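(* Let $k$ be a field, let $d\ge 3$ be an integer, and let $G$ be a graph on $[n]$ with $\Delta(G)\le d$. (1) If $G$ is a tree, then $\operatorname{reg}(S/L_G(d)^s)=2s+n-3$ for all $s\ge1$. (2) If $G$ is a connected unicyclic graph, then $\operatorname{reg}(S/L_G(d)^s)=2s+n-2$ for all $s\ge1$.
   Context: Graphs are finite, simple and undirected, with vertex set $V(G)=[n]=\{1,\dots,n\}$ and edge set $E(G)$. $\Delta(G)$ is the maximal degree of a vertex of $G$. $G$ is unicyclic if it contains precisely one cycle as a subgraph. For a field $k$ and $d\ge1$, the LSS-ideal of $G$ is $$L_G(d)=\Big(f_e^{(d)}=\sum_{\ell=1}^d x_{i\ell}x_{j\ell}\ :\ e=\{i,j\}\in E(G)\Big)\subset S=k[x_{ij}: i\in[n],\ j\in[d]],$$ with $S$ standard graded. For a finitely generated graded $S$-module $M$, $\operatorname{reg}(M)=\max\{j-i:\operatorname{Tor}_i^S(M,k)_j\ne0\}$ is the Castelnuovo–Mumford regularity over $S$.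
   Formalization: In part (1) the case n = 1 with s ≥ 2 is excluded: there G is a single vertex, L_G(d) = 0 and reg(S/L_G(d)^s) = reg(S) = 0, whereas the formula 2s+n-3 would give 2s-2 > 0. *)

theory Defs
  imports "HOL-Library.Cardinality" "HOL-Library.Poly_Mapping" "Jordan_Normal_Form.Matrix"
begin

section \<open>Graphs\<close>

text \<open>A graph is given by its edge set; its vertices are all elements of the finite vertex type.\<close>

definition simple_graph :: "'n set set \<Rightarrow> bool" where
  "simple_graph E \<longleftrightarrow> (\<forall>e\<in>E. card e = 2)"

definition vertex_degree :: "'n set set \<Rightarrow> 'n \<Rightarrow> nat" where
  "vertex_degree E v = card {e \<in> E. v \<in> e}"

definition max_degree :: "'n::finite set set \<Rightarrow> nat" where
  "max_degree E = Max (range (vertex_degree E))"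

definition connected_graph :: "'n set set \<Rightarrow> bool" where
  "connected_graph E \<longleftrightarrow> (\<forall>u v. (u, v) \<in> {(a, b). {a, b} \<in> E}\<^sup>*)"

text \<open>A cycle, as a subgraph, is identified with its edge set, so that the choice of a starting
  vertex and of an orientation is irrelevant.\<close>

definition cycle_in :: "'n set set \<Rightarrow> 'n set set \<Rightarrow> bool" where
  "cycle_in E C \<longleftrightarrow> C \<subseteq> E \<and>
    (\<exists>vs. distinct vs \<and> length vs \<ge> 3 \<and>
      C = {{vs ! i, vs ! (Suc i mod length vs)} | i. i < length vs})"

definition tree :: "'n set set \<Rightarrow> bool" where
  "tree E \<longleftrightarrow> connected_graph E \<and> (\<nexists>C. cycle_in E C)"

definition unicyclic :: "'n set set \<Rightarrow> bool" where
  "unicyclic E \<longleftrightarrow> (\<exists>!C. cycle_in E C)"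


section \<open>Polynomials and ideals\<close>

type_synonym ('v, 'k) mpoly = "('v \<Rightarrow>\<^sub>0 nat) \<Rightarrow>\<^sub>0 'k"

definition var :: "'v \<Rightarrow> ('v, 'k::comm_ring_1) mpoly" where
  "var v = Poly_Mapping.single (Poly_Mapping.single v 1) 1"

text \<open>The degree is an integer since shifts may be negative; the only polynomial that is
  homogeneous of negative degree is 0.\<close>

definition homogeneous :: "('v, 'k::zero) mpoly \<Rightarrow> int \<Rightarrow> bool" where
  "homogeneous p t \<longleftrightarrow> (\<forall>m \<in> Poly_Mapping.keys p. (\<Sum>v\<in>Poly_Mapping.keys m. int (Poly_Mapping.lookup m v)) = t)"

definition ideal_gen :: "'a::comm_ring_1 set \<Rightarrow> 'a set" where
  "ideal_gen B = Modules.module.span (*) B"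

definition ideal_power :: "'a::comm_ring_1 set \<Rightarrow> nat \<Rightarrow> 'a set" where
  "ideal_power I s = ideal_gen {\<Prod>t<s. f t | f. \<forall>t<s. f t \<in> I}"

text \<open>With vertex type \<^typ>\<open>'n\<close> in the role of the index set of size \<open>n\<close> and \<^typ>\<open>'d\<close> in the role
  of the index set of size \<open>d\<close>, the ambient polynomial ring is the whole type
  \<^typ>\<open>('n \<times> 'd, 'k) mpoly\<close>.\<close>

definition LSS_ideal :: "'n set set \<Rightarrow> ('n \<times> 'd::finite, 'k::field) mpoly set" where
  "LSS_ideal E = ideal_gen {\<Sum>l\<in>UNIV. var (i, l) * var (j, l) | i j. {i, j} \<in> E}"


section \<open>Tor and regularity of a graded quotient ring\<close>

text \<open>
  \<open>graded_free_resolution I rk dg e D\<close>: the data form a graded resolution of \<open>S/I\<close>, with \<open>S\<close> the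
  polynomial ring and \<open>I\<close> a homogeneous ideal, by free modules of finite rank
  \<open>\<dots> \<rightarrow> F_2 \<rightarrow> F_1 \<rightarrow> F_0 \<rightarrow> S/I \<rightarrow> 0\<close>.
  Here \<open>F_i = S^(rk i)\<close>, its \<open>q\<close>-th basis vector has degree \<open>dg i q\<close>, and \<open>D i\<close> is the matrix of the
  differential \<open>F_(i+1) \<rightarrow> F_i\<close>. The augmentation is the composition of \<open>v \<mapsto> e \<bullet> v\<close> with the
  projection \<open>S \<rightarrow> S/I\<close>. All maps have degree 0.
\<close>

definition graded_free_resolution ::
  "('v, 'k::field) mpoly set \<Rightarrow> (nat \<Rightarrow> nat) \<Rightarrow> (nat \<Rightarrow> nat \<Rightarrow> int) \<Rightarrow>
    ('v, 'k) mpoly vec \<Rightarrow> (nat \<Rightarrow> ('v, 'k) mpoly mat) \<Rightarrow> bool" where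
  "graded_free_resolution I rk dg e D \<longleftrightarrow>
    e \<in> carrier_vec (rk 0) \<and>
    (\<forall>q<rk 0. homogeneous (e $ q) (dg 0 q)) \<and>
    (\<forall>i. D i \<in> carrier_mat (rk i) (rk (Suc i)) \<and>
      (\<forall>p<rk i. \<forall>q<rk (Suc i). homogeneous (D i $$ (p, q)) (dg (Suc i) q - dg i p))) \<and>
    (\<forall>f. \<exists>v\<in>carrier_vec (rk 0). f - e \<bullet> v \<in> I) \<and>
    {v \<in> carrier_vec (rk 0). e \<bullet> v \<in> I} = (\<lambda>w. D 0 *\<^sub>v w) ` carrier_vec (rk 1) \<and>
    (\<forall>i. {v \<in> carrier_vec (rk (Suc i)). D i *\<^sub>v v = 0\<^sub>v (rk i)} =
      (\<lambda>w. D (Suc i) *\<^sub>v w) ` carrier_vec (rk (Suc (Suc i))))"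

text \<open>
  Let \<open>k = S/(all variables)\<close>. Then \<open>F_i \<otimes>\<^sub>S k\<close> is \<open>k^(rk i)\<close>, graded by the degrees of its basis, and
  the differential induced by \<open>D i\<close> is obtained by replacing each entry by its constant term.
\<close>

definition tensor_diff :: "('v, 'k::field) mpoly mat \<Rightarrow> 'k mat" where
  "tensor_diff A = map_mat (\<lambda>p. Poly_Mapping.lookup p 0) A"

definition tensor_strand :: "nat \<Rightarrow> (nat \<Rightarrow> int) \<Rightarrow> int \<Rightarrow> 'k::field vec set" where
  "tensor_strand r a j = {v \<in> carrier_vec r. \<forall>p<r. v $ p \<noteq> 0 \<longrightarrow> a p = j}"

definition tor_cycles ::
  "(nat \<Rightarrow> nat) \<Rightarrow> (nat \<Rightarrow> nat \<Rightarrow> int) \<Rightarrow> (nat \<Rightarrow> ('v, 'k::field) mpoly mat) \<Rightarrow>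
    nat \<Rightarrow> int \<Rightarrow> 'k vec set" where
  "tor_cycles rk dg D i j = {v \<in> tensor_strand (rk i) (dg i) j.
    \<forall>i'. i = Suc i' \<longrightarrow> tensor_diff (D i') *\<^sub>v v = 0\<^sub>v (rk i')}"

definition tor_boundaries ::
  "(nat \<Rightarrow> nat) \<Rightarrow> (nat \<Rightarrow> nat \<Rightarrow> int) \<Rightarrow> (nat \<Rightarrow> ('v, 'k::field) mpoly mat) \<Rightarrow>
    nat \<Rightarrow> int \<Rightarrow> 'k vec set" where
  "tor_boundaries rk dg D i j =
    (\<lambda>w. tensor_diff (D i) *\<^sub>v w) ` tensor_strand (rk (Suc i)) (dg (Suc i)) j"

text \<open>\<open>tor_nonzero I i j\<close> says that \<open>Tor_i(S/I, k)_j \<noteq> 0\<close>. Up to isomorphism Tor does not depend on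
  the resolution, so it does not matter which one is used.\<close>

definition tor_nonzero :: "('v, 'k::field) mpoly set \<Rightarrow> nat \<Rightarrow> int \<Rightarrow> bool" where
  "tor_nonzero I i j \<longleftrightarrow> (\<exists>rk dg e D. graded_free_resolution I rk dg e D \<and>
    tor_cycles rk dg D i j \<noteq> tor_boundaries rk dg D i j)"

text \<open>The regularity of \<open>S/I\<close>. The set is finite and nonempty for a proper homogeneous ideal \<open>I\<close> in
  finitely many variables.\<close>

definition reg_quotient :: "('v, 'k::field) mpoly set \<Rightarrow> int" where
  "reg_quotient I = Max {j - int i | i j. tor_nonzero I i j}"

end

theory Submission
  imports Defs "HOL-Library.Product_Lexorder" "HOL-Computational_Algebra.Primes"
begin

text \<open>
  Let \<open>I\<close> be generated by a regular sequence of \<open>r \<ge> 1\<close> forms of degree \<open>c \<ge> 1\<close>. Then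
  \<open>reg (S/I^s) = c (s + r - 1) - r\<close> for \<open>s \<ge> 1\<close>. For \<open>c = 2\<close> this is \<open>2 s + r - 2\<close>, and the number \<open>r\<close> of edges
  is \<open>n - 1\<close> for a tree and \<open>n\<close> for a connected unicyclic graph. So the theorem says two things:
  the formula for powers, and that the quadrics \<open>f_e\<close> form a regular sequence.

  The formula. Let \<open>f\<close> be the last form of the sequence and \<open>Q\<close> the ideal of the other ones.
  Then \<open>I^s : f = I^(s-1)\<close> and \<open>I^s + (f) = Q^s + (f)\<close>, and \<open>f\<close> is a nonzerodivisor modulo \<open>Q^s\<close>
  (\<open>ipow_colon\<close>, \<open>add_principal_ipow\<close>, \<open>nonzerodivisor_mod_ipow\<close>). The mapping cone of the
  multiplication by \<open>f\<close> on a resolution of \<open>S/Q^s\<close> resolves \<open>S/(Q^s + (f))\<close>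
  (\<open>mapping_cone_resolution\<close>). The horseshoe lemma for
  \<open>0 \<rightarrow> S/I^(s-1) (-c) \<rightarrow> S/I^s \<rightarrow> S/(Q^s + (f)) \<rightarrow> 0\<close> then gives a resolution of \<open>S/I^s\<close>
  (\<open>horseshoe_resolution\<close>), by induction on \<open>r\<close> and \<open>s\<close>. It is not minimal, but it suffices to know
  in which homological positions \<open>i\<close> and degrees \<open>j\<close> it has basis elements: always \<open>i \<le> r\<close> and
  \<open>j \<le> c (s + i - 1)\<close>, and the pair \<open>(r, c (s + r - 1))\<close> occurs (\<open>resolution_support_ipow\<close>).
  Since graded free resolutions are unique up to homotopy, Tor computed from any resolution lives
  in these pairs (\<open>tor_nonzero_imp_support\<close>). In degree \<open>c (s + r - 1)\<close> there is nothing in the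
  positions \<open>r - 1\<close> and \<open>r + 1\<close>, so the class in position \<open>r\<close> survives (\<open>tor_nonzero_isolated\<close>).

  The regular sequence. Polynomials with pairwise coprime leading monomials form a regular sequence
  (\<open>regular_sequence_coprime_leading\<close>). The leading monomial of \<open>f_e\<close> can be made
  \<open>x_(i,l) x_(j,l)\<close> with \<open>l\<close> the colour of the edge \<open>e = {i, j}\<close>, where edges of equal colour are
  disjoint, provided that the variables have weights for which this is the heaviest term of
  each \<open>f_e\<close> (\<open>positive_colouring\<close>). Such a colouring extends along a new leaf \<open>q\<close> with
  neighbour \<open>p\<close>: as the degree of \<open>p\<close> is at most \<open>d\<close>, a colour \<open>k\<close> is still free at \<open>p\<close>, and a huge weight
  for \<open>x_(q,k)\<close> makes the term of colour \<open>k\<close> the heaviest one (\<open>positive_colouring_add_leaf\<close>).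
  A tree grows from a vertex by adding leaves, a connected unicyclic graph from its cycle, and for
  a cycle three colours suffice (\<open>positive_colouring_cycle\<close>).
\<close>

section \<open>Ideals and their powers\<close>

interpretation ideal: Modules.module "(*) :: 'a::comm_ring_1 \<Rightarrow> 'a \<Rightarrow> 'a"
  by unfold_locales (auto simp: algebra_simps)

text \<open>
  As a rewrite rule, associativity from right to left would loop with \<open>algebra_simps\<close>.
\<close>

declare ideal.scale_scale [simp del]

abbreviation is_ideal :: "'a::comm_ring_1 set \<Rightarrow> bool" where
  "is_ideal \<equiv> ideal.subspace"

lemma ideal_mult_right: "is_ideal I \<Longrightarrow> a \<in> I \<Longrightarrow> a * c \<in> I"
  using ideal.subspace_scale[of I a c] by (simp add: mult.commute)

lemma is_ideal_colon:
  assumes "is_ideal J"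
  shows "is_ideal {a. f * a \<in> J}"
proof (rule ideal.subspaceI)
  show "c * a \<in> {a. f * a \<in> J}" if "a \<in> {a. f * a \<in> J}" for c a
    using that ideal.subspace_scale[OF assms, of "f * a" c] by (simp add: mult.left_commute)
qed (use ideal.subspace_0[OF assms] ideal.subspace_add[OF assms] in \<open>auto simp: distrib_left\<close>)

lemma is_ideal_ideal_gen [simp]: "is_ideal (ideal_gen B)"
  by (simp add: ideal_gen_def)

lemma ideal_gen_minimal: "B \<subseteq> I \<Longrightarrow> is_ideal I \<Longrightarrow> ideal_gen B \<subseteq> I"
  by (simp add: ideal_gen_def ideal.span_minimal)

lemma ideal_gen_base: "a \<in> B \<Longrightarrow> a \<in> ideal_gen B"
  by (simp add: ideal_gen_def ideal.span_base)

lemma ideal_gen_mono: "A \<subseteq> B \<Longrightarrow> ideal_gen A \<subseteq> ideal_gen B"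
  by (simp add: ideal_gen_def ideal.span_mono)

lemma ideal_gen_insert: "x \<in> ideal_gen (insert f B) \<longleftrightarrow> (\<exists>k. x - k * f \<in> ideal_gen B)"
  by (simp add: ideal_gen_def ideal.span_breakdown_eq)

definition ideal_prod :: "'a::comm_ring_1 set \<Rightarrow> 'a set \<Rightarrow> 'a set" where
  "ideal_prod A B = ideal_gen {a * b | a b. a \<in> A \<and> b \<in> B}"

text \<open>
  The power of an ideal in the recursive form that suits induction;
  \<open>ideal_power_eq_ipow\<close> identifies it with \<^const>\<open>ideal_power\<close>.
\<close>

fun ipow :: "'a::comm_ring_1 set \<Rightarrow> nat \<Rightarrow> 'a set" where
  "ipow I 0 = UNIV"
| "ipow I (Suc t) = ideal_prod I (ipow I t)"

lemma is_ideal_ideal_prod [simp]: "is_ideal (ideal_prod A B)"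
  by (simp add: ideal_prod_def)

lemma is_ideal_ipow [simp]: "is_ideal (ipow I t)"
  by (cases t) auto

lemma ideal_prod_memI: "a \<in> A \<Longrightarrow> b \<in> B \<Longrightarrow> a * b \<in> ideal_prod A B"
  unfolding ideal_prod_def by (rule ideal_gen_base) blast

lemma ideal_prod_minimal:
  "(\<And>a b. a \<in> A \<Longrightarrow> b \<in> B \<Longrightarrow> a * b \<in> C) \<Longrightarrow> is_ideal C \<Longrightarrow> ideal_prod A B \<subseteq> C"
  unfolding ideal_prod_def by (rule ideal_gen_minimal) auto

lemma ideal_prod_mono: "A \<subseteq> A' \<Longrightarrow> B \<subseteq> B' \<Longrightarrow> ideal_prod A B \<subseteq> ideal_prod A' B'"
  unfolding ideal_prod_def by (rule ideal_gen_mono) auto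

lemma ideal_prod_subset_right: "is_ideal B \<Longrightarrow> ideal_prod A B \<subseteq> B"
  by (rule ideal_prod_minimal) (auto intro: ideal.subspace_scale)

lemma ideal_prod_UNIV: "is_ideal B \<Longrightarrow> ideal_prod UNIV B = B"
  using ideal_prod_subset_right[of B UNIV] ideal_prod_memI[of 1 UNIV _ B]
  by (metis UNIV_I mult_1 subsetI subset_antisym)

lemma ideal_prod_UNIV_right: "is_ideal K \<Longrightarrow> ideal_prod K UNIV = K"
  using ideal_prod_minimal[of K UNIV K] ideal_mult_right[of K] ideal_prod_memI[of _ K 1 UNIV]
  by (metis UNIV_I mult.right_neutral subsetI subset_antisym)

lemma ipow_mono: "I \<subseteq> J \<Longrightarrow> ipow I t \<subseteq> ipow J t"
  by (induction t) (simp_all add: ideal_prod_mono)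

lemma ipow_Suc_subset: "ipow I (Suc t) \<subseteq> ipow I t"
  by (simp add: ideal_prod_subset_right)

text \<open>
  A product of \<open>s + 1\<close> elements is one of \<open>s\<close> elements times one more element; for the
  converse, multiplication by a fixed \<open>a \<in> I\<close> maps the generators of the \<open>s\<close>-th power to generators
  of the next one.
\<close>

lemma ideal_power_eq_ipow:
  assumes "is_ideal I"
  shows "ideal_power I s = ipow I s"
proof (induction s)
  case 0
  have "ideal_power I 0 = ideal_gen {1}"
    unfolding ideal_power_def by (rule arg_cong[of _ _ ideal_gen]) auto
  also have "\<dots> = UNIV"
    using ideal.subspace_scale[OF is_ideal_ideal_gen, of 1 "{1}"] ideal_gen_base[of 1 "{1}"]
    by auto
  finally show ?case by simp
next
  case (Suc s)
  have "ideal_power I (Suc s) \<subseteq> ideal_prod I (ideal_power I s)"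
    unfolding ideal_power_def[of _ "Suc s"]
  proof (rule ideal_gen_minimal, clarify)
    fix f assume f: "\<forall>t<Suc s. f t \<in> I"
    have "(\<Prod>t<s. f t) \<in> ideal_power I s"
      unfolding ideal_power_def using f by (intro ideal_gen_base) auto
    then show "(\<Prod>t<Suc s. f t) \<in> ideal_prod I (ideal_power I s)"
      using ideal_prod_memI[of "f s" I "\<Prod>t<s. f t"] f by (simp add: mult.commute)
  qed simp
  moreover have "ideal_prod I (ideal_power I s) \<subseteq> ideal_power I (Suc s)"
  proof (rule ideal_prod_minimal)
    fix a b assume a: "a \<in> I" and b: "b \<in> ideal_power I s"
    have "ideal_power I s \<subseteq> {b. a * b \<in> ideal_power I (Suc s)}"
      unfolding ideal_power_def[of _ s]
    proof (rule ideal_gen_minimal, clarify)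
      fix f assume f: "\<forall>t<s. f t \<in> I"
      have "(\<Prod>t<Suc s. (f(s := a)) t) \<in> ideal_power I (Suc s)"
        unfolding ideal_power_def using f a
        by (intro ideal_gen_base CollectI exI[of _ "f(s := a)"]) auto
      then show "a * (\<Prod>t<s. f t) \<in> ideal_power I (Suc s)"
        by (simp add: mult.commute)
    next
      show "is_ideal {b. a * b \<in> ideal_power I (Suc s)}"
        by (rule is_ideal_colon) (simp add: ideal_power_def)
    qed
    then show "a * b \<in> ideal_power I (Suc s)" using b by blast
  qed (simp add: ideal_power_def)
  ultimately show ?case using Suc by auto
qed

lemma is_ideal_sum_mult:
  assumes "is_ideal A" and "is_ideal B"
  shows "is_ideal {a + f * b | a b. a \<in> A \<and> b \<in> B}" (is "is_ideal ?S")
proof (rule ideal.subspaceI)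
  show "0 \<in> ?S"
    using ideal.subspace_0[OF assms(1)] ideal.subspace_0[OF assms(2)]
    by (auto intro!: exI[of _ 0])
next
  fix x y assume "x \<in> ?S" "y \<in> ?S"
  then obtain a b a' b' where xy: "x = a + f * b" "a \<in> A" "b \<in> B"
    "y = a' + f * b'" "a' \<in> A" "b' \<in> B" by auto
  have "x + y = (a + a') + f * (b + b')" using xy by (simp add: algebra_simps)
  moreover have "a + a' \<in> A" "b + b' \<in> B"
    using xy ideal.subspace_add[OF assms(1)] ideal.subspace_add[OF assms(2)] by auto
  ultimately show "x + y \<in> ?S" by auto
next
  fix c x assume "x \<in> ?S"
  then obtain a b where x: "x = a + f * b" "a \<in> A" "b \<in> B" by auto
  have "c * x = c * a + f * (c * b)" using x by (simp add: algebra_simps)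
  moreover have "c * a \<in> A" "c * b \<in> B"
    using x ideal.subspace_scale[OF assms(1)] ideal.subspace_scale[OF assms(2)] by auto
  ultimately show "c * x \<in> ?S" by auto
qed

text \<open>
  A product of \<open>t + 1\<close> elements of \<open>I = Q + (f)\<close> is, up to multiples of \<open>f\<close> by products of \<open>t\<close> elements,
  a product of elements of \<open>Q\<close>. This expansion, multiplied by an arbitrary ideal \<open>K\<close>, replaces the bookkeeping with monomials in the generators.
\<close>

lemma ideal_prod_ipow_insert:
  assumes "is_ideal K" and "I = ideal_gen (insert f B)" and "Q = ideal_gen B"
  shows "ideal_prod K (ipow I (Suc t)) =
    {q + f * u | q u. q \<in> ideal_prod K (ipow Q (Suc t)) \<and> u \<in> ideal_prod K (ipow I t)}"
    (is "_ = ?R K t")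
proof -
  have QI: "Q \<subseteq> I" using assms by (auto intro: ideal_gen_mono[THEN subsetD])
  have fI: "f \<in> I" using assms by (auto intro: ideal_gen_base)
  have Isplit: "\<exists>q c. b = q + c * f \<and> q \<in> Q" if "b \<in> I" for b
    using that ideal_gen_insert[of b f B] assms
    by (metis diff_add_cancel)
  have sup: "?R K t \<subseteq> ideal_prod K (ipow I (Suc t))" if "is_ideal K" for K t
  proof clarify
    fix q u assume q: "q \<in> ideal_prod K (ipow Q (Suc t))" and u: "u \<in> ideal_prod K (ipow I t)"
    have "ideal_prod K (ipow I t) \<subseteq> {u. f * u \<in> ideal_prod K (ipow I (Suc t))}"
    proof (rule ideal_prod_minimal)
      fix a b assume "a \<in> K" "b \<in> ipow I t"
      then have "a * (f * b) \<in> ideal_prod K (ipow I (Suc t))"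
        using fI by (auto intro!: ideal_prod_memI)
      then show "a * b \<in> {u. f * u \<in> ideal_prod K (ipow I (Suc t))}"
        by (simp add: algebra_simps)
    next
      show "is_ideal {u. f * u \<in> ideal_prod K (ipow I (Suc t))}"
        by (rule is_ideal_colon) simp
    qed
    moreover have "q \<in> ideal_prod K (ipow I (Suc t))"
      using q ideal_prod_mono[OF order_refl ipow_mono[OF QI]] by blast
    ultimately show "q + f * u \<in> ideal_prod K (ipow I (Suc t))"
      using u ideal.subspace_add[OF is_ideal_ideal_prod] by blast
  qed
  have idR: "is_ideal (?R K t)" for K t
    by (rule is_ideal_sum_mult) auto
  have split: "ipow I (Suc t) \<subseteq> {q + f * u | q u. q \<in> ipow Q (Suc t) \<and> u \<in> ipow I t}" for t
  proof (induction t)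
    case 0
    show ?case
    proof
      fix x assume "x \<in> ipow I (Suc 0)"
      then have "x \<in> I" using ideal_prod_UNIV_right[of I] assms by simp
      then obtain q c where x: "x = q + c * f" "q \<in> Q" using Isplit by blast
      then have "q \<in> ipow Q (Suc 0)" using ideal_prod_memI[of q Q 1 UNIV] by simp
      then show "x \<in> {q + f * u | q u. q \<in> ipow Q (Suc 0) \<and> u \<in> ipow I 0}"
        using x by (auto simp: mult.commute)
    qed
  next
    case (Suc t)
    let ?S = "{q + f * u | q u. q \<in> ipow Q (Suc (Suc t)) \<and> u \<in> ipow I (Suc t)}"
    have "ideal_prod I (ipow I (Suc t)) \<subseteq> ?S"
    proof (rule ideal_prod_minimal)
      fix b c assume b: "b \<in> I" and c: "c \<in> ipow I (Suc t)"
      obtain q e where q: "b = q + e * f" "q \<in> Q" using Isplit b by blast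
      obtain c1 c2 where c12: "c = c1 + f * c2" "c1 \<in> ipow Q (Suc t)" "c2 \<in> ipow I t"
        using Suc c by blast
      have "b * c = q * c1 + f * (q * c2 + e * c)"
        using q c12 by (simp add: algebra_simps)
      moreover have "q * c1 \<in> ipow Q (Suc (Suc t))"
        using q c12 ideal_prod_memI[of q Q c1 "ipow Q (Suc t)"] by simp
      moreover have "q * c2 + e * c \<in> ipow I (Suc t)"
      proof (rule ideal.subspace_add[OF is_ideal_ipow])
        show "q * c2 \<in> ipow I (Suc t)"
          using q c12 QI ideal_prod_memI[of q I c2 "ipow I t"] by auto
        show "e * c \<in> ipow I (Suc t)"
          by (rule ideal.subspace_scale[OF is_ideal_ipow c])
      qed
      ultimately show "b * c \<in> ?S" by blast
    qed (rule is_ideal_sum_mult; simp)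
    then show ?case by simp
  qed
  have "ideal_prod K (ipow I (Suc t)) \<subseteq> ?R K t"
  proof (rule ideal_prod_minimal[OF _ idR])
    fix a b assume a: "a \<in> K" and "b \<in> ipow I (Suc t)"
    then obtain q u where b: "b = q + f * u" "q \<in> ipow Q (Suc t)" "u \<in> ipow I t"
      using split by blast
    have "a * b = a * q + f * (a * u)" using b by (simp add: algebra_simps)
    then show "a * b \<in> ?R K t"
      using a b ideal_prod_memI by blast
  qed
  with sup[OF assms(1)] show ?thesis by blast
qed

lemma ipow_insert:
  assumes "I = ideal_gen (insert f B)" and "Q = ideal_gen B"
  shows "ipow I (Suc t) = {q + f * u | q u. q \<in> ipow Q (Suc t) \<and> u \<in> ipow I t}"
  using ideal_prod_ipow_insert[OF ideal.subspace_UNIV assms, of t]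
  by (simp only: ideal_prod_UNIV[OF is_ideal_ipow])

section \<open>Regular sequences\<close>

definition nonzerodivisor_mod :: "'a::comm_ring_1 \<Rightarrow> 'a set \<Rightarrow> bool" where
  "nonzerodivisor_mod x I \<longleftrightarrow> (\<forall>a. x * a \<in> I \<longrightarrow> a \<in> I)"

text \<open>
  The head is the last element of the sequence, so that the inductions below append a form by
  \<^const>\<open>Cons\<close>. The quotient by the generated ideal may be zero.
\<close>

fun regular_sequence :: "'a::comm_ring_1 list \<Rightarrow> bool" where
  "regular_sequence [] \<longleftrightarrow> True"
| "regular_sequence (f # fs) \<longleftrightarrow> regular_sequence fs \<and> nonzerodivisor_mod f (ideal_gen (set fs))"

text \<open>
  For \<open>I\<close> generated by a regular sequence and \<open>K \<supseteq> I\<close>, the module \<open>I^t / K I^t\<close> is a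
  direct sum of copies of \<open>S/K\<close>, so a nonzerodivisor \<open>x\<close> on \<open>S/K\<close> is one on it. This is the quasi-regularity
  of regular sequences, in a form without coordinates. With \<open>q = q' + f u\<close>, where \<open>q' \<in> Q^t\<close> and \<open>u \<in> I^(t-1)\<close>,
  and \<open>x q = w + f v\<close>, where \<open>w \<in> K Q^t\<close> and \<open>v \<in> K I^(t-1)\<close>, one gets
  \<open>f (x u - v) = w - x q' \<in> Q^t\<close>. As \<open>f\<close> is a nonzerodivisor modulo \<open>Q^t\<close>, this gives \<open>x u - v \<in> Q^t\<close>, and
  the induction hypotheses apply to \<open>q'\<close> and to \<open>u\<close>.
\<close>

lemma nonzerodivisor_mod_ideal_prod_ipow:
  assumes "regular_sequence fs" and "is_ideal K" and "ideal_gen (set fs) \<subseteq> K"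
    and "nonzerodivisor_mod x K"
    and "q \<in> ipow (ideal_gen (set fs)) t"
    and "x * q \<in> ideal_prod K (ipow (ideal_gen (set fs)) t)"
  shows "q \<in> ideal_prod K (ipow (ideal_gen (set fs)) t)"
  using assms
proof (induction fs arbitrary: K x q t)
  case Nil
  show ?case
  proof (cases t)
    case 0
    then show ?thesis using Nil ideal_prod_UNIV_right[OF Nil(2)] by (auto simp: nonzerodivisor_mod_def)
  next
    case (Suc t')
    have "ipow (ideal_gen {}) t \<subseteq> {0::'a}"
      unfolding Suc ipow.simps by (rule ideal_prod_minimal) (auto simp: ideal_gen_def)
    then have "q = 0" using Nil by auto
    then show ?thesis using ideal.subspace_0 is_ideal_ideal_prod by blast
  qed
next
  case (Cons f fs)
  define Q where "Q = ideal_gen (set fs)"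
  define I where "I = ideal_gen (set (f # fs))"
  have QI: "Q \<subseteq> I" unfolding Q_def I_def by (rule ideal_gen_mono) auto
  have reg: "regular_sequence fs" "nonzerodivisor_mod f Q" using Cons(2) by (auto simp: Q_def)
  have QK: "Q \<subseteq> K" and fK: "f \<in> K"
    using Cons(4) QI by (auto simp: I_def intro: ideal_gen_base)
  \<comment> \<open>The induction hypothesis with \<open>K = Q\<close>, climbing along the powers of \<open>Q\<close>.\<close>
  have nzd: "nonzerodivisor_mod f (ipow Q t)" for t
    unfolding nonzerodivisor_mod_def
  proof (induction t)
    case (Suc t)
    show ?case
    proof clarify
      fix a assume a: "f * a \<in> ipow Q (Suc t)"
      then have "a \<in> ipow Q t" using Suc ipow_Suc_subset by blast
      then show "a \<in> ipow Q (Suc t)"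
        using Cons.IH[of Q f a t] reg a by (simp add: Q_def)
    qed
  qed simp
  have "q \<in> ipow I t \<Longrightarrow> x * q \<in> ideal_prod K (ipow I t) \<Longrightarrow> q \<in> ideal_prod K (ipow I t)"
  proof (induction t arbitrary: q)
    case 0
    then show ?case using ideal_prod_UNIV_right[OF Cons(3)] Cons(5) by (auto simp: nonzerodivisor_mod_def)
  next
    case (Suc t)
    note ins = ipow_insert[of I f "set fs" Q t] ideal_prod_ipow_insert[OF Cons(3), of I f "set fs" Q t]
    obtain q' u where q: "q = q' + f * u" "q' \<in> ipow Q (Suc t)" "u \<in> ipow I t"
      using Suc(2) ins by (auto simp: I_def Q_def simp del: ipow.simps)
    obtain w v where xq: "x * q = w + f * v" "w \<in> ideal_prod K (ipow Q (Suc t))"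
      "v \<in> ideal_prod K (ipow I t)"
      using Suc(3) ins by (auto simp: I_def Q_def simp del: ipow.simps)
    have eq: "f * (x * u - v) = w - x * q'" using q xq by (simp add: algebra_simps)
    have "w \<in> ipow Q (Suc t)" using xq(2) ideal_prod_subset_right is_ideal_ipow by blast
    then have "w - x * q' \<in> ipow Q (Suc t)"
      using q(2) ideal.subspace_diff[OF is_ideal_ipow] ideal.subspace_scale[OF is_ideal_ipow] by blast
    then have z: "x * u - v \<in> ipow Q (Suc t)"
      using nzd[of "Suc t"] eq by (metis nonzerodivisor_mod_def)
    have "x * q' = w - f * (x * u - v)" using eq by simp
    moreover have "f * (x * u - v) \<in> ideal_prod K (ipow Q (Suc t))"
      by (rule ideal_prod_memI[OF fK z])
    ultimately have "x * q' \<in> ideal_prod K (ipow Q (Suc t))"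
      using xq(2) ideal.subspace_diff[OF is_ideal_ideal_prod] by simp
    then have q': "q' \<in> ideal_prod K (ipow Q (Suc t))"
      using Cons.IH[OF reg(1) Cons(3) _ Cons(5), of q' "Suc t"] q(2) QK by (simp add: Q_def del: ipow.simps)
    have "ipow Q (Suc t) \<subseteq> ideal_prod K (ipow I t)"
      unfolding ipow.simps by (rule ideal_prod_mono[OF QK ipow_mono[OF QI]])
    then have "v + (x * u - v) \<in> ideal_prod K (ipow I t)"
      using z xq(3) ideal.subspace_add[OF is_ideal_ideal_prod] by blast
    then have "u \<in> ideal_prod K (ipow I t)" using Suc.IH[of u] q(3) by simp
    then show ?case using ins(2) q(1) q' by (auto simp: I_def Q_def simp del: ipow.simps)
  qed
  then show ?case using Cons(6,7) unfolding I_def .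
qed

text \<open>
  Climb along the powers: if \<open>x a \<in> I^(t+1)\<close>, then \<open>a \<in> I^t\<close> by induction, and
  \<open>x a \<in> I I^t\<close> forces \<open>a \<in> I I^t\<close> by the previous lemma with \<open>K = I\<close>.
\<close>

lemma nonzerodivisor_mod_ipow:
  assumes "regular_sequence fs" and "nonzerodivisor_mod x (ideal_gen (set fs))"
  shows "nonzerodivisor_mod x (ipow (ideal_gen (set fs)) t)"
  unfolding nonzerodivisor_mod_def
proof (induction t)
  case (Suc t)
  show ?case
  proof clarify
    fix a assume a: "x * a \<in> ipow (ideal_gen (set fs)) (Suc t)"
    then have "a \<in> ipow (ideal_gen (set fs)) t" using Suc ipow_Suc_subset by blast
    then show "a \<in> ipow (ideal_gen (set fs)) (Suc t)"
      using nonzerodivisor_mod_ideal_prod_ipow[of fs "ideal_gen (set fs)" x a t] assms a by simp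
  qed
qed simp

text \<open>
  If \<open>f a = q + f u\<close> with \<open>q \<in> Q^(t+1)\<close> and \<open>u \<in> I^t\<close>, then
  \<open>f (a - u) \<in> Q^(t+1)\<close>, so \<open>a - u \<in> Q^(t+1)\<close>, because \<open>f\<close> is a nonzerodivisor modulo that power.
\<close>

lemma ipow_colon:
  assumes "regular_sequence (f # fs)"
  shows "f * a \<in> ipow (ideal_gen (set (f # fs))) (Suc t) \<longleftrightarrow> a \<in> ipow (ideal_gen (set (f # fs))) t"
proof
  define I where "I = ideal_gen (set (f # fs))"
  define Q where "Q = ideal_gen (set fs)"
  note ins = ipow_insert[of I f "set fs" Q t]
  assume "f * a \<in> ipow (ideal_gen (set (f # fs))) (Suc t)"
  then obtain q u where fa: "f * a = q + f * u" "q \<in> ipow Q (Suc t)" "u \<in> ipow I t"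
    using ins by (auto simp: I_def Q_def simp del: ipow.simps)
  have "f * (a - u) = q" using fa by (simp add: algebra_simps)
  then have "a - u \<in> ipow Q (Suc t)"
    using nonzerodivisor_mod_ipow[of fs f "Suc t"] assms fa(2)
    by (auto simp: nonzerodivisor_mod_def Q_def simp del: ipow.simps)
  moreover have "ipow Q (Suc t) \<subseteq> ipow I t"
    using ipow_Suc_subset[of Q t] ipow_mono[of Q I t] ideal_gen_mono[of "set fs" "set (f # fs)"]
    by (auto simp: I_def Q_def)
  ultimately have "u + (a - u) \<in> ipow I t"
    using fa(3) ideal.subspace_add[OF is_ideal_ipow] by blast
  then show "a \<in> ipow (ideal_gen (set (f # fs))) t" by (simp add: I_def)
next
  assume "a \<in> ipow (ideal_gen (set (f # fs))) t"
  then show "f * a \<in> ipow (ideal_gen (set (f # fs))) (Suc t)"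
    by (auto intro!: ideal_prod_memI ideal_gen_base)
qed

definition add_principal :: "'a::comm_ring_1 set \<Rightarrow> 'a \<Rightarrow> 'a set" where
  "add_principal I g = {i + g * a | i a. i \<in> I}"

text \<open>
  Modulo \<open>f\<close>, only the summand \<open>Q^(t+1)\<close> in the expansion of \<open>I^(t+1)\<close> survives.
\<close>

lemma add_principal_ipow:
  "add_principal (ipow (ideal_gen (set (f # fs))) (Suc t)) f =
   add_principal (ipow (ideal_gen (set fs)) (Suc t)) f"
proof -
  define I where "I = ideal_gen (set (f # fs))"
  define Q where "Q = ideal_gen (set fs)"
  have ins: "ipow I (Suc t) = {q + f * u | q u. q \<in> ipow Q (Suc t) \<and> u \<in> ipow I t}"
    using ipow_insert[of I f "set fs" Q t] by (auto simp: I_def Q_def simp del: ipow.simps)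
  have "ipow Q (Suc t) \<subseteq> ipow I (Suc t)"
    by (rule ipow_mono) (auto simp: I_def Q_def intro: ideal_gen_mono[THEN subsetD])
  moreover have "\<exists>i a'. q + f * u + f * a = i + f * a' \<and> i \<in> ipow Q (Suc t)"
    if "q \<in> ipow Q (Suc t)" for q u a
    using that by (intro exI[of _ q] exI[of _ "u + a"]) (simp add: algebra_simps)
  ultimately have "add_principal (ipow I (Suc t)) f = add_principal (ipow Q (Suc t)) f"
    unfolding add_principal_def ins by (intro equalityI subsetI; clarsimp; blast)
  then show ?thesis unfolding I_def Q_def .
qed

section \<open>Homogeneous components\<close>

definition mon_degree :: "('v \<Rightarrow>\<^sub>0 nat) \<Rightarrow> int" where
  "mon_degree m = (\<Sum>v\<in>Poly_Mapping.keys m. int (Poly_Mapping.lookup m v))"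

lemma homogeneous_iff: "homogeneous p t \<longleftrightarrow> (\<forall>m. Poly_Mapping.lookup p m \<noteq> 0 \<longrightarrow> mon_degree m = t)"
  by (auto simp: homogeneous_def mon_degree_def in_keys_iff)

lemma mon_degree_0 [simp]: "mon_degree 0 = 0"
  by (simp add: mon_degree_def)

lemma mon_degree_add [simp]: "mon_degree (a + b) = mon_degree a + mon_degree b"
proof -
  have *: "mon_degree m = (\<Sum>v\<in>S. int (Poly_Mapping.lookup m v))"
    if "finite S" "Poly_Mapping.keys m \<subseteq> S" for m :: "'a \<Rightarrow>\<^sub>0 nat" and S
    unfolding mon_degree_def using that by (intro sum.mono_neutral_left) (auto simp: in_keys_iff)
  let ?S = "Poly_Mapping.keys a \<union> Poly_Mapping.keys b"
  show ?thesis
    using *[of ?S "a + b"] *[of ?S a] *[of ?S b] Poly_Mapping.keys_add[of a b]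
    by (simp add: lookup_add sum.distrib)
qed

definition hom_part :: "int \<Rightarrow> ('v, 'k::zero) mpoly \<Rightarrow> ('v, 'k) mpoly" where
  "hom_part t p = Abs_poly_mapping (\<lambda>m. if mon_degree m = t then Poly_Mapping.lookup p m else 0)"

lemma lookup_hom_part:
  "Poly_Mapping.lookup (hom_part t p) m = (if mon_degree m = t then Poly_Mapping.lookup p m else 0)"
proof -
  have "finite {m. (if mon_degree m = t then Poly_Mapping.lookup p m else 0) \<noteq> 0}"
    by (rule finite_subset[OF _ finite_lookup[of p]]) auto
  then show ?thesis by (simp add: hom_part_def)
qed

lemma homogeneous_hom_part [simp]: "homogeneous (hom_part t p) t"
  by (simp add: homogeneous_iff lookup_hom_part)

lemma hom_part_homogeneous: "homogeneous p t \<Longrightarrow> hom_part u p = (if u = t then p else 0)"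
  by (intro poly_mapping_eqI) (auto simp: homogeneous_iff lookup_hom_part)

lemma hom_part_0 [simp]: "hom_part t 0 = 0"
  by (intro poly_mapping_eqI) (simp add: lookup_hom_part)

lemma hom_part_add: "hom_part t (p + q) = hom_part t p + hom_part t (q :: ('v, 'k::comm_ring_1) mpoly)"
  by (intro poly_mapping_eqI) (simp add: lookup_hom_part lookup_add)

lemma hom_part_diff: "hom_part t (p - q) = hom_part t p - hom_part t (q :: ('v, 'k::comm_ring_1) mpoly)"
  by (intro poly_mapping_eqI) (simp add: lookup_hom_part lookup_minus)

lemma hom_part_sum: "hom_part t (\<Sum>x\<in>A. f x) = (\<Sum>x\<in>A. hom_part t (f x :: ('v, 'k::comm_ring_1) mpoly))"
  by (induction A rule: infinite_finite_induct) (auto simp: hom_part_add)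

text \<open>
  Multiplication by a form shifts homogeneous components. All choices of homogeneous
  preimages below rest on this.
\<close>

lemma hom_part_mult:
  fixes p q :: "('v, 'k::comm_ring_1) mpoly"
  assumes "homogeneous p u"
  shows "hom_part t (p * q) = p * hom_part (t - u) q"
proof (rule poly_mapping_eqI)
  fix m
  have "Poly_Mapping.lookup p l * (\<Sum>n. Poly_Mapping.lookup (hom_part (t - u) q) n when m = l + n) =
      (if mon_degree m = t then Poly_Mapping.lookup p l * (\<Sum>n. Poly_Mapping.lookup q n when m = l + n) else 0)"
    for l
  proof (cases "Poly_Mapping.lookup p l = 0")
    case False
    then have l: "mon_degree l = u" using assms by (auto simp: homogeneous_iff)
    then have "(Poly_Mapping.lookup (hom_part (t - u) q) n when m = l + n) =
      (if mon_degree m = t then (Poly_Mapping.lookup q n when m = l + n) else 0)" for n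
      by (auto simp: lookup_hom_part when_def)
    then show ?thesis by simp
  qed simp
  then show "Poly_Mapping.lookup (hom_part t (p * q)) m = Poly_Mapping.lookup (p * hom_part (t - u) q) m"
    by (simp add: lookup_hom_part lookup_mult)
qed

lemma homogeneous_0 [simp]: "homogeneous 0 t"
  by (simp add: homogeneous_iff)

lemma homogeneous_1 [simp]: "homogeneous (1 :: ('v, 'k::comm_ring_1) mpoly) 0"
  by (simp add: homogeneous_iff lookup_one when_def)

lemma homogeneous_add:
  "homogeneous p t \<Longrightarrow> homogeneous q t \<Longrightarrow> homogeneous (p + q :: ('v, 'k::comm_ring_1) mpoly) t"
  unfolding homogeneous_iff lookup_add by (metis add.right_neutral)

lemma homogeneous_diff:
  "homogeneous p t \<Longrightarrow> homogeneous q t \<Longrightarrow> homogeneous (p - q :: ('v, 'k::comm_ring_1) mpoly) t"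
  unfolding homogeneous_iff lookup_minus by (metis diff_0_right)

lemma homogeneous_uminus:
  "homogeneous p t \<Longrightarrow> homogeneous (- p :: ('v, 'k::comm_ring_1) mpoly) t"
  by (simp add: homogeneous_iff)

lemma homogeneous_mult:
  "homogeneous p t \<Longrightarrow> homogeneous q u \<Longrightarrow> homogeneous (p * q :: ('v, 'k::comm_ring_1) mpoly) (t + u)"
  using hom_part_mult[of p t "t + u" q] hom_part_homogeneous[of q u u]
  by (metis add_diff_cancel_left' homogeneous_hom_part)

lemma homogeneous_sum:
  "(\<And>x. x \<in> A \<Longrightarrow> homogeneous (f x) t) \<Longrightarrow> homogeneous (\<Sum>x\<in>A. f x :: ('v, 'k::comm_ring_1) mpoly) t"
  by (induction A rule: infinite_finite_induct) (auto intro: homogeneous_add)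

lemma homogeneous_constant_term:
  "homogeneous p t \<Longrightarrow> Poly_Mapping.lookup p 0 \<noteq> 0 \<Longrightarrow> t = 0"
  by (auto simp: homogeneous_iff)

definition homogeneous_ideal :: "('v, 'k::comm_ring_1) mpoly set \<Rightarrow> bool" where
  "homogeneous_ideal I \<longleftrightarrow> is_ideal I \<and> (\<forall>p\<in>I. \<forall>t. hom_part t p \<in> I)"

lemma homogeneous_ideal_colon:
  assumes "homogeneous_ideal I" and "homogeneous g c"
  shows "homogeneous_ideal {a. g * a \<in> I}"
  unfolding homogeneous_ideal_def
proof (intro conjI ballI allI)
  show "is_ideal {a. g * a \<in> I}" using assms is_ideal_colon by (auto simp: homogeneous_ideal_def)
  fix p t assume "p \<in> {a. g * a \<in> I}"
  then have "hom_part (t + c) (g * p) \<in> I" using assms by (auto simp: homogeneous_ideal_def)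
  then show "hom_part t p \<in> {a. g * a \<in> I}" using hom_part_mult[OF assms(2)] by simp
qed

lemma homogeneous_ideal_sum_mult:
  assumes "homogeneous_ideal A" and "homogeneous_ideal B" and "homogeneous f c"
  shows "homogeneous_ideal {a + f * b | a b. a \<in> A \<and> b \<in> B}"
  unfolding homogeneous_ideal_def
proof (intro conjI ballI allI)
  show "is_ideal {a + f * b | a b. a \<in> A \<and> b \<in> B}"
    using assms by (auto simp: homogeneous_ideal_def intro!: is_ideal_sum_mult)
  fix p t assume "p \<in> {a + f * b | a b. a \<in> A \<and> b \<in> B}"
  then obtain a b where "p = a + f * b" "a \<in> A" "b \<in> B" by auto
  moreover from this have "hom_part t a \<in> A" "hom_part (t - c) b \<in> B"
    using assms by (auto simp: homogeneous_ideal_def)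
  ultimately show "hom_part t p \<in> {a + f * b | a b. a \<in> A \<and> b \<in> B}"
    using hom_part_mult[OF assms(3), of t b] by (auto simp: hom_part_add)
qed

lemma homogeneous_ideal_UNIV [simp]: "homogeneous_ideal UNIV"
  by (simp add: homogeneous_ideal_def)

lemma ideal_gen_empty: "ideal_gen {} = {0}"
  by (simp add: ideal_gen_def)

lemma ipow_zero_ideal: "ipow (ideal_gen {}) (Suc t) = {0}"
  using ideal_prod_minimal[of "{0}" "ipow {0} t" "{0}"] ideal.subspace_0[OF is_ideal_ideal_prod]
  by (auto simp: ideal_gen_empty)

text \<open>
  By induction along the expansion \<open>I^(t+1) = Q^(t+1) + f I^t\<close>, whose two summands are homogeneous.
\<close>

lemma homogeneous_ideal_ipow:
  assumes "\<forall>f\<in>set fs. \<exists>c. homogeneous f c"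
  shows "homogeneous_ideal (ipow (ideal_gen (set fs)) t)"
  using assms
proof (induction fs arbitrary: t)
  case Nil
  show ?case
    by (cases t) (auto simp: homogeneous_ideal_def ipow_zero_ideal simp del: ipow.simps(2))
next
  case (Cons f fs)
  obtain c where c: "homogeneous f c" using Cons(2) by auto
  show ?case
  proof (induction t)
    case (Suc t)
    show ?case
      using ipow_insert[of "ideal_gen (set (f # fs))" f "set fs" _ t, OF _ refl]
        homogeneous_ideal_sum_mult[OF Cons.IH Suc c, of "Suc t"] Cons(2)
      by (simp del: ipow.simps)
  qed simp
qed

section \<open>Graded matrices\<close>

text \<open>
  The matrices of degree-0 maps from the free module with basis degrees \<open>b\<close> to the one with basis
  degrees \<open>a\<close>.
\<close>

definition graded_mat ::
  "nat \<Rightarrow> nat \<Rightarrow> (nat \<Rightarrow> int) \<Rightarrow> (nat \<Rightarrow> int) \<Rightarrow> ('v, 'k::comm_ring_1) mpoly mat \<Rightarrow> bool" where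
  "graded_mat r c a b A \<longleftrightarrow>
    A \<in> carrier_mat r c \<and> (\<forall>p<r. \<forall>q<c. homogeneous (A $$ (p, q)) (b q - a p))"

definition graded_vec :: "nat \<Rightarrow> (nat \<Rightarrow> int) \<Rightarrow> ('v, 'k::comm_ring_1) mpoly vec \<Rightarrow> bool" where
  "graded_vec r a e \<longleftrightarrow> e \<in> carrier_vec r \<and> (\<forall>p<r. homogeneous (e $ p) (a p))"

lemma graded_mat_carrier: "graded_mat r c a b A \<Longrightarrow> A \<in> carrier_mat r c"
  by (simp add: graded_mat_def)

lemma graded_vec_carrier: "graded_vec r a e \<Longrightarrow> e \<in> carrier_vec r"
  by (simp add: graded_vec_def)

lemma graded_mat_mult:
  assumes A: "graded_mat r m a b A" and B: "graded_mat m c b d B"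
  shows "graded_mat r c a d (A * B)"
  unfolding graded_mat_def
proof (intro conjI allI impI)
  show "A * B \<in> carrier_mat r c" using A B by (auto simp: graded_mat_def)
  fix p q assume pq: "p < r" "q < c"
  have "homogeneous (A $$ (p, x) * B $$ (x, q)) (d q - a p)" if "x < m" for x
    using homogeneous_mult[of "A $$ (p, x)" "b x - a p" "B $$ (x, q)" "d q - b x"] A B pq that
    by (simp add: graded_mat_def)
  then show "homogeneous ((A * B) $$ (p, q)) (d q - a p)"
    using A B pq by (auto simp: graded_mat_def scalar_prod_def intro!: homogeneous_sum)
qed

lemma graded_mat_minus:
  "graded_mat r c a b A \<Longrightarrow> graded_mat r c a b B \<Longrightarrow> graded_mat r c a b (A - B)"
  unfolding graded_mat_def by (auto intro!: homogeneous_diff)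

lemma graded_mat_uminus: "graded_mat r c a b A \<Longrightarrow> graded_mat r c a b (- A)"
  unfolding graded_mat_def by (auto intro!: homogeneous_uminus)

lemma graded_mat_one: "graded_mat r r a a (1\<^sub>m r)"
  by (auto simp: graded_mat_def)

lemma graded_mat_shift:
  "graded_mat r c (\<lambda>q. a q + t) (\<lambda>q. b q + t) A \<longleftrightarrow> graded_mat r c a b A"
  by (simp add: graded_mat_def)

text \<open>
  A graded free module is projective in the graded sense: preimages of the columns exist by
  assumption, and their components of the right degree are preimages too.
\<close>

lemma graded_mat_lift:
  assumes A: "graded_mat r m a b A" and U: "graded_mat r c a d U"
    and im: "\<And>q. q < c \<Longrightarrow> \<exists>w\<in>carrier_vec m. A *\<^sub>v w = col U q"
  shows "\<exists>W. graded_mat m c b d W \<and> A * W = U"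
proof -
  obtain w where w: "\<And>q. q < c \<Longrightarrow> w q \<in> carrier_vec m \<and> A *\<^sub>v w q = col U q"
    using im by metis
  define W where "W = mat m c (\<lambda>(p, q). hom_part (d q - b p) (w q $ p))"
  have "A * W = U"
  proof (rule eq_matI)
    fix x q assume "x < dim_row U" "q < dim_col U"
    then have xq: "x < r" "q < c" using U by (auto simp: graded_mat_def)
    have "(A * W) $$ (x, q) = (\<Sum>p<m. A $$ (x, p) * hom_part (d q - b p) (w q $ p))"
      using A xq by (auto simp: graded_mat_def W_def scalar_prod_def lessThan_atLeast0)
    also have "\<dots> = (\<Sum>p<m. hom_part (d q - a x) (A $$ (x, p) * w q $ p))"
      using A xq hom_part_mult[of "A $$ (x, p)" "b p - a x" "d q - a x" "w q $ p" for p]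
      by (intro sum.cong) (auto simp: graded_mat_def)
    also have "(\<Sum>p<m. hom_part (d q - a x) (A $$ (x, p) * w q $ p)) =
        hom_part (d q - a x) ((A *\<^sub>v w q) $ x)"
      using A xq w[of q, THEN conjunct1]
      by (auto simp: graded_mat_def scalar_prod_def lessThan_atLeast0 hom_part_sum)
    also have "\<dots> = hom_part (d q - a x) (U $$ (x, q))"
      using w[of q] xq U by (auto simp: graded_mat_def)
    finally show "(A * W) $$ (x, q) = U $$ (x, q)"
      using U xq hom_part_homogeneous[of "U $$ (x, q)" "d q - a x"] by (simp add: graded_mat_def)
  qed (use A U in \<open>auto simp: graded_mat_def W_def\<close>)
  moreover have "graded_mat m c b d W" by (auto simp: graded_mat_def W_def)
  ultimately show ?thesis by blast
qed

text \<open>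
  The same for the augmentation \<open>S^m \<rightarrow> S/I\<close>, where equality holds only modulo \<open>I\<close>.
\<close>

lemma graded_vec_lift:
  assumes e: "graded_vec m b e" and u: "\<And>q. q < c \<Longrightarrow> homogeneous (u q) (d q)"
    and I: "homogeneous_ideal I"
    and im: "\<And>q. q < c \<Longrightarrow> \<exists>w\<in>carrier_vec m. u q - e \<bullet> w \<in> I"
  shows "\<exists>W. graded_mat m c b d W \<and> (\<forall>q<c. u q - e \<bullet> col W q \<in> I)"
proof -
  obtain w where w: "\<And>q. q < c \<Longrightarrow> w q \<in> carrier_vec m \<and> u q - e \<bullet> w q \<in> I"
    using im by metis
  define W where "W = mat m c (\<lambda>(p, q). hom_part (d q - b p) (w q $ p))"
  have "u q - e \<bullet> col W q \<in> I" if q: "q < c" for q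
  proof -
    have "e \<bullet> col W q = (\<Sum>p<m. e $ p * hom_part (d q - b p) (w q $ p))"
      using e q by (auto simp: W_def scalar_prod_def lessThan_atLeast0)
    also have "\<dots> = (\<Sum>p<m. hom_part (d q) (e $ p * w q $ p))"
      using e q hom_part_mult[of "e $ p" "b p" "d q" "w q $ p" for p]
      by (intro sum.cong) (auto simp: graded_vec_def)
    also have "\<dots> = hom_part (d q) (e \<bullet> w q)"
      using e q w[of q] by (auto simp: scalar_prod_def lessThan_atLeast0 hom_part_sum)
    finally have "u q - e \<bullet> col W q = hom_part (d q) (u q - e \<bullet> w q)"
      using hom_part_homogeneous[OF u[OF q], of "d q"] by (simp add: hom_part_diff)
    then show ?thesis using w[OF q] I by (simp add: homogeneous_ideal_def)
  qed
  moreover have "graded_mat m c b d W" by (auto simp: graded_mat_def W_def)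
  ultimately show ?thesis by blast
qed

section \<open>Complexes and resolutions\<close>

text \<open>
  What remains of \<^const>\<open>graded_free_resolution\<close> without exactness. Comparison maps start at such
  complexes.
\<close>

definition graded_complex ::
  "('v, 'k::field) mpoly set \<Rightarrow> (nat \<Rightarrow> nat) \<Rightarrow> (nat \<Rightarrow> nat \<Rightarrow> int) \<Rightarrow>
    ('v, 'k) mpoly vec \<Rightarrow> (nat \<Rightarrow> ('v, 'k) mpoly mat) \<Rightarrow> bool" where
  "graded_complex I rk dg e D \<longleftrightarrow>
    graded_vec (rk 0) (dg 0) e \<and>
    (\<forall>i. graded_mat (rk i) (rk (Suc i)) (dg i) (dg (Suc i)) (D i)) \<and>
    (\<forall>w\<in>carrier_vec (rk 1). e \<bullet> (D 0 *\<^sub>v w) \<in> I) \<and>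
    (\<forall>i. D i * D (Suc i) = 0\<^sub>m (rk i) (rk (Suc (Suc i))))"

lemma mult_mat_unit_vec:
  fixes A :: "'a::comm_ring_1 mat"
  assumes "A \<in> carrier_mat r c" and "j < c"
  shows "A *\<^sub>v unit_vec c j = col A j"
  using assms by (intro eq_vecI) (auto simp: scalar_prod_right_unit)

lemma mat_diff_add:
  "A \<in> carrier_mat r c \<Longrightarrow> B \<in> carrier_mat r c \<Longrightarrow> A - B + B = (A :: 'a::comm_ring_1 mat)"
  by (intro eq_matI) auto

lemma zero_mat_mult_vec:
  "w \<in> carrier_vec c \<Longrightarrow> 0\<^sub>m r c *\<^sub>v w = (0\<^sub>v r :: 'a::comm_ring_1 vec)"
  by (intro eq_vecI) auto

lemma mat_eq_zeroI:
  fixes A :: "'a::comm_ring_1 mat"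
  assumes "A \<in> carrier_mat r c" and "\<And>w. w \<in> carrier_vec c \<Longrightarrow> A *\<^sub>v w = 0\<^sub>v r"
  shows "A = 0\<^sub>m r c"
proof (rule eq_matI)
  fix i j assume "i < dim_row (0\<^sub>m r c)" "j < dim_col (0\<^sub>m r c)"
  then have ij: "i < r" "j < c" by auto
  have "col A j = 0\<^sub>v r" using assms(2)[of "unit_vec c j"] mult_mat_unit_vec[OF assms(1) ij(2)] by simp
  then show "A $$ (i, j) = 0\<^sub>m r c $$ (i, j)"
    using assms(1) ij by (metis carrier_matD index_col index_zero_mat(1) index_zero_vec(1))
qed (use assms in auto)

text \<open>
  The set equalities in the definition split into the complex property and exactness; this is
  the form in which resolutions are used and constructed.
\<close>

lemma graded_free_resolution_iff:
  "graded_free_resolution I rk dg e D \<longleftrightarrow>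
    graded_complex I rk dg e D \<and>
    (\<forall>f. \<exists>v\<in>carrier_vec (rk 0). f - e \<bullet> v \<in> I) \<and>
    (\<forall>v\<in>carrier_vec (rk 0). e \<bullet> v \<in> I \<longrightarrow> (\<exists>w\<in>carrier_vec (rk 1). D 0 *\<^sub>v w = v)) \<and>
    (\<forall>i. \<forall>v\<in>carrier_vec (rk (Suc i)). D i *\<^sub>v v = 0\<^sub>v (rk i) \<longrightarrow>
      (\<exists>w\<in>carrier_vec (rk (Suc (Suc i))). D (Suc i) *\<^sub>v w = v))"
  (is "?L \<longleftrightarrow> ?R")
proof
  assume L: ?L
  have carr: "D i \<in> carrier_mat (rk i) (rk (Suc i))" for i
    using L by (simp add: graded_free_resolution_def)
  have k0: "{v \<in> carrier_vec (rk 0). e \<bullet> v \<in> I} = (\<lambda>w. D 0 *\<^sub>v w) ` carrier_vec (rk 1)"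
    and ki: "\<And>i. {v \<in> carrier_vec (rk (Suc i)). D i *\<^sub>v v = 0\<^sub>v (rk i)} =
      (\<lambda>w. D (Suc i) *\<^sub>v w) ` carrier_vec (rk (Suc (Suc i)))"
    using L by (auto simp: graded_free_resolution_def)
  have "D i * D (Suc i) = 0\<^sub>m (rk i) (rk (Suc (Suc i)))" for i
  proof (rule mat_eq_zeroI)
    show "D i * D (Suc i) \<in> carrier_mat (rk i) (rk (Suc (Suc i)))"
      using mult_carrier_mat[OF carr carr] .
    fix w :: "('a, 'b) mpoly vec" assume "w \<in> carrier_vec (rk (Suc (Suc i)))"
    then show "D i * D (Suc i) *\<^sub>v w = 0\<^sub>v (rk i)"
      using ki[of i] assoc_mult_mat_vec[OF carr carr, of w i] by auto
  qed
  moreover have "\<forall>w\<in>carrier_vec (rk 1). e \<bullet> (D 0 *\<^sub>v w) \<in> I" using k0 by blast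
  ultimately have "graded_complex I rk dg e D"
    using L by (simp add: graded_free_resolution_def graded_complex_def graded_vec_def graded_mat_def)
  moreover have "\<forall>f. \<exists>v\<in>carrier_vec (rk 0). f - e \<bullet> v \<in> I"
    using L by (simp add: graded_free_resolution_def)
  moreover have "\<forall>v\<in>carrier_vec (rk 0). e \<bullet> v \<in> I \<longrightarrow> (\<exists>w\<in>carrier_vec (rk 1). D 0 *\<^sub>v w = v)"
  proof (intro ballI impI)
    fix v assume "v \<in> carrier_vec (rk 0)" "e \<bullet> v \<in> I"
    then have "v \<in> {v \<in> carrier_vec (rk 0). e \<bullet> v \<in> I}" by simp
    then show "\<exists>w\<in>carrier_vec (rk 1). D 0 *\<^sub>v w = v" unfolding k0 by auto
  qed
  moreover have "\<forall>i. \<forall>v\<in>carrier_vec (rk (Suc i)). D i *\<^sub>v v = 0\<^sub>v (rk i) \<longrightarrow>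
      (\<exists>w\<in>carrier_vec (rk (Suc (Suc i))). D (Suc i) *\<^sub>v w = v)"
  proof (intro allI ballI impI)
    fix i v assume "v \<in> carrier_vec (rk (Suc i))" "D i *\<^sub>v v = 0\<^sub>v (rk i)"
    then have "v \<in> {v \<in> carrier_vec (rk (Suc i)). D i *\<^sub>v v = 0\<^sub>v (rk i)}" by simp
    then show "\<exists>w\<in>carrier_vec (rk (Suc (Suc i))). D (Suc i) *\<^sub>v w = v" unfolding ki by auto
  qed
  ultimately show ?R by blast
next
  assume R: ?R
  then have C: "graded_complex I rk dg e D" by blast
  have carr: "D i \<in> carrier_mat (rk i) (rk (Suc i))" for i
    using C by (simp add: graded_complex_def graded_mat_def)
  have "D i *\<^sub>v (D (Suc i) *\<^sub>v w) = 0\<^sub>v (rk i)" if "w \<in> carrier_vec (rk (Suc (Suc i)))" for i w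
    using C assoc_mult_mat_vec[OF carr carr that] zero_mat_mult_vec[OF that]
    by (simp add: graded_complex_def)
  moreover have Dw: "D i *\<^sub>v w \<in> carrier_vec (rk i)" for i w
    by (rule carrier_vecI) (metis carr carrier_matD(1) dim_mult_mat_vec)
  ultimately have "{v \<in> carrier_vec (rk (Suc i)). D i *\<^sub>v v = 0\<^sub>v (rk i)} =
      (\<lambda>w. D (Suc i) *\<^sub>v w) ` carrier_vec (rk (Suc (Suc i)))" (is "?A = ?B") for i
  proof (intro equalityI subsetI)
    fix v assume "v \<in> ?A"
    then have "\<exists>w\<in>carrier_vec (rk (Suc (Suc i))). D (Suc i) *\<^sub>v w = v" using R by simp
    then show "v \<in> ?B" by auto
  qed auto
  moreover have "{v \<in> carrier_vec (rk 0). e \<bullet> v \<in> I} = (\<lambda>w. D 0 *\<^sub>v w) ` carrier_vec (rk 1)"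
    (is "?A = ?B")
  proof (intro equalityI subsetI)
    fix v assume "v \<in> ?A"
    then have "\<exists>w\<in>carrier_vec (rk 1). D 0 *\<^sub>v w = v" using R by simp
    then show "v \<in> ?B" by auto
  next
    fix v assume "v \<in> ?B"
    then show "v \<in> ?A" using C Dw by (auto simp: graded_complex_def)
  qed
  ultimately show ?L
    using R C by (simp add: graded_free_resolution_def graded_complex_def graded_vec_def graded_mat_def)
qed

lemma scalar_prod_mult_mat_vec:
  fixes e :: "'a::comm_ring_1 vec"
  assumes "e \<in> carrier_vec m" and "A \<in> carrier_mat m c" and "w \<in> carrier_vec c"
  shows "e \<bullet> (A *\<^sub>v w) = (\<Sum>q<c. (e \<bullet> col A q) * w $ q)"
proof -
  have "e \<bullet> (A *\<^sub>v w) = (\<Sum>p<m. \<Sum>q<c. e $ p * A $$ (p, q) * w $ q)"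
    using assms by (auto simp: scalar_prod_def lessThan_atLeast0 sum_distrib_left mult.assoc intro!: sum.cong)
  also have "\<dots> = (\<Sum>q<c. \<Sum>p<m. e $ p * A $$ (p, q) * w $ q)" by (rule sum.swap)
  also have "\<dots> = (\<Sum>q<c. (e \<bullet> col A q) * w $ q)"
    using assms by (auto simp: scalar_prod_def lessThan_atLeast0 sum_distrib_right intro!: sum.cong)
  finally show ?thesis .
qed

text \<open>
  Compatibility of a map with the augmentations (up to the factor \<open>g\<close>) is checked on basis
  vectors.
\<close>

lemma augmentation_comparison:
  fixes e :: "'a::comm_ring_1 vec"
  assumes I: "is_ideal I" and e: "e \<in> carrier_vec m" and e': "e' \<in> carrier_vec c"
    and A: "A \<in> carrier_mat m c" and eq: "\<And>q. q < c \<Longrightarrow> g * e' $ q - e \<bullet> col A q \<in> I"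
    and w: "w \<in> carrier_vec c"
  shows "g * (e' \<bullet> w) - e \<bullet> (A *\<^sub>v w) \<in> I"
proof -
  have "g * (e' \<bullet> w) - e \<bullet> (A *\<^sub>v w) = (\<Sum>q<c. (g * e' $ q - e \<bullet> col A q) * w $ q)"
    using e' w unfolding scalar_prod_mult_mat_vec[OF e A w]
    by (simp add: scalar_prod_def lessThan_atLeast0 left_diff_distrib sum_subtractf sum_distrib_left mult.assoc)
  also have "\<dots> \<in> I"
    using eq by (intro ideal.subspace_sum[OF I] ideal_mult_right[OF I]) auto
  finally show ?thesis .
qed

text \<open>
  The comparison theorem for multiplication by \<open>g\<close>, from a complex over \<open>S/I'\<close> to a resolution
  of \<open>S/I\<close>. The chain map is built degree by degree: by exactness \<open>\<theta>_i D'_i\<close> factors through \<open>D_i\<close>, because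
  \<open>D_(i-1) \<theta>_i D'_i = \<theta>_(i-1) D'_(i-1) D'_i = 0\<close>. The case \<open>g = 1\<close> compares resolutions; a general \<open>g\<close> is
  used for mapping cones.
\<close>

lemma comparison_map_exists:
  assumes C: "graded_complex I' rk' dg' e' D'" and R: "graded_free_resolution I rk dg e D"
    and I: "homogeneous_ideal I" and g: "homogeneous g c" and gI: "\<And>x. x \<in> I' \<Longrightarrow> g * x \<in> I"
  shows "\<exists>\<theta>. (\<forall>i. graded_mat (rk i) (rk' i) (dg i) (\<lambda>q. dg' i q + c) (\<theta> i) \<and>
      D i * \<theta> (Suc i) = \<theta> i * D' i) \<and> (\<forall>q<rk' 0. g * e' $ q - e \<bullet> col (\<theta> 0) q \<in> I)"
proof -
  have I0: "is_ideal I" using I by (simp add: homogeneous_ideal_def)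
  have D': "graded_mat (rk' i) (rk' (Suc i)) (dg' i) (dg' (Suc i)) (D' i)"
    and D'D': "D' i * D' (Suc i) = 0\<^sub>m (rk' i) (rk' (Suc (Suc i)))"
    and e': "graded_vec (rk' 0) (dg' 0) e'" for i
    using C by (auto simp: graded_complex_def)
  have D: "graded_mat (rk i) (rk (Suc i)) (dg i) (dg (Suc i)) (D i)"
    and e: "graded_vec (rk 0) (dg 0) e" for i
    using R by (auto simp: graded_free_resolution_iff graded_complex_def)
  note [simp] = graded_mat_carrier[OF D] graded_mat_carrier[OF D'] graded_vec_carrier[OF e]
    graded_vec_carrier[OF e']
  \<comment> \<open>The invariant of the recursion contains the liftability of the next square.\<close>
  define P where "P = (\<lambda>i \<theta>. graded_mat (rk i) (rk' i) (dg i) (\<lambda>q. dg' i q + c) \<theta> \<and>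
    (\<forall>q<rk' (Suc i). \<exists>w\<in>carrier_vec (rk (Suc i)). D i *\<^sub>v w = col (\<theta> * D' i) q) \<and>
    (i = 0 \<longrightarrow> (\<forall>q<rk' 0. g * e' $ q - e \<bullet> col \<theta> q \<in> I)))"
  have "\<exists>\<theta>. P 0 \<theta>"
  proof -
    have "\<exists>W. graded_mat (rk 0) (rk' 0) (dg 0) (\<lambda>q. dg' 0 q + c) W \<and>
        (\<forall>q<rk' 0. g * e' $ q - e \<bullet> col W q \<in> I)"
    proof (rule graded_vec_lift[OF e _ I])
      fix q assume "q < rk' 0"
      then show "homogeneous (g * e' $ q) (dg' 0 q + c)"
        using homogeneous_mult[OF g, of "e' $ q" "dg' 0 q"] e' by (simp add: graded_vec_def add.commute)
      show "\<exists>w\<in>carrier_vec (rk 0). g * e' $ q - e \<bullet> w \<in> I"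
        using R by (simp add: graded_free_resolution_iff)
    qed
    then obtain \<theta> where \<theta>: "graded_mat (rk 0) (rk' 0) (dg 0) (\<lambda>q. dg' 0 q + c) \<theta>"
      and eq: "\<And>q. q < rk' 0 \<Longrightarrow> g * e' $ q - e \<bullet> col \<theta> q \<in> I" by blast
    have "\<exists>w\<in>carrier_vec (rk (Suc 0)). D 0 *\<^sub>v w = col (\<theta> * D' 0) q" if q: "q < rk' (Suc 0)" for q
    proof -
      have col: "col (D' 0) q = D' 0 *\<^sub>v unit_vec (rk' (Suc 0)) q"
        using q mult_mat_unit_vec[OF graded_mat_carrier[OF D'[of 0]] q] by simp
      have colc: "col (D' 0) q \<in> carrier_vec (rk' 0)"
        using q graded_mat_carrier[OF D'[of 0]] col_carrier_vec by blast
      have "g * (e' \<bullet> col (D' 0) q) - e \<bullet> (\<theta> *\<^sub>v col (D' 0) q) \<in> I"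
        using augmentation_comparison[OF I0 _ _ graded_mat_carrier[OF \<theta>] eq colc] by simp
      moreover have "e' \<bullet> col (D' 0) q \<in> I'"
        using C unfolding col by (simp add: graded_complex_def)
      ultimately have "e \<bullet> (\<theta> *\<^sub>v col (D' 0) q) \<in> I"
        using gI ideal.subspace_diff[OF I0] by (metis add_diff_cancel_left' diff_add_cancel)
      then have "\<exists>w\<in>carrier_vec (rk 1). D 0 *\<^sub>v w = \<theta> *\<^sub>v col (D' 0) q"
        using R graded_mat_carrier[OF \<theta>] colc unfolding graded_free_resolution_iff
        by (meson mult_mat_vec_carrier)
      then show ?thesis
        using col_mult2[OF graded_mat_carrier[OF \<theta>] graded_mat_carrier[OF D'[of 0]] q] by simp
    qed
    then show ?thesis using \<theta> eq by (auto simp: P_def)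
  qed
  moreover have "\<exists>\<theta>'. P (Suc i) \<theta>' \<and> D i * \<theta>' = \<theta> * D' i" if P: "P i \<theta>" for i \<theta>
  proof -
    have \<theta>: "graded_mat (rk i) (rk' i) (dg i) (\<lambda>q. dg' i q + c) \<theta>" using P by (simp add: P_def)
    have "graded_mat (rk i) (rk' (Suc i)) (dg i) (\<lambda>q. dg' (Suc i) q + c) (\<theta> * D' i)"
      using graded_mat_mult[OF \<theta>, of "rk' (Suc i)" "\<lambda>q. dg' (Suc i) q + c" "D' i"] D'[of i]
      by (simp add: graded_mat_shift)
    from graded_mat_lift[OF D this] P obtain \<theta>' where
      \<theta>': "graded_mat (rk (Suc i)) (rk' (Suc i)) (dg (Suc i)) (\<lambda>q. dg' (Suc i) q + c) \<theta>'"
      and eq: "D i * \<theta>' = \<theta> * D' i" by (auto simp: P_def)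
    note [simp] = graded_mat_carrier[OF \<theta>] graded_mat_carrier[OF \<theta>']
    have "D i * (\<theta>' * D' (Suc i)) = 0\<^sub>m (rk i) (rk' (Suc (Suc i)))"
    proof -
      have "D i * (\<theta>' * D' (Suc i)) = D i * \<theta>' * D' (Suc i)"
        by (rule assoc_mult_mat[OF graded_mat_carrier[OF D] graded_mat_carrier[OF \<theta>']
              graded_mat_carrier[OF D'], symmetric])
      also have "\<dots> = \<theta> * (D' i * D' (Suc i))"
        unfolding eq by (rule assoc_mult_mat[OF graded_mat_carrier[OF \<theta>]
              graded_mat_carrier[OF D'] graded_mat_carrier[OF D']])
      also have "\<dots> = 0\<^sub>m (rk i) (rk' (Suc (Suc i)))" unfolding D'D' by (rule right_mult_zero_mat) auto
      finally show ?thesis .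
    qed
    have "\<exists>w\<in>carrier_vec (rk (Suc (Suc i))). D (Suc i) *\<^sub>v w = col (\<theta>' * D' (Suc i)) q"
      if q: "q < rk' (Suc (Suc i))" for q
    proof -
      have carr: "\<theta>' * D' (Suc i) \<in> carrier_mat (rk (Suc i)) (rk' (Suc (Suc i)))"
        by (rule mult_carrier_mat[of _ _ "rk' (Suc i)"]) auto
      have "D i *\<^sub>v col (\<theta>' * D' (Suc i)) q = col (D i * (\<theta>' * D' (Suc i))) q"
        using col_mult2[OF _ carr q, of "D i" "rk i"] by simp
      also have "\<dots> = 0\<^sub>v (rk i)"
        using q \<open>D i * (\<theta>' * D' (Suc i)) = _\<close> by simp
      finally show ?thesis
        using R col_carrier_vec[OF q carr] unfolding graded_free_resolution_iff by blast
    qed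
    then show ?thesis using \<theta>' eq by (auto simp: P_def)
  qed
  ultimately obtain \<theta> where "\<And>i. P i (\<theta> i) \<and> D i * \<theta> (Suc i) = \<theta> i * D' i"
    using dependent_nat_choice[of P "\<lambda>i \<theta> \<theta>'. D i * \<theta>' = \<theta> * D' i"] by metis
  then show ?thesis by (intro exI[of _ \<theta>]) (auto simp: P_def)
qed

text \<open>
  A chain map from a resolution to itself that is zero on \<open>S/I\<close> is null-homotopic: the
  columns of \<open>\<gamma>_(i+1) - h_i D_i\<close> are cycles, so this matrix factors through \<open>D_(i+1)\<close>.
\<close>

lemma null_homotopy_exists:
  assumes R: "graded_free_resolution I rk dg e D" and I: "homogeneous_ideal I"
    and \<gamma>: "\<And>i. graded_mat (rk i) (rk i) (dg i) (dg i) (\<gamma> i)"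
    and chain: "\<And>i. D i * \<gamma> (Suc i) = \<gamma> i * D i"
    and aug: "\<And>q. q < rk 0 \<Longrightarrow> e \<bullet> col (\<gamma> 0) q \<in> I"
  shows "\<exists>h. (\<forall>i. graded_mat (rk (Suc i)) (rk i) (dg (Suc i)) (dg i) (h i) \<and>
      \<gamma> (Suc i) = D (Suc i) * h (Suc i) + h i * D i) \<and> \<gamma> 0 = D 0 * h 0"
proof -
  have D: "graded_mat (rk i) (rk (Suc i)) (dg i) (dg (Suc i)) (D i)"
    and DD: "D i * D (Suc i) = 0\<^sub>m (rk i) (rk (Suc (Suc i)))" for i
    using R by (auto simp: graded_free_resolution_iff graded_complex_def)
  note [simp] = graded_mat_carrier[OF D] graded_mat_carrier[OF \<gamma>]
  define P where "P = (\<lambda>i h. graded_mat (rk (Suc i)) (rk i) (dg (Suc i)) (dg i) h \<and>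
    D i * h * D i = \<gamma> i * D i \<and> (i = 0 \<longrightarrow> \<gamma> 0 = D 0 * h))"
  have "\<exists>h. P 0 h"
  proof -
    have "\<exists>w\<in>carrier_vec (rk (Suc 0)). D 0 *\<^sub>v w = col (\<gamma> 0) q" if "q < rk 0" for q
      using aug[OF that] R col_carrier_vec[OF that, of "\<gamma> 0" "rk 0"]
      unfolding graded_free_resolution_iff by simp
    from graded_mat_lift[OF D \<gamma> this] show ?thesis by (auto simp: P_def)
  qed
  moreover have "\<exists>h'. P (Suc i) h' \<and> \<gamma> (Suc i) = D (Suc i) * h' + h * D i" if P: "P i h" for i h
  proof -
    have h: "graded_mat (rk (Suc i)) (rk i) (dg (Suc i)) (dg i) h"
      and dhd: "D i * h * D i = \<gamma> i * D i" using P by (auto simp: P_def)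
    note [simp] = graded_mat_carrier[OF h]
    define U where "U = \<gamma> (Suc i) - h * D i"
    have U: "graded_mat (rk (Suc i)) (rk (Suc i)) (dg (Suc i)) (dg (Suc i)) U"
      unfolding U_def by (intro graded_mat_minus \<gamma> graded_mat_mult[OF h D])
    have hD: "h * D i \<in> carrier_mat (rk (Suc i)) (rk (Suc i))"
      by (rule mult_carrier_mat[of _ _ "rk i"]) auto
    have "D i * U = D i * \<gamma> (Suc i) - D i * (h * D i)"
      unfolding U_def by (rule mult_minus_distrib_mat[OF graded_mat_carrier[OF D] _ hD]) auto
    also have "D i * (h * D i) = D i * h * D i"
      by (rule assoc_mult_mat[OF graded_mat_carrier[OF D] graded_mat_carrier[OF h]
            graded_mat_carrier[OF D], symmetric])
    finally have "D i * U = \<gamma> i * D i - \<gamma> i * D i" unfolding dhd chain .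
    then have DU: "D i * U = 0\<^sub>m (rk i) (rk (Suc i))"
      using minus_r_inv_mat[OF mult_carrier_mat[OF graded_mat_carrier[OF \<gamma>] graded_mat_carrier[OF D]]]
      by simp
    have "\<exists>w\<in>carrier_vec (rk (Suc (Suc i))). D (Suc i) *\<^sub>v w = col U q" if q: "q < rk (Suc i)" for q
    proof -
      have "D i *\<^sub>v col U q = 0\<^sub>v (rk i)"
        using col_mult2[OF _ graded_mat_carrier[OF U] q, of "D i" "rk i"] DU q by simp
      then show ?thesis
        using R col_carrier_vec[OF q graded_mat_carrier[OF U]] unfolding graded_free_resolution_iff by blast
    qed
    from graded_mat_lift[OF D U this] obtain h' where
      h': "graded_mat (rk (Suc (Suc i))) (rk (Suc i)) (dg (Suc (Suc i))) (dg (Suc i)) h'"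
      and eq: "D (Suc i) * h' = U" by blast
    have "\<gamma> (Suc i) = D (Suc i) * h' + h * D i"
      unfolding eq U_def by (rule mat_diff_add[OF graded_mat_carrier[OF \<gamma>] hD, symmetric])
    moreover have "D (Suc i) * h' * D (Suc i) = \<gamma> (Suc i) * D (Suc i)"
    proof -
      have "h * D i * D (Suc i) = h * (D i * D (Suc i))"
        by (rule assoc_mult_mat[OF graded_mat_carrier[OF h] graded_mat_carrier[OF D]
              graded_mat_carrier[OF D]])
      also have "\<dots> = 0\<^sub>m (rk (Suc i)) (rk (Suc (Suc i)))" unfolding DD
        by (rule right_mult_zero_mat[OF graded_mat_carrier[OF h]])
      finally have "h * D i * D (Suc i) = 0\<^sub>m (rk (Suc i)) (rk (Suc (Suc i)))" .
      moreover have "U * D (Suc i) = \<gamma> (Suc i) * D (Suc i) - h * D i * D (Suc i)"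
        unfolding U_def
        by (rule minus_mult_distrib_mat[OF graded_mat_carrier[OF \<gamma>] hD graded_mat_carrier[OF D]])
      moreover have "\<gamma> (Suc i) * D (Suc i) \<in> carrier_mat (rk (Suc i)) (rk (Suc (Suc i)))"
        by (rule mult_carrier_mat[OF graded_mat_carrier[OF \<gamma>] graded_mat_carrier[OF D]])
      ultimately show ?thesis unfolding eq by (auto simp del: index_mult_mat)
    qed
    ultimately show ?thesis using h' by (auto simp: P_def)
  qed
  ultimately obtain h where "\<And>i. P i (h i) \<and> \<gamma> (Suc i) = D (Suc i) * h (Suc i) + h i * D i"
    using dependent_nat_choice[of P "\<lambda>i h h'. \<gamma> (Suc i) = D (Suc i) * h' + h * D i"] by metis
  then show ?thesis by (intro exI[of _ h]) (auto simp: P_def)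
qed

section \<open>Total complexes: cones and the horseshoe\<close>

text \<open>
  The basis degrees of a direct sum whose first summand has rank \<open>r\<close>.
\<close>

definition glue :: "nat \<Rightarrow> (nat \<Rightarrow> 'a) \<Rightarrow> (nat \<Rightarrow> 'a) \<Rightarrow> nat \<Rightarrow> 'a" where
  "glue r a a' q = (if q < r then a q else a' (q - r))"

text \<open>
  The differential of an extension of the complex with differentials \<open>B\<close> by the one with
  differentials \<open>A\<close>; \<open>\<Theta>\<close> is its twist. Mapping cones and the complexes of the horseshoe lemma both have this
  form.
\<close>

definition block_mat :: "'a::zero mat \<Rightarrow> 'a mat \<Rightarrow> 'a mat \<Rightarrow> 'a mat" where
  "block_mat A \<Theta> B = four_block_mat A \<Theta> (0\<^sub>m (dim_row B) (dim_col A)) B"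

lemma graded_mat_block:
  assumes "graded_mat r c a b A" and "graded_mat r c' a b' \<Theta>" and "graded_mat r' c' a' b' B"
  shows "graded_mat (r + r') (c + c') (glue r a a') (glue c b b') (block_mat A \<Theta> B)"
  using assms by (auto simp: graded_mat_def block_mat_def glue_def)

lemma graded_vec_append:
  assumes "graded_vec r a e" and "graded_vec r' a' e'"
  shows "graded_vec (r + r') (glue r a a') (e @\<^sub>v e')"
  using assms by (auto simp: graded_vec_def glue_def)

lemma block_mat_mult_vec:
  fixes A :: "'a::comm_ring_1 mat"
  assumes "A \<in> carrier_mat r c" and "\<Theta> \<in> carrier_mat r c'" and "B \<in> carrier_mat r' c'"
    and "x \<in> carrier_vec c" and "y \<in> carrier_vec c'"
  shows "block_mat A \<Theta> B *\<^sub>v (x @\<^sub>v y) = (A *\<^sub>v x + \<Theta> *\<^sub>v y) @\<^sub>v (B *\<^sub>v y)"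
proof -
  have "B *\<^sub>v y \<in> carrier_vec r'" using assms by auto
  moreover have "0\<^sub>m (dim_row B) (dim_col A) *\<^sub>v x = 0\<^sub>v r'"
    using zero_mat_mult_vec[of x c r'] assms by simp
  ultimately show ?thesis
    unfolding block_mat_def using assms
    by (subst four_block_mat_mult_vec[of A r c \<Theta> c' _ r']) auto
qed

lemma block_mat_mult:
  fixes A :: "'a::comm_ring_1 mat"
  assumes A: "A \<in> carrier_mat r m" and \<Theta>: "\<Theta> \<in> carrier_mat r m'" and B: "B \<in> carrier_mat r' m'"
    and A': "A' \<in> carrier_mat m c" and \<Theta>': "\<Theta>' \<in> carrier_mat m c'" and B': "B' \<in> carrier_mat m' c'"
    and "A * A' = 0\<^sub>m r c" and "B * B' = 0\<^sub>m r' c'" and an: "A * \<Theta>' = \<Theta> * (- B')"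
  shows "block_mat A \<Theta> B * block_mat A' \<Theta>' B' = 0\<^sub>m (r + r') (c + c')"
proof -
  have "A * \<Theta>' + \<Theta> * B' = 0\<^sub>m r c'"
    unfolding an using uminus_mult_right_mat[of \<Theta> B'] mult_carrier_mat[OF \<Theta> B'] \<Theta> B'
    by (simp add: uminus_l_inv_mat)
  then show ?thesis
    unfolding block_mat_def using assms
    by (subst mult_four_block_mat[of _ r m _ m' _ r' _ _ c _ c']) (auto simp: left_mult_zero_mat)
qed

lemma carrier_vec_append_cases:
  assumes "v \<in> carrier_vec (n + m)"
  obtains x y where "v = x @\<^sub>v y" "x \<in> carrier_vec n" "y \<in> carrier_vec m"
  using assms vec_first_last_append[OF assms] by (metis vec_first_carrier vec_last_carrier)

lemma vec_minus_add:
  fixes x :: "'a::comm_ring_1 vec"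
  shows "x \<in> carrier_vec n \<Longrightarrow> y \<in> carrier_vec n \<Longrightarrow> x - y + y = x"
  by (intro eq_vecI) auto

text \<open>
  A cycle \<open>(x, y)\<close> of a twisted direct sum is a boundary as soon as its component \<open>y\<close> is a
  boundary \<open>B' z\<close> and the first complex is exact: \<open>x - \<Theta>' z\<close> is then a cycle of the first complex.
\<close>

lemma block_mat_exact:
  fixes A :: "'a::comm_ring_1 mat"
  assumes A: "A \<in> carrier_mat r m" and \<Theta>: "\<Theta> \<in> carrier_mat r m'" and B: "B \<in> carrier_mat r' m'"
    and A': "A' \<in> carrier_mat m c" and \<Theta>': "\<Theta>' \<in> carrier_mat m c'" and B': "B' \<in> carrier_mat m' c'"
    and an: "A * \<Theta>' = \<Theta> * (- B')"
    and exA: "\<And>x. x \<in> carrier_vec m \<Longrightarrow> A *\<^sub>v x = 0\<^sub>v r \<Longrightarrow> \<exists>t\<in>carrier_vec c. A' *\<^sub>v t = x"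
    and x: "x \<in> carrier_vec m" and z: "z \<in> carrier_vec c'"
    and zero: "A *\<^sub>v x + \<Theta> *\<^sub>v (B' *\<^sub>v z) = 0\<^sub>v r"
  shows "\<exists>w\<in>carrier_vec (c + c'). block_mat A' \<Theta>' B' *\<^sub>v w = x @\<^sub>v (B' *\<^sub>v z)"
proof -
  have Tz: "\<Theta>' *\<^sub>v z \<in> carrier_vec m" and Bz: "B' *\<^sub>v z \<in> carrier_vec m'"
    using \<Theta>' B' z by auto
  have "A *\<^sub>v (\<Theta>' *\<^sub>v z) = (\<Theta> * (- B')) *\<^sub>v z"
    unfolding an[symmetric] by (rule assoc_mult_mat_vec[OF A \<Theta>' z, symmetric])
  also have "\<dots> = \<Theta> *\<^sub>v (- (B' *\<^sub>v z))"
    using assoc_mult_mat_vec[OF \<Theta> _ z, of "- B'"] B' z by simp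
  also have "\<dots> = - (\<Theta> *\<^sub>v (B' *\<^sub>v z))"
    using \<Theta> B' by (intro eq_vecI) auto
  finally have "A *\<^sub>v (x - \<Theta>' *\<^sub>v z) = A *\<^sub>v x + \<Theta> *\<^sub>v (B' *\<^sub>v z)"
    using mult_minus_distrib_mat_vec[OF A x Tz] A \<Theta> by (intro eq_vecI) auto
  then obtain t where t: "t \<in> carrier_vec c" "A' *\<^sub>v t = x - \<Theta>' *\<^sub>v z"
    using exA[of "x - \<Theta>' *\<^sub>v z"] zero x Tz by auto
  have "block_mat A' \<Theta>' B' *\<^sub>v (t @\<^sub>v z) = x @\<^sub>v (B' *\<^sub>v z)"
    unfolding block_mat_mult_vec[OF A' \<Theta>' B' t(1) z] t(2) vec_minus_add[OF x Tz] ..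
  then show ?thesis using t z by (intro bexI[of _ "t @\<^sub>v z"]) auto
qed

text \<open>
  Of a resolution, only the homological positions and the degrees of its basis elements are
  recorded. \<open>T\<close> contains the positions of the nonzero Betti numbers of \<open>S/I\<close>, and possibly further pairs
  if the resolution is not minimal.
\<close>

definition resolution_support :: "('v, 'k::field) mpoly set \<Rightarrow> (nat \<times> int) set \<Rightarrow> bool" where
  "resolution_support I T \<longleftrightarrow> (\<exists>rk dg e D. graded_free_resolution I rk dg e D \<and>
    T = {(i, dg i q) | i q. q < rk i})"

lemma glue_support:
  "{(i, glue (r i) (a i) (a' i) q) | i q. q < r i + r' i} =
    {(i, a i q) | i q. q < r i} \<union> {(i, a' i q) | i q. q < (r' i :: nat)}" (is "?L = ?R")
proof (intro equalityI subsetI)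
  fix z assume "z \<in> ?L"
  then obtain i q where z: "z = (i, glue (r i) (a i) (a' i) q)" "q < r i + r' i" by auto
  show "z \<in> ?R"
  proof (cases "q < r i")
    case False
    then have "z = (i, a' i (q - r i))" "q - r i < r' i" using z by (auto simp: glue_def)
    then show ?thesis by blast
  qed (use z in \<open>auto simp: glue_def\<close>)
next
  fix z assume "z \<in> ?R"
  then show "z \<in> ?L"
  proof
    assume "z \<in> {(i, a' i q) | i q. q < r' i}"
    then obtain i q where "z = (i, a' i q)" "q < r' i" by auto
    then show ?thesis by (auto simp: glue_def intro!: exI[of _ i] exI[of _ "r i + q"])
  next
    assume "z \<in> {(i, a i q) | i q. q < r i}"
    then obtain i q where "z = (i, a i q)" "q < r i" by auto
    then show ?thesis by (auto simp: glue_def intro!: exI[of _ i] exI[of _ q])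
  qed
qed

text \<open>
  The cone of the multiplication \<open>S/(I : g) (-c) \<rightarrow> S/I\<close> by \<open>g\<close>, whose cokernel is
  \<open>S/(I + (g))\<close> and which is injective. The resolution of \<open>S/(I : g)\<close> enters with its homological position raised
  by one and its degrees raised by \<open>c\<close>. Exactness in position 1 is the only place where injectivity is
  used: if \<open>(x, y)\<close> is a cycle there, then \<open>g e' y \<in> I\<close>, so \<open>y\<close> is a boundary.
\<close>

lemma mapping_cone_resolution:
  assumes I: "homogeneous_ideal I" and g: "homogeneous g c"
    and T: "resolution_support I T" and T': "resolution_support {a. g * a \<in> I} T'"
  shows "resolution_support (add_principal I g) (T \<union> (\<lambda>(i, j). (Suc i, j + c)) ` T')"
proof -
  have I0: "is_ideal I" using I by (simp add: homogeneous_ideal_def)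
  obtain rk dg e D where R: "graded_free_resolution I rk dg e D"
    and T_def: "T = {(i, dg i q) | i q. q < rk i}" using T by (auto simp: resolution_support_def)
  obtain rk' dg' e' D' where R': "graded_free_resolution {a. g * a \<in> I} rk' dg' e' D'"
    and T'_def: "T' = {(i, dg' i q) | i q. q < rk' i}" using T' by (auto simp: resolution_support_def)
  have C: "graded_complex I rk dg e D" and C': "graded_complex {a. g * a \<in> I} rk' dg' e' D'"
    using R R' by (auto simp: graded_free_resolution_iff)
  obtain \<theta> where \<theta>: "\<And>i. graded_mat (rk i) (rk' i) (dg i) (\<lambda>q. dg' i q + c) (\<theta> i)"
    and chain: "\<And>i. D i * \<theta> (Suc i) = \<theta> i * D' i"
    and aug: "\<And>q. q < rk' 0 \<Longrightarrow> g * e' $ q - e \<bullet> col (\<theta> 0) q \<in> I"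
    using comparison_map_exists[OF C' R I g] by auto
  have D: "graded_mat (rk i) (rk (Suc i)) (dg i) (dg (Suc i)) (D i)"
    and DD: "D i * D (Suc i) = 0\<^sub>m (rk i) (rk (Suc (Suc i)))"
    and e: "graded_vec (rk 0) (dg 0) e" for i
    using C by (auto simp: graded_complex_def)
  have D': "graded_mat (rk' i) (rk' (Suc i)) (dg' i) (dg' (Suc i)) (D' i)"
    and D'D': "D' i * D' (Suc i) = 0\<^sub>m (rk' i) (rk' (Suc (Suc i)))"
    and e': "graded_vec (rk' 0) (dg' 0) e'" for i
    using C' by (auto simp: graded_complex_def)
  note Dc = graded_mat_carrier[OF D] and D'c = graded_mat_carrier[OF D']
    and \<theta>c = graded_mat_carrier[OF \<theta>] and ec = graded_vec_carrier[OF e]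
    and e'c = graded_vec_carrier[OF e']
  \<comment> \<open>The shifted resolution of the colon ideal, with the usual sign in its differentials; it is
    zero in position 0.\<close>
  define rG where "rG = (\<lambda>i. case i of 0 \<Rightarrow> 0 | Suc i \<Rightarrow> rk' i)"
  define dG where "dG = (\<lambda>i q. case i of 0 \<Rightarrow> 0 | Suc i \<Rightarrow> dg' i q + c)"
  define DG where "DG = (\<lambda>i. case i of 0 \<Rightarrow> 0\<^sub>m 0 (rk' 0) | Suc i \<Rightarrow> - D' i)"
  have [simp]: "rG 0 = 0" "rG (Suc i) = rk' i" "DG 0 = 0\<^sub>m 0 (rk' 0)" "DG (Suc i) = - D' i"
    "dG (Suc i) = (\<lambda>q. dg' i q + c)" for i
    by (auto simp: rG_def DG_def dG_def)
  have DG: "graded_mat (rG i) (rG (Suc i)) (dG i) (dG (Suc i)) (DG i)" for i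
    using graded_mat_uminus[OF D'] by (cases i) (auto simp: graded_mat_shift, simp add: graded_mat_def)
  have \<theta>G: "graded_mat (rk i) (rG (Suc i)) (dg i) (dG (Suc i)) (\<theta> i)" for i
    using \<theta> by simp
  have DGDG: "DG i * DG (Suc i) = 0\<^sub>m (rG i) (rG (Suc (Suc i)))" for i
  proof (cases i)
    case 0
    then show ?thesis using D'c[of 0] by (auto intro!: eq_matI)
  next
    case (Suc i')
    have "- D' i' * - D' (Suc i') = D' i' * D' (Suc i')"
      using D'c[of i'] D'c[of "Suc i'"] by (intro eq_matI) auto
    then show ?thesis using Suc D'D' by simp
  qed
  have anti: "D i * \<theta> (Suc i) = \<theta> i * - DG (Suc i)" for i
    using chain D'c[of i] by simp
  note DGc = graded_mat_carrier[OF DG] and \<theta>Gc = graded_mat_carrier[OF \<theta>G]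
  define rC where "rC = (\<lambda>i. rk i + rG i)"
  define dC where "dC = (\<lambda>i. glue (rk i) (dg i) (dG i))"
  define DC where "DC = (\<lambda>i. block_mat (D i) (\<theta> i) (DG i))"
  define eC where "eC = e @\<^sub>v (0\<^sub>v 0)"
  have eC: "graded_vec (rC 0) (dC 0) eC"
    unfolding rC_def dC_def eC_def by (rule graded_vec_append[OF e]) (auto simp: graded_vec_def)
  have eCx: "eC \<bullet> (x @\<^sub>v y) = e \<bullet> x" if "x \<in> carrier_vec (rk 0)" "y \<in> carrier_vec 0" for x y
    unfolding eC_def using scalar_prod_append[OF ec _ that, of "0\<^sub>v 0"] that by (simp add: scalar_prod_def)
  have Mult: "DC i *\<^sub>v (x @\<^sub>v y) = (D i *\<^sub>v x + \<theta> i *\<^sub>v y) @\<^sub>v (DG i *\<^sub>v y)"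
    if "x \<in> carrier_vec (rk (Suc i))" "y \<in> carrier_vec (rG (Suc i))" for i x y
    unfolding DC_def by (rule block_mat_mult_vec[OF Dc \<theta>Gc DGc that])
  have augw: "g * (e' \<bullet> y) - e \<bullet> (\<theta> 0 *\<^sub>v y) \<in> I" if "y \<in> carrier_vec (rk' 0)" for y
    by (rule augmentation_comparison[OF I0 ec e'c \<theta>c aug that])
  have sub: "e \<bullet> (x - z) = e \<bullet> x - e \<bullet> z" "e \<bullet> (x + z) = e \<bullet> x + e \<bullet> z"
    if "x \<in> carrier_vec (rk 0)" "z \<in> carrier_vec (rk 0)" for x z
    using scalar_prod_minus_distrib[OF ec that] scalar_prod_add_distrib[OF ec that] by auto
  have eD: "e \<bullet> (D 0 *\<^sub>v x) \<in> I" if "x \<in> carrier_vec (rk 1)" for x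
    using C that by (simp add: graded_complex_def)
  have complex: "graded_complex (add_principal I g) rC dC eC DC"
    unfolding graded_complex_def
  proof (intro conjI allI ballI)
    show "graded_mat (rC i) (rC (Suc i)) (dC i) (dC (Suc i)) (DC i)" for i
      unfolding rC_def dC_def DC_def by (rule graded_mat_block[OF D \<theta>G DG])
    show "DC i * DC (Suc i) = 0\<^sub>m (rC i) (rC (Suc (Suc i)))" for i
      unfolding rC_def DC_def by (rule block_mat_mult[OF Dc \<theta>Gc DGc Dc \<theta>Gc DGc DD DGDG anti])
    fix w :: "('a, 'b) mpoly vec" assume "w \<in> carrier_vec (rC 1)"
    then obtain x y where w: "w = x @\<^sub>v y" "x \<in> carrier_vec (rk 1)" "y \<in> carrier_vec (rk' 0)"
      unfolding rC_def by (auto elim: carrier_vec_append_cases)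
    have "eC \<bullet> (DC 0 *\<^sub>v w) = e \<bullet> (D 0 *\<^sub>v x) + e \<bullet> (\<theta> 0 *\<^sub>v y)"
    proof -
      have "D 0 *\<^sub>v x \<in> carrier_vec (rk 0)" "\<theta> 0 *\<^sub>v y \<in> carrier_vec (rk 0)"
        "0\<^sub>m 0 (rk' 0) *\<^sub>v y \<in> carrier_vec 0"
        using Dc[of 0] \<theta>c[of 0] w by (auto simp: zero_mat_mult_vec)
      then show ?thesis using w Mult[of x 0 y] by (simp add: eCx sub(2))
    qed
    also have "\<dots> = (e \<bullet> (D 0 *\<^sub>v x) - (g * (e' \<bullet> y) - e \<bullet> (\<theta> 0 *\<^sub>v y))) + g * (e' \<bullet> y)" by simp
    also have "\<dots> \<in> add_principal I g"
      using ideal.subspace_diff[OF I0 eD[OF w(2)] augw[OF w(3)]] unfolding add_principal_def by blast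
    finally show "eC \<bullet> (DC 0 *\<^sub>v w) \<in> add_principal I g" .
  qed (rule eC)
  have "graded_free_resolution (add_principal I g) rC dC eC DC"
    unfolding graded_free_resolution_iff
  proof (intro conjI allI ballI impI)
    show "graded_complex (add_principal I g) rC dC eC DC" by (rule complex)
  next
    fix f
    obtain x where x: "x \<in> carrier_vec (rk 0)" "f - e \<bullet> x \<in> I"
      using R unfolding graded_free_resolution_iff by blast
    have "f - e \<bullet> x = (f - e \<bullet> x) + g * 0" by simp
    then have "f - e \<bullet> x \<in> add_principal I g" using x unfolding add_principal_def by blast
    then show "\<exists>v\<in>carrier_vec (rC 0). f - eC \<bullet> v \<in> add_principal I g"
      using x eCx[of x "0\<^sub>v 0"] append_carrier_vec[of x "rk 0" "0\<^sub>v 0" 0]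
      by (intro bexI[of _ "x @\<^sub>v 0\<^sub>v 0"]) (auto simp: rC_def)
  next
    fix v assume v: "v \<in> carrier_vec (rC 0)" "eC \<bullet> v \<in> add_principal I g"
    then obtain x y where xy: "v = x @\<^sub>v y" "x \<in> carrier_vec (rk 0)" "y \<in> carrier_vec 0"
      using carrier_vec_append_cases[of v "rk 0" 0] by (auto simp: rC_def)
    obtain i a where ia: "e \<bullet> x = i + g * a" "i \<in> I"
      using v(2) xy eCx[of x y] by (auto simp: add_principal_def)
    \<comment> \<open>The multiple of \<open>g\<close> comes from the new generators in position 1.\<close>
    obtain z where z: "z \<in> carrier_vec (rk' 0)" "g * (a - e' \<bullet> z) \<in> I"
      using R' unfolding graded_free_resolution_iff by blast
    have \<theta>z: "\<theta> 0 *\<^sub>v z \<in> carrier_vec (rk 0)" using \<theta>c[of 0] z by auto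
    have "e \<bullet> (x - \<theta> 0 *\<^sub>v z) = i + g * (a - e' \<bullet> z) + (g * (e' \<bullet> z) - e \<bullet> (\<theta> 0 *\<^sub>v z))"
      using sub(1)[OF xy(2) \<theta>z] ia by (simp add: algebra_simps)
    also have "\<dots> \<in> I"
      using ia z augw[OF z(1)] ideal.subspace_add[OF I0] by blast
    finally obtain t where t: "t \<in> carrier_vec (rk 1)" "D 0 *\<^sub>v t = x - \<theta> 0 *\<^sub>v z"
      using R xy \<theta>z unfolding graded_free_resolution_iff by (meson minus_carrier_vec)
    have "y = DG 0 *\<^sub>v z" using xy z by (intro eq_vecI) auto
    then have "DC 0 *\<^sub>v (t @\<^sub>v z) = v"
      using Mult[of t 0 z] t z vec_minus_add[OF xy(2) \<theta>z] xy(1) by simp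
    then show "\<exists>w\<in>carrier_vec (rC 1). DC 0 *\<^sub>v w = v"
      using t z by (intro bexI[of _ "t @\<^sub>v z"]) (auto simp: rC_def)
  next
    fix i v assume v: "v \<in> carrier_vec (rC (Suc i))" "DC i *\<^sub>v v = 0\<^sub>v (rC i)"
    obtain x y where xy: "v = x @\<^sub>v y" "x \<in> carrier_vec (rk (Suc i))" "y \<in> carrier_vec (rk' i)"
      using v(1) unfolding rC_def by (auto elim: carrier_vec_append_cases)
    have "0\<^sub>v (rC i) = 0\<^sub>v (rk i) @\<^sub>v 0\<^sub>v (rG i)" by (auto simp: rC_def)
    then have "(D i *\<^sub>v x + \<theta> i *\<^sub>v y) @\<^sub>v (DG i *\<^sub>v y) = 0\<^sub>v (rk i) @\<^sub>v 0\<^sub>v (rG i)"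
      using v(2) Mult[of x i y] xy by simp
    moreover have "D i *\<^sub>v x + \<theta> i *\<^sub>v y \<in> carrier_vec (rk i)" using Dc[of i] \<theta>c[of i] xy by auto
    ultimately have zero: "D i *\<^sub>v x + \<theta> i *\<^sub>v y = 0\<^sub>v (rk i)" and zG: "DG i *\<^sub>v y = 0\<^sub>v (rG i)"
      using append_vec_eq[of "D i *\<^sub>v x + \<theta> i *\<^sub>v y" "rk i" "0\<^sub>v (rk i)"] by auto
    have "\<exists>z\<in>carrier_vec (rk' (Suc i)). D' i *\<^sub>v z = y"
    proof (cases i)
      case 0
      have Dx: "D 0 *\<^sub>v x \<in> carrier_vec (rk 0)" and \<theta>y: "\<theta> 0 *\<^sub>v y \<in> carrier_vec (rk 0)"
        using Dc[of 0] \<theta>c[of 0] xy 0 by auto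
      have "e \<bullet> (D 0 *\<^sub>v x) + e \<bullet> (\<theta> 0 *\<^sub>v y) = 0"
        using sub(2)[OF Dx \<theta>y] zero 0 ec by simp
      then have "g * (e' \<bullet> y) = (g * (e' \<bullet> y) - e \<bullet> (\<theta> 0 *\<^sub>v y)) - e \<bullet> (D 0 *\<^sub>v x)"
        by (simp add: algebra_simps add_eq_0_iff)
      also have "\<dots> \<in> I"
        using ideal.subspace_diff[OF I0 augw eD] xy 0 by simp
      finally show ?thesis
        using R' xy 0 unfolding graded_free_resolution_iff by simp
    next
      case (Suc i')
      have "- (D' i' *\<^sub>v y) = 0\<^sub>v (rk' i')" using zG Suc D'c[of i'] xy by simp
      then have "D' i' *\<^sub>v y = 0\<^sub>v (rk' i')"
        using uminus_zero_vec_eq[of "D' i' *\<^sub>v y" "rk' i'"] D'c[of i'] xy Suc by auto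
      then show ?thesis using R' xy Suc unfolding graded_free_resolution_iff by blast
    qed
    then obtain z where z: "z \<in> carrier_vec (rk' (Suc i))" "D' i *\<^sub>v z = y" by blast
    \<comment> \<open>The sign compensates the one in the shifted differential.\<close>
    define z' where "z' = - z"
    have z': "z' \<in> carrier_vec (rG (Suc (Suc i)))" "DG (Suc i) *\<^sub>v z' = y"
      using z D'c[of i] by (auto simp: z'_def intro!: eq_vecI)
    have exA: "\<exists>t\<in>carrier_vec (rk (Suc (Suc i))). D (Suc i) *\<^sub>v t = x"
      if "x \<in> carrier_vec (rk (Suc i))" "D i *\<^sub>v x = 0\<^sub>v (rk i)" for x
      using R that unfolding graded_free_resolution_iff by blast
    show "\<exists>w\<in>carrier_vec (rC (Suc (Suc i))). DC (Suc i) *\<^sub>v w = v"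
      using block_mat_exact[OF Dc[of i] \<theta>Gc[of i] DGc[of i] Dc[of "Suc i"] \<theta>Gc[of "Suc i"]
          DGc[of "Suc i"] anti exA xy(2) z'(1)] zero z'(2) xy(1)
      unfolding rC_def DC_def by simp
  qed
  moreover have "T \<union> (\<lambda>(i, j). (Suc i, j + c)) ` T' = {(i, dC i q) | i q. q < rC i}"
  proof -
    have "{(i, dG i q) | i q. q < rG i} = (\<lambda>(i, j). (Suc i, j + c)) ` T'"
    proof (intro equalityI subsetI)
      fix z assume "z \<in> {(i, dG i q) | i q. q < rG i}"
      then obtain i q where "z = (i, dG i q)" "q < rG i" by auto
      then show "z \<in> (\<lambda>(i, j). (Suc i, j + c)) ` T'"
        by (cases i) (auto simp: T'_def intro!: rev_image_eqI)
    next
      fix z assume "z \<in> (\<lambda>(i, j). (Suc i, j + c)) ` T'"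
      then obtain i q where "z = (Suc i, dg' i q + c)" "q < rk' i" by (auto simp: T'_def)
      then show "z \<in> {(i, dG i q) | i q. q < rG i}"
        by (auto intro!: exI[of _ "Suc i"] exI[of _ q])
    qed
    then show ?thesis unfolding T_def rC_def dC_def glue_support by simp
  qed
  ultimately show ?thesis unfolding resolution_support_def by blast
qed

text \<open>
  The horseshoe lemma for \<open>0 \<rightarrow> S/(I : g) (-c) \<rightarrow> S/I \<rightarrow> S/(I + (g)) \<rightarrow> 0\<close>. The twist \<open>\<theta>\<close> is a
  comparison map from the resolution of \<open>S/(I + (g))\<close>, truncated in position 0, to the one of
  \<open>S/(I : g)\<close>. It lifts the map \<open>\<epsilon>\<close> that expresses, modulo \<open>I\<close>, the relations of \<open>S/(I + (g))\<close> as
  multiples of \<open>-g\<close>.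
\<close>

lemma horseshoe_resolution:
  assumes I: "homogeneous_ideal I" and g: "homogeneous g c"
    and T: "resolution_support {a. g * a \<in> I} T" and T': "resolution_support (add_principal I g) T'"
  shows "resolution_support I ((\<lambda>(i, j). (i, j + c)) ` T \<union> T')"
proof -
  define J where "J = {a. g * a \<in> I}"
  have I0: "is_ideal I" using I by (simp add: homogeneous_ideal_def)
  have J: "homogeneous_ideal J" unfolding J_def by (rule homogeneous_ideal_colon[OF I g])
  then have J0: "is_ideal J" by (simp add: homogeneous_ideal_def)
  obtain rk dg e D where R: "graded_free_resolution J rk dg e D"
    and T_def: "T = {(i, dg i q) | i q. q < rk i}" using T by (auto simp: resolution_support_def J_def)
  obtain rk' dg' e' D' where R': "graded_free_resolution (add_principal I g) rk' dg' e' D'"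
    and T'_def: "T' = {(i, dg' i q) | i q. q < rk' i}" using T' by (auto simp: resolution_support_def)
  have C: "graded_complex J rk dg e D" and C': "graded_complex (add_principal I g) rk' dg' e' D'"
    using R R' by (auto simp: graded_free_resolution_iff)
  have D: "graded_mat (rk i) (rk (Suc i)) (dg i) (dg (Suc i)) (D i)"
    and DD: "D i * D (Suc i) = 0\<^sub>m (rk i) (rk (Suc (Suc i)))"
    and e: "graded_vec (rk 0) (dg 0) e" for i
    using C by (auto simp: graded_complex_def)
  have D': "graded_mat (rk' i) (rk' (Suc i)) (dg' i) (dg' (Suc i)) (D' i)"
    and D'D': "D' i * D' (Suc i) = 0\<^sub>m (rk' i) (rk' (Suc (Suc i)))"
    and e': "graded_vec (rk' 0) (dg' 0) e'" for i
    using C' by (auto simp: graded_complex_def)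
  note Dc = graded_mat_carrier[OF D] and D'c = graded_mat_carrier[OF D']
    and ec = graded_vec_carrier[OF e] and e'c = graded_vec_carrier[OF e']
  have "\<exists>a. homogeneous a (dg' 1 q - c) \<and> g * a + e' \<bullet> col (D' 0) q \<in> I" if q: "q < rk' 1" for q
  proof -
    have "e' \<bullet> (D' 0 *\<^sub>v unit_vec (rk' 1) q) \<in> add_principal I g"
      using C' by (simp add: graded_complex_def)
    then obtain i a where ia: "e' \<bullet> col (D' 0) q = i + g * a" "i \<in> I"
      using mult_mat_unit_vec[OF D'c[of 0]] q by (auto simp: add_principal_def)
    have "homogeneous (e' $ p * D' 0 $$ (p, q)) (dg' 1 q)" if "p < rk' 0" for p
      using homogeneous_mult[of "e' $ p" "dg' 0 p" "D' 0 $$ (p, q)" "dg' 1 q - dg' 0 p"] e' D'[of 0] that q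
      by (simp add: graded_vec_def graded_mat_def)
    then have "homogeneous (e' \<bullet> col (D' 0) q) (dg' 1 q)"
      using D'c[of 0] q by (auto simp: scalar_prod_def intro!: homogeneous_sum)
    then have "g * hom_part (dg' 1 q - c) (- a) + e' \<bullet> col (D' 0) q =
        hom_part (dg' 1 q) (g * (- a) + e' \<bullet> col (D' 0) q)"
      by (simp only: hom_part_add hom_part_mult[OF g] hom_part_homogeneous if_True simp_thms)
    also have "\<dots> \<in> I" using ia I by (simp add: homogeneous_ideal_def)
    finally show ?thesis by (metis homogeneous_hom_part)
  qed
  then obtain a where a: "\<And>q. q < rk' 1 \<Longrightarrow> homogeneous (a q) (dg' 1 q - c) \<and> g * a q + e' \<bullet> col (D' 0) q \<in> I"
    by metis
  define \<epsilon> where "\<epsilon> = vec (rk' 1) a"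
  have \<epsilon>c: "\<epsilon> \<in> carrier_vec (rk' 1)" by (simp add: \<epsilon>_def)
  have e'aug: "g * (\<epsilon> \<bullet> y) + e' \<bullet> (D' 0 *\<^sub>v y) \<in> I" if y: "y \<in> carrier_vec (rk' 1)" for y
  proof -
    have "g * \<epsilon> $ q - (- e') \<bullet> col (D' 0) q \<in> I" if "q < rk' 1" for q
      using a[OF that] e'c D'c[of 0] that by (simp add: \<epsilon>_def)
    then have "g * (\<epsilon> \<bullet> y) - (- e') \<bullet> (D' 0 *\<^sub>v y) \<in> I"
      using augmentation_comparison[OF I0 _ \<epsilon>c _ _ y, of "- e'" "rk' 0" "D' 0" g] e'c D'c[of 0] by simp
    then show ?thesis using e'c D'c[of 0] by simp
  qed
  \<comment> \<open>The truncated resolution is a complex over \<open>S/(I : g)\<close> with augmentation \<open>\<epsilon>\<close>; the sign makes the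
    twisted differential square to zero.\<close>
  have "graded_complex J (\<lambda>i. rk' (Suc i)) (\<lambda>i q. dg' (Suc i) q - c) \<epsilon> (\<lambda>i. - D' (Suc i))"
    unfolding graded_complex_def
  proof (intro conjI allI ballI)
    show "graded_vec (rk' (Suc 0)) (\<lambda>q. dg' (Suc 0) q - c) \<epsilon>"
      using a by (simp add: graded_vec_def \<epsilon>_def)
    show "graded_mat (rk' (Suc i)) (rk' (Suc (Suc i))) (\<lambda>q. dg' (Suc i) q - c)
        (\<lambda>q. dg' (Suc (Suc i)) q - c) (- D' (Suc i))" for i
      using graded_mat_uminus[OF D'[of "Suc i"]] by (simp add: graded_mat_def)
    show "- D' (Suc i) * - D' (Suc (Suc i)) = 0\<^sub>m (rk' (Suc i)) (rk' (Suc (Suc (Suc i))))" for i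
    proof -
      have "- D' (Suc i) * - D' (Suc (Suc i)) = D' (Suc i) * D' (Suc (Suc i))"
        using D'c[of "Suc i"] D'c[of "Suc (Suc i)"] by (intro eq_matI) auto
      then show ?thesis using D'D' by simp
    qed
    fix w :: "('a, 'b) mpoly vec" assume "w \<in> carrier_vec (rk' (Suc 1))"
    then have w: "w \<in> carrier_vec (rk' (Suc (Suc 0)))" by simp
    then have Dw: "D' (Suc 0) *\<^sub>v w \<in> carrier_vec (rk' (Suc 0))" using D'c[of "Suc 0"] by auto
    have "D' 0 *\<^sub>v (D' (Suc 0) *\<^sub>v w) = 0\<^sub>v (rk' 0)"
      using assoc_mult_mat_vec[OF D'c D'c w] zero_mat_mult_vec[OF w] D'D'[of 0] by simp
    then have "g * (\<epsilon> \<bullet> (D' (Suc 0) *\<^sub>v w)) \<in> I"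
      using e'aug[of "D' (Suc 0) *\<^sub>v w"] Dw e'c by simp
    moreover have "g * (\<epsilon> \<bullet> (- D' (Suc 0) *\<^sub>v w)) = - (g * (\<epsilon> \<bullet> (D' (Suc 0) *\<^sub>v w)))"
      using D'c[of "Suc 0"] w \<epsilon>c by simp
    ultimately show "\<epsilon> \<bullet> (- D' (Suc 0) *\<^sub>v w) \<in> J"
      using ideal.subspace_neg[OF I0] unfolding J_def by auto
  qed
  from comparison_map_exists[OF this R J homogeneous_1]
  obtain \<theta> where \<theta>0: "\<And>i. graded_mat (rk i) (rk' (Suc i)) (dg i) (\<lambda>q. dg' (Suc i) q - c) (\<theta> i)"
    and anti: "\<And>i. D i * \<theta> (Suc i) = \<theta> i * - D' (Suc i)"
    and aug: "\<And>q. q < rk' (Suc 0) \<Longrightarrow> 1 * \<epsilon> $ q - e \<bullet> col (\<theta> 0) q \<in> J"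
    by auto
  define dF where "dF = (\<lambda>i q. dg i q + c)"
  have \<theta>: "graded_mat (rk i) (rk' (Suc i)) (dF i) (dg' (Suc i)) (\<theta> i)" for i
    using \<theta>0[of i] by (simp add: graded_mat_def dF_def algebra_simps)
  have DF: "graded_mat (rk i) (rk (Suc i)) (dF i) (dF (Suc i)) (D i)" for i
    unfolding dF_def graded_mat_shift by (rule D)
  note \<theta>c = graded_mat_carrier[OF \<theta>]
  define rC where "rC = (\<lambda>i. rk i + rk' i)"
  define dC where "dC = (\<lambda>i. glue (rk i) (dF i) (dg' i))"
  define DC where "DC = (\<lambda>i. block_mat (D i) (\<theta> i) (D' i))"
  define eC where "eC = (g \<cdot>\<^sub>v e) @\<^sub>v e'"
  have "graded_vec (rk 0) (dF 0) (g \<cdot>\<^sub>v e)"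
    using e homogeneous_mult[OF g] unfolding graded_vec_def dF_def by (auto simp: add.commute[of _ c])
  then have eC: "graded_vec (rC 0) (dC 0) eC"
    unfolding rC_def dC_def eC_def by (rule graded_vec_append[OF _ e'])
  have eCx: "eC \<bullet> (x @\<^sub>v y) = g * (e \<bullet> x) + e' \<bullet> y"
    if "x \<in> carrier_vec (rk 0)" "y \<in> carrier_vec (rk' 0)" for x y
    unfolding eC_def using scalar_prod_append[OF _ e'c that, of "g \<cdot>\<^sub>v e"] ec that by simp
  have Mult: "DC i *\<^sub>v (x @\<^sub>v y) = (D i *\<^sub>v x + \<theta> i *\<^sub>v y) @\<^sub>v (D' i *\<^sub>v y)"
    if "x \<in> carrier_vec (rk (Suc i))" "y \<in> carrier_vec (rk' (Suc i))" for i x y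
    unfolding DC_def by (rule block_mat_mult_vec[OF Dc \<theta>c D'c that])
  have augw: "\<epsilon> \<bullet> y - e \<bullet> (\<theta> 0 *\<^sub>v y) \<in> J" if "y \<in> carrier_vec (rk' (Suc 0))" for y
    using augmentation_comparison[OF J0 ec _ \<theta>c aug that] \<epsilon>c by simp
  have sub: "e \<bullet> (x - z) = e \<bullet> x - e \<bullet> z" "e \<bullet> (x + z) = e \<bullet> x + e \<bullet> z"
    if "x \<in> carrier_vec (rk 0)" "z \<in> carrier_vec (rk 0)" for x z
    using scalar_prod_minus_distrib[OF ec that] scalar_prod_add_distrib[OF ec that] by auto
  have eD: "e \<bullet> (D 0 *\<^sub>v x) \<in> J" if "x \<in> carrier_vec (rk (Suc 0))" for x
    using C that by (simp add: graded_complex_def)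
  have complex: "graded_complex I rC dC eC DC"
    unfolding graded_complex_def
  proof (intro conjI allI ballI)
    show "graded_mat (rC i) (rC (Suc i)) (dC i) (dC (Suc i)) (DC i)" for i
      unfolding rC_def dC_def DC_def by (rule graded_mat_block[OF DF \<theta> D'])
    show "DC i * DC (Suc i) = 0\<^sub>m (rC i) (rC (Suc (Suc i)))" for i
      unfolding rC_def DC_def by (rule block_mat_mult[OF Dc \<theta>c D'c Dc \<theta>c D'c DD D'D' anti])
    fix w :: "('a, 'b) mpoly vec" assume "w \<in> carrier_vec (rC 1)"
    then obtain x y where w: "w = x @\<^sub>v y" "x \<in> carrier_vec (rk (Suc 0))" "y \<in> carrier_vec (rk' (Suc 0))"
      unfolding rC_def by (auto elim: carrier_vec_append_cases)
    have Dx: "D 0 *\<^sub>v x \<in> carrier_vec (rk 0)" and \<theta>y: "\<theta> 0 *\<^sub>v y \<in> carrier_vec (rk 0)"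
      and D'y: "D' 0 *\<^sub>v y \<in> carrier_vec (rk' 0)"
      using Dc[of 0] \<theta>c[of 0] D'c[of 0] w by auto
    have "eC \<bullet> (DC 0 *\<^sub>v w) = g * (e \<bullet> (D 0 *\<^sub>v x) + e \<bullet> (\<theta> 0 *\<^sub>v y)) + e' \<bullet> (D' 0 *\<^sub>v y)"
      using w Mult[of x 0 y] Dx \<theta>y D'y by (simp add: eCx sub(2))
    also have "\<dots> = g * (e \<bullet> (D 0 *\<^sub>v x) - (\<epsilon> \<bullet> y - e \<bullet> (\<theta> 0 *\<^sub>v y))) + (g * (\<epsilon> \<bullet> y) + e' \<bullet> (D' 0 *\<^sub>v y))"
      by (simp add: algebra_simps)
    also have "\<dots> \<in> I"
    proof (rule ideal.subspace_add[OF I0 _ e'aug])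
      show "g * (e \<bullet> (D 0 *\<^sub>v x) - (\<epsilon> \<bullet> y - e \<bullet> (\<theta> 0 *\<^sub>v y))) \<in> I"
        using ideal.subspace_diff[OF J0 eD[OF w(2)] augw[OF w(3)]] unfolding J_def by blast
      show "y \<in> carrier_vec (rk' 1)" using w by simp
    qed
    finally show "eC \<bullet> (DC 0 *\<^sub>v w) \<in> I" .
  qed (rule eC)
  have "graded_free_resolution I rC dC eC DC"
    unfolding graded_free_resolution_iff
  proof (intro conjI allI ballI impI)
    show "graded_complex I rC dC eC DC" by (rule complex)
  next
    fix f
    obtain y where y: "y \<in> carrier_vec (rk' 0)" "f - e' \<bullet> y \<in> add_principal I g"
      using R' unfolding graded_free_resolution_iff by blast
    then obtain i b where ib: "f - e' \<bullet> y = i + g * b" "i \<in> I" by (auto simp: add_principal_def)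
    obtain x where x: "x \<in> carrier_vec (rk 0)" "b - e \<bullet> x \<in> J"
      using R unfolding graded_free_resolution_iff by blast
    have "f - eC \<bullet> (x @\<^sub>v y) = i + g * (b - e \<bullet> x)"
      using eCx[OF x(1) y(1)] ib by (simp add: algebra_simps)
    also have "\<dots> \<in> I" using ib x ideal.subspace_add[OF I0] unfolding J_def by blast
    finally show "\<exists>v\<in>carrier_vec (rC 0). f - eC \<bullet> v \<in> I"
      using x y by (intro bexI[of _ "x @\<^sub>v y"]) (auto simp: rC_def)
  next
    fix v assume v: "v \<in> carrier_vec (rC 0)" "eC \<bullet> v \<in> I"
    then obtain x y where xy: "v = x @\<^sub>v y" "x \<in> carrier_vec (rk 0)" "y \<in> carrier_vec (rk' 0)"
      unfolding rC_def by (auto elim: carrier_vec_append_cases)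
    have exy: "g * (e \<bullet> x) + e' \<bullet> y \<in> I" using v(2) xy eCx[of x y] by simp
    have "e' \<bullet> y = (g * (e \<bullet> x) + e' \<bullet> y) + g * (- (e \<bullet> x))" by simp
    then have "e' \<bullet> y \<in> add_principal I g" using exy unfolding add_principal_def by blast
    then obtain z where z: "z \<in> carrier_vec (rk' (Suc 0))" "D' 0 *\<^sub>v z = y"
      using R' xy unfolding graded_free_resolution_iff by auto
    have \<theta>z: "\<theta> 0 *\<^sub>v z \<in> carrier_vec (rk 0)" using \<theta>c[of 0] z by auto
    have "g * (e \<bullet> x - \<epsilon> \<bullet> z) = (g * (e \<bullet> x) + e' \<bullet> y) - (g * (\<epsilon> \<bullet> z) + e' \<bullet> (D' 0 *\<^sub>v z))"
      using z by (simp add: algebra_simps)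
    also have "\<dots> \<in> I" using ideal.subspace_diff[OF I0 exy e'aug[of z]] z(1) by simp
    finally have "e \<bullet> x - \<epsilon> \<bullet> z \<in> J" by (simp add: J_def)
    then have "(e \<bullet> x - \<epsilon> \<bullet> z) + (\<epsilon> \<bullet> z - e \<bullet> (\<theta> 0 *\<^sub>v z)) \<in> J"
      using ideal.subspace_add[OF J0 _ augw[OF z(1)]] by blast
    then have "e \<bullet> (x - \<theta> 0 *\<^sub>v z) \<in> J" using sub(1)[OF xy(2) \<theta>z] by simp
    then obtain t where t: "t \<in> carrier_vec (rk 1)" "D 0 *\<^sub>v t = x - \<theta> 0 *\<^sub>v z"
      using R xy \<theta>z unfolding graded_free_resolution_iff by (meson minus_carrier_vec)
    have "DC 0 *\<^sub>v (t @\<^sub>v z) = v"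
      using Mult[of t 0 z] t z vec_minus_add[OF xy(2) \<theta>z] xy(1) by simp
    then show "\<exists>w\<in>carrier_vec (rC 1). DC 0 *\<^sub>v w = v"
      using t z by (intro bexI[of _ "t @\<^sub>v z"]) (auto simp: rC_def)
  next
    fix i v assume v: "v \<in> carrier_vec (rC (Suc i))" "DC i *\<^sub>v v = 0\<^sub>v (rC i)"
    obtain x y where xy: "v = x @\<^sub>v y" "x \<in> carrier_vec (rk (Suc i))" "y \<in> carrier_vec (rk' (Suc i))"
      using v(1) unfolding rC_def by (auto elim: carrier_vec_append_cases)
    have "0\<^sub>v (rC i) = 0\<^sub>v (rk i) @\<^sub>v 0\<^sub>v (rk' i)" by (auto simp: rC_def)
    then have "(D i *\<^sub>v x + \<theta> i *\<^sub>v y) @\<^sub>v (D' i *\<^sub>v y) = 0\<^sub>v (rk i) @\<^sub>v 0\<^sub>v (rk' i)"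
      using v(2) Mult[of x i y] xy by simp
    moreover have "D i *\<^sub>v x + \<theta> i *\<^sub>v y \<in> carrier_vec (rk i)" using Dc[of i] \<theta>c[of i] xy by auto
    ultimately have zero: "D i *\<^sub>v x + \<theta> i *\<^sub>v y = 0\<^sub>v (rk i)" and zG: "D' i *\<^sub>v y = 0\<^sub>v (rk' i)"
      using append_vec_eq[of "D i *\<^sub>v x + \<theta> i *\<^sub>v y" "rk i" "0\<^sub>v (rk i)"] by auto
    obtain z where z: "z \<in> carrier_vec (rk' (Suc (Suc i)))" "D' (Suc i) *\<^sub>v z = y"
      using R' xy zG unfolding graded_free_resolution_iff by blast
    have exA: "\<exists>t\<in>carrier_vec (rk (Suc (Suc i))). D (Suc i) *\<^sub>v t = x"
      if "x \<in> carrier_vec (rk (Suc i))" "D i *\<^sub>v x = 0\<^sub>v (rk i)" for x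
      using R that unfolding graded_free_resolution_iff by blast
    show "\<exists>w\<in>carrier_vec (rC (Suc (Suc i))). DC (Suc i) *\<^sub>v w = v"
      using block_mat_exact[OF Dc[of i] \<theta>c[of i] D'c[of i] Dc[of "Suc i"] \<theta>c[of "Suc i"]
          D'c[of "Suc i"] anti exA xy(2) z(1)] zero z(2) xy(1)
      unfolding rC_def DC_def by simp
  qed
  moreover have "(\<lambda>(i, j). (i, j + c)) ` T \<union> T' = {(i, dC i q) | i q. q < rC i}"
  proof -
    have "(\<lambda>(i, j). (i, j + c)) ` T = {(i, dF i q) | i q. q < rk i}"
      unfolding T_def dF_def by (auto simp: image_iff)
    then show ?thesis unfolding T'_def rC_def dC_def glue_support by simp
  qed
  ultimately show ?thesis unfolding resolution_support_def by blast
qed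

text \<open>
  The zero module has the zero resolution; this is the base case \<open>I^0 = S\<close>.
\<close>

lemma resolution_support_UNIV: "resolution_support UNIV {}"
proof -
  have [simp]: "carrier_vec 0 = {0\<^sub>v 0 :: 'c::comm_ring_1 vec}" by auto
  have "graded_free_resolution UNIV (\<lambda>_. 0) (\<lambda>_ _. 0) (0\<^sub>v 0) (\<lambda>_. 0\<^sub>m 0 0)"
    unfolding graded_free_resolution_def by (auto simp: zero_mat_mult_vec)
  then show ?thesis unfolding resolution_support_def by force
qed

lemma resolution_support_zero: "resolution_support {0} {(0, 0)}"
proof -
  define rk where "rk = (\<lambda>i. case i of 0 \<Rightarrow> Suc 0 | Suc _ \<Rightarrow> 0)"
  define e :: "('a, 'b) mpoly vec" where "e = vec 1 (\<lambda>_. 1)"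
  have [simp]: "rk 0 = 1" "rk (Suc i) = 0" for i by (auto simp: rk_def)
  have ev: "e \<bullet> v = v $ 0" if "v \<in> carrier_vec 1" for v
    using that by (simp add: e_def scalar_prod_def)
  have "graded_free_resolution {0} rk (\<lambda>_ _. 0) e (\<lambda>i. 0\<^sub>m (rk i) (rk (Suc i)))"
    unfolding graded_free_resolution_iff graded_complex_def
  proof (intro conjI allI ballI impI)
    show "graded_vec (rk 0) (\<lambda>_. 0) e" by (simp add: graded_vec_def e_def)
    show "\<exists>v\<in>carrier_vec (rk 0). f - e \<bullet> v \<in> {0}" for f
      by (intro bexI[of _ "vec 1 (\<lambda>_. f)"]) (auto simp: ev)
    show "e \<bullet> (0\<^sub>m (rk 0) (rk (Suc 0)) *\<^sub>v w) \<in> {0}"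
      if "w \<in> carrier_vec (rk 1)" for w :: "('a, 'b) mpoly vec"
      using that ev[of "0\<^sub>v 1"] by (simp add: zero_mat_mult_vec)
    show "\<exists>w\<in>carrier_vec (rk 1). 0\<^sub>m (rk 0) (rk (Suc 0)) *\<^sub>v w = v"
      if "v \<in> carrier_vec (rk 0)" "e \<bullet> v \<in> {0}" for v
      using that ev[of v] by (intro bexI[of _ "0\<^sub>v 0"]) (auto intro!: eq_vecI simp: scalar_prod_def)
    show "\<exists>w\<in>carrier_vec (rk (Suc (Suc i))). 0\<^sub>m (rk (Suc i)) (rk (Suc (Suc i))) *\<^sub>v w = v"
      if "v \<in> carrier_vec (rk (Suc i))" for v :: "('a, 'b) mpoly vec" and i
      using that by (intro bexI[of _ "0\<^sub>v 0"]) auto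
  qed (auto simp: graded_mat_def)
  moreover have "{(0, 0)} = {(i, 0 :: int) | i q. q < rk i}"
  proof -
    have "q < rk i \<longleftrightarrow> i = 0 \<and> q = 0" for i q by (cases i) auto
    then show ?thesis by auto
  qed
  ultimately show ?thesis unfolding resolution_support_def by blast
qed

section \<open>Tor and regularity\<close>

text \<open>
  A sum of exponent vectors vanishes only if both vanish, so taking constant terms is
  multiplicative, and tensoring with the residue field commutes with matrix products.
\<close>

lemma constant_term_mult:
  fixes p q :: "('v, 'k::comm_ring_1) mpoly"
  shows "Poly_Mapping.lookup (p * q) 0 = Poly_Mapping.lookup p 0 * Poly_Mapping.lookup q 0"
proof -
  have sum0: "0 = l + n \<longleftrightarrow> l = 0 \<and> n = 0" for l n :: "'v \<Rightarrow>\<^sub>0 nat"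
    by (auto simp: poly_mapping_eq_iff fun_eq_iff lookup_add)
  have "(\<Sum>n. Poly_Mapping.lookup q n when 0 = l + n) = (Poly_Mapping.lookup q 0 when l = 0)" for l
    by (cases "l = 0") (auto simp: sum0)
  then have "Poly_Mapping.lookup (p * q) 0 = (\<Sum>l. (Poly_Mapping.lookup p l * Poly_Mapping.lookup q 0) when l = 0)"
    by (simp add: lookup_mult mult_when)
  then show ?thesis by simp
qed

lemma mult_mat_zero_vec:
  "A \<in> carrier_mat r c \<Longrightarrow> A *\<^sub>v 0\<^sub>v c = (0\<^sub>v r :: 'a::comm_ring_1 vec)"
  by (intro eq_vecI) auto

lemma tensor_diff_carrier: "A \<in> carrier_mat r c \<Longrightarrow> tensor_diff A \<in> carrier_mat r c"
  by (simp add: tensor_diff_def)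

lemma tensor_diff_mult:
  assumes "A \<in> carrier_mat r m" and "B \<in> carrier_mat m c"
  shows "tensor_diff (A * B) = tensor_diff A * tensor_diff B"
  using assms
  by (intro eq_matI) (auto simp: tensor_diff_def scalar_prod_def lookup_sum constant_term_mult)

lemma tensor_diff_add:
  assumes "A \<in> carrier_mat r c" and "B \<in> carrier_mat r c"
  shows "tensor_diff (A + B) = tensor_diff A + tensor_diff B"
  using assms by (intro eq_matI) (auto simp: tensor_diff_def lookup_add)

lemma tensor_diff_one: "tensor_diff (1\<^sub>m r) = 1\<^sub>m r"
  by (intro eq_matI) (auto simp: tensor_diff_def)

lemma tensor_diff_zero: "tensor_diff (0\<^sub>m r c) = 0\<^sub>m r c"
  by (intro eq_matI) (auto simp: tensor_diff_def)

lemma tensor_strand_carrier: "v \<in> tensor_strand r a j \<Longrightarrow> v \<in> carrier_vec r"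
  by (simp add: tensor_strand_def)

text \<open>
  A homogeneous entry with a nonzero constant term has degree 0, so it connects basis elements of
  equal degree.
\<close>

lemma tensor_strand_image:
  assumes A: "graded_mat r c a b A" and w: "w \<in> tensor_strand c b j"
  shows "tensor_diff A *\<^sub>v w \<in> tensor_strand r a j"
  unfolding tensor_strand_def
proof (intro CollectI conjI allI impI)
  note Ac = tensor_diff_carrier[OF graded_mat_carrier[OF A]]
  show "tensor_diff A *\<^sub>v w \<in> carrier_vec r" using Ac tensor_strand_carrier[OF w] by auto
  fix p assume p: "p < r" and "(tensor_diff A *\<^sub>v w) $ p \<noteq> 0"
  then have "(\<Sum>q<c. tensor_diff A $$ (p, q) * w $ q) \<noteq> 0"
    using Ac tensor_strand_carrier[OF w] by (auto simp: scalar_prod_def lessThan_atLeast0)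
  then obtain q where q: "q < c" "tensor_diff A $$ (p, q) * w $ q \<noteq> 0"
    by (metis (no_types, lifting) lessThan_iff sum.neutral)
  then have "b q - a p = 0"
    using A p homogeneous_constant_term[of "A $$ (p, q)" "b q - a p"]
    by (auto simp: graded_mat_def tensor_diff_def)
  then show "a p = j" using q w by (auto simp: tensor_strand_def)
qed

lemma tensor_strand_trivial:
  assumes "v \<in> tensor_strand r a j" and "\<And>p. p < r \<Longrightarrow> a p \<noteq> j"
  shows "v = 0\<^sub>v r"
  using assms unfolding tensor_strand_def by (intro eq_vecI) auto

lemma tor_boundaries_subset_cycles:
  assumes "graded_complex I rk dg e D"
  shows "tor_boundaries rk dg D i j \<subseteq> tor_cycles rk dg D i j"
proof
  fix v assume "v \<in> tor_boundaries rk dg D i j"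
  then obtain w where w: "w \<in> tensor_strand (rk (Suc i)) (dg (Suc i)) j" "v = tensor_diff (D i) *\<^sub>v w"
    by (auto simp: tor_boundaries_def)
  have D: "graded_mat (rk i) (rk (Suc i)) (dg i) (dg (Suc i)) (D i)"
    and DD: "D i * D (Suc i) = 0\<^sub>m (rk i) (rk (Suc (Suc i)))" for i
    using assms by (auto simp: graded_complex_def)
  have "tensor_diff (D i') *\<^sub>v v = 0\<^sub>v (rk i')" if "i = Suc i'" for i'
  proof -
    note Dt = tensor_diff_carrier[OF graded_mat_carrier[OF D]]
    have "tensor_diff (D i' * D i) *\<^sub>v w = tensor_diff (D i') *\<^sub>v v"
      using assoc_mult_mat_vec[OF Dt[of i'] _ tensor_strand_carrier[OF w(1)], of "tensor_diff (D i)"]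
        Dt[of i] tensor_diff_mult[OF graded_mat_carrier[OF D] graded_mat_carrier[OF D], of i'] that w(2)
      by simp
    then show ?thesis
      using zero_mat_mult_vec[OF tensor_strand_carrier[OF w(1)]] that by (simp add: DD tensor_diff_zero)
  qed
  then show "v \<in> tor_cycles rk dg D i j"
    using tensor_strand_image[OF D w(1)] w(2) by (auto simp: tor_cycles_def)
qed

text \<open>
  Let \<open>G\<close> be the resolution with support \<open>T\<close> and \<open>F\<close> the one in which Tor is nonzero. The
  comparison maps \<open>\<alpha> : F \<rightarrow> G\<close> and \<open>\<beta> : G \<rightarrow> F\<close> satisfy \<open>1 - \<beta> \<alpha> = D h + h D\<close>. If \<open>(i, j) \<notin> T\<close>, then \<open>\<alpha>\<close> kills every
  cycle \<open>v\<close> in position \<open>i\<close> and degree \<open>j\<close> after tensoring, so \<open>v = D h v\<close> is a boundary.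
\<close>

lemma tor_nonzero_imp_support:
  assumes I: "homogeneous_ideal I" and T: "resolution_support I T" and nz: "tor_nonzero I i j"
  shows "(i, j) \<in> T"
proof (rule ccontr)
  assume nT: "(i, j) \<notin> T"
  obtain rk dg e D where F: "graded_free_resolution I rk dg e D"
    and ne: "tor_cycles rk dg D i j \<noteq> tor_boundaries rk dg D i j"
    using nz unfolding tor_nonzero_def by blast
  obtain rk' dg' e' D' where G: "graded_free_resolution I rk' dg' e' D'"
    and T_def: "T = {(i, dg' i q) | i q. q < rk' i}" using T by (auto simp: resolution_support_def)
  have I0: "is_ideal I" using I by (simp add: homogeneous_ideal_def)
  have FC: "graded_complex I rk dg e D" and GC: "graded_complex I rk' dg' e' D'"
    using F G by (auto simp: graded_free_resolution_iff)
  have D: "graded_mat (rk i) (rk (Suc i)) (dg i) (dg (Suc i)) (D i)"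
    and e: "graded_vec (rk 0) (dg 0) e" for i
    using FC by (auto simp: graded_complex_def)
  have D': "graded_mat (rk' i) (rk' (Suc i)) (dg' i) (dg' (Suc i)) (D' i)"
    and e': "graded_vec (rk' 0) (dg' 0) e'" for i
    using GC by (auto simp: graded_complex_def)
  obtain \<alpha> where \<alpha>: "\<And>i. graded_mat (rk' i) (rk i) (dg' i) (dg i) (\<alpha> i)"
    and \<alpha>D: "\<And>i. D' i * \<alpha> (Suc i) = \<alpha> i * D i"
    and \<alpha>aug: "\<And>q. q < rk 0 \<Longrightarrow> 1 * e $ q - e' \<bullet> col (\<alpha> 0) q \<in> I"
    using comparison_map_exists[OF FC G I homogeneous_1] by auto
  obtain \<beta> where \<beta>: "\<And>i. graded_mat (rk i) (rk' i) (dg i) (dg' i) (\<beta> i)"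
    and \<beta>D: "\<And>i. D i * \<beta> (Suc i) = \<beta> i * D' i"
    and \<beta>aug: "\<And>q. q < rk' 0 \<Longrightarrow> 1 * e' $ q - e \<bullet> col (\<beta> 0) q \<in> I"
    using comparison_map_exists[OF GC F I homogeneous_1] by auto
  note Dc = graded_mat_carrier[OF D] and D'c = graded_mat_carrier[OF D']
    and \<alpha>c = graded_mat_carrier[OF \<alpha>] and \<beta>c = graded_mat_carrier[OF \<beta>]
    and ec = graded_vec_carrier[OF e] and e'c = graded_vec_carrier[OF e']
  \<comment> \<open>\<open>1 - \<beta> \<alpha>\<close> lifts the zero map of \<open>S/I\<close>, so it is null-homotopic.\<close>
  define \<gamma> where "\<gamma> = (\<lambda>i. 1\<^sub>m (rk i) - \<beta> i * \<alpha> i)"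
  have \<beta>\<alpha>c: "\<beta> i * \<alpha> i \<in> carrier_mat (rk i) (rk i)" for i
    using mult_carrier_mat[OF \<beta>c \<alpha>c] .
  have \<gamma>: "graded_mat (rk i) (rk i) (dg i) (dg i) (\<gamma> i)" for i
    unfolding \<gamma>_def by (intro graded_mat_minus graded_mat_one graded_mat_mult[OF \<beta> \<alpha>])
  have chain: "D i * \<gamma> (Suc i) = \<gamma> i * D i" for i
  proof -
    have "D i * (\<beta> (Suc i) * \<alpha> (Suc i)) = D i * \<beta> (Suc i) * \<alpha> (Suc i)"
      by (rule assoc_mult_mat[OF Dc \<beta>c \<alpha>c, symmetric])
    also have "\<dots> = \<beta> i * (D' i * \<alpha> (Suc i))"
      unfolding \<beta>D by (rule assoc_mult_mat[OF \<beta>c D'c \<alpha>c])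
    also have "\<dots> = \<beta> i * \<alpha> i * D i"
      unfolding \<alpha>D by (rule assoc_mult_mat[OF \<beta>c \<alpha>c Dc, symmetric])
    finally show ?thesis
      unfolding \<gamma>_def mult_minus_distrib_mat[OF Dc one_carrier_mat \<beta>\<alpha>c]
        minus_mult_distrib_mat[OF one_carrier_mat \<beta>\<alpha>c Dc]
      using Dc[of i] by simp
  qed
  have aug: "e \<bullet> col (\<gamma> 0) q \<in> I" if q: "q < rk 0" for q
  proof -
    have cc: "col (\<alpha> 0) q \<in> carrier_vec (rk' 0)" using col_carrier_vec[OF q \<alpha>c] .
    have "1 * (e' \<bullet> col (\<alpha> 0) q) - e \<bullet> (\<beta> 0 *\<^sub>v col (\<alpha> 0) q) \<in> I"
      by (rule augmentation_comparison[OF I0 ec e'c \<beta>c \<beta>aug cc])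
    from ideal.subspace_add[OF I0 \<alpha>aug[OF q] this]
    have "e $ q - e \<bullet> (\<beta> 0 *\<^sub>v col (\<alpha> 0) q) \<in> I" by simp
    moreover have "col (\<gamma> 0) q = unit_vec (rk 0) q - \<beta> 0 *\<^sub>v col (\<alpha> 0) q"
      unfolding \<gamma>_def using q \<beta>\<alpha>c[of 0] \<alpha>c[of 0] \<beta>c[of 0] col_mult2[OF \<beta>c \<alpha>c q]
      by (intro eq_vecI) auto
    moreover have "\<beta> 0 *\<^sub>v col (\<alpha> 0) q \<in> carrier_vec (rk 0)"
      using mult_mat_vec_carrier[OF \<beta>c cc] .
    ultimately show ?thesis
      using scalar_prod_minus_distrib[OF ec unit_vec_carrier] ec q by (simp add: scalar_prod_right_unit)
  qed
  obtain h where h: "\<And>i. graded_mat (rk (Suc i)) (rk i) (dg (Suc i)) (dg i) (h i)"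
    and hS: "\<And>i. \<gamma> (Suc i) = D (Suc i) * h (Suc i) + h i * D i" and h0: "\<gamma> 0 = D 0 * h 0"
    using null_homotopy_exists[OF F I \<gamma> chain aug] by auto
  note hc = graded_mat_carrier[OF h]
  note tc = tensor_diff_carrier
  have "tor_cycles rk dg D i j \<subseteq> tor_boundaries rk dg D i j"
  proof
    fix v assume v: "v \<in> tor_cycles rk dg D i j"
    then have vs: "v \<in> tensor_strand (rk i) (dg i) j" by (simp add: tor_cycles_def)
    note vc = tensor_strand_carrier[OF vs]
    have "tensor_diff (\<alpha> i) *\<^sub>v v = 0\<^sub>v (rk' i)"
      using tensor_strand_trivial[OF tensor_strand_image[OF \<alpha> vs]] nT by (auto simp: T_def)
    then have "tensor_diff (\<beta> i * \<alpha> i) *\<^sub>v v = 0\<^sub>v (rk i)"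
      using assoc_mult_mat_vec[OF tc[OF \<beta>c] tc[OF \<alpha>c] vc] tensor_diff_mult[OF \<beta>c \<alpha>c, of i]
        mult_mat_zero_vec[OF tc[OF \<beta>c, of i]] by simp
    moreover have "1\<^sub>m (rk i) = \<gamma> i + \<beta> i * \<alpha> i"
      unfolding \<gamma>_def by (rule mat_diff_add[OF one_carrier_mat \<beta>\<alpha>c, symmetric])
    then have "1\<^sub>m (rk i) = tensor_diff (\<gamma> i) + tensor_diff (\<beta> i * \<alpha> i)"
      using tensor_diff_add[OF graded_mat_carrier[OF \<gamma>] \<beta>\<alpha>c, of i] by (metis tensor_diff_one)
    then have "v = tensor_diff (\<gamma> i) *\<^sub>v v + tensor_diff (\<beta> i * \<alpha> i) *\<^sub>v v"
      using add_mult_distrib_mat_vec[OF tc[OF graded_mat_carrier[OF \<gamma>]] tc[OF \<beta>\<alpha>c] vc]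
      by (metis one_mult_mat_vec vc)
    moreover have "tensor_diff (\<gamma> i) *\<^sub>v v \<in> carrier_vec (rk i)"
      using mult_mat_vec_carrier[OF tc[OF graded_mat_carrier[OF \<gamma>]] vc] .
    ultimately have v\<gamma>: "v = tensor_diff (\<gamma> i) *\<^sub>v v" by simp
    have Dh: "tensor_diff (D i * h i) *\<^sub>v v = tensor_diff (D i) *\<^sub>v (tensor_diff (h i) *\<^sub>v v)"
      unfolding tensor_diff_mult[OF Dc hc] by (rule assoc_mult_mat_vec[OF tc[OF Dc] tc[OF hc] vc])
    have "tensor_diff (\<gamma> i) *\<^sub>v v = tensor_diff (D i) *\<^sub>v (tensor_diff (h i) *\<^sub>v v)"
    proof (cases i)
      case 0
      then show ?thesis using Dh h0 by simp
    next
      case (Suc i')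
      have "tensor_diff (h i' * D i') *\<^sub>v v = tensor_diff (h i') *\<^sub>v (tensor_diff (D i') *\<^sub>v v)"
        unfolding tensor_diff_mult[OF hc Dc] using vc Suc
        by (intro assoc_mult_mat_vec[OF tc[OF hc] tc[OF Dc]]) simp
      also have "tensor_diff (D i') *\<^sub>v v = 0\<^sub>v (rk i')" using v Suc by (simp add: tor_cycles_def)
      finally have "tensor_diff (h i' * D i') *\<^sub>v v = 0\<^sub>v (rk i)"
        using mult_mat_zero_vec[OF tc[OF hc, of i']] Suc by simp
      moreover have "tensor_diff (\<gamma> i) *\<^sub>v v = tensor_diff (D i * h i) *\<^sub>v v + tensor_diff (h i' * D i') *\<^sub>v v"
        unfolding Suc hS tensor_diff_add[OF mult_carrier_mat[OF Dc hc] mult_carrier_mat[OF hc Dc]]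
        using vc Suc
        by (intro add_mult_distrib_mat_vec[OF tc[OF mult_carrier_mat[OF Dc hc]]
              tc[OF mult_carrier_mat[OF hc Dc]]]) simp
      ultimately show ?thesis
        using Dh mult_mat_vec_carrier[OF tc[OF mult_carrier_mat[OF Dc hc]] vc] by simp
    qed
    moreover have "tensor_diff (h i) *\<^sub>v v \<in> tensor_strand (rk (Suc i)) (dg (Suc i)) j"
      by (rule tensor_strand_image[OF h vs])
    ultimately show "v \<in> tor_boundaries rk dg D i j"
      using v\<gamma> unfolding tor_boundaries_def by auto
  qed
  then show False using tor_boundaries_subset_cycles[OF FC] ne by blast
qed

text \<open>
  If a degree occurs in position \<open>i\<close> but in neither neighbouring position, the differentials
  into and out of this part vanish after tensoring, also in a resolution that is not minimal.
\<close>

lemma tor_nonzero_isolated: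
  assumes T: "resolution_support I T" and ij: "(i, j) \<in> T" and up: "(Suc i, j) \<notin> T"
    and down: "\<And>i'. i = Suc i' \<Longrightarrow> (i', j) \<notin> T"
  shows "tor_nonzero I i j"
proof -
  obtain rk dg e D where F: "graded_free_resolution I rk dg e D"
    and T_def: "T = {(i, dg i q) | i q. q < rk i}" using T by (auto simp: resolution_support_def)
  have D: "graded_mat (rk i) (rk (Suc i)) (dg i) (dg (Suc i)) (D i)" for i
    using F by (auto simp: graded_free_resolution_iff graded_complex_def)
  obtain q where q: "q < rk i" "dg i q = j" using ij by (auto simp: T_def)
  define v where "v = (unit_vec (rk i) q :: 'b vec)"
  have vs: "v \<in> tensor_strand (rk i) (dg i) j"
    using q by (auto simp: v_def tensor_strand_def)
  have "tensor_diff (D i') *\<^sub>v v = 0\<^sub>v (rk i')" if "i = Suc i'" for i'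
    using tensor_strand_trivial[OF tensor_strand_image[OF D[of i']], of v j] vs down[OF that] that
    by (auto simp: T_def)
  then have "v \<in> tor_cycles rk dg D i j" using vs by (simp add: tor_cycles_def)
  moreover have "v \<notin> tor_boundaries rk dg D i j"
  proof
    assume "v \<in> tor_boundaries rk dg D i j"
    then obtain w where w: "w \<in> tensor_strand (rk (Suc i)) (dg (Suc i)) j" "v = tensor_diff (D i) *\<^sub>v w"
      by (auto simp: tor_boundaries_def)
    have "w = 0\<^sub>v (rk (Suc i))" using tensor_strand_trivial[OF w(1)] up by (auto simp: T_def)
    then have "v = 0\<^sub>v (rk i)"
      using w(2) mult_mat_zero_vec[OF tensor_diff_carrier[OF graded_mat_carrier[OF D], of i]] by simp
    then show False using q(1) by (simp add: v_def)
  qed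
  ultimately show ?thesis using F unfolding tor_nonzero_def by blast
qed

section \<open>Powers of ideals generated by regular sequences\<close>

text \<open>
  By induction on the sequence and on \<open>t\<close>. Both operations respect the bounds: the cone keeps
  each pair \<open>(i, j)\<close> of \<open>Q^(t+1)\<close> and adds \<open>(i + 1, j + c)\<close>, and the horseshoe adds \<open>(i, j + c)\<close> for
  each pair \<open>(i, j)\<close> of \<open>I^t\<close>. The extremal pair of \<open>I^(t+1)\<close> comes from the cone if \<open>t = 0\<close> and from \<open>I^t\<close> otherwise.
  The zero ideal has all its positive powers equal to zero, with the single pair \<open>(0, 0)\<close>, which is
  extremal only for \<open>t = 1\<close>.
\<close>

lemma resolution_support_ipow:
  fixes fs :: "('v, 'k::field) mpoly list"
  assumes "regular_sequence fs" and "\<forall>f\<in>set fs. homogeneous f c" and c: "c \<ge> 0"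
  shows "\<exists>T. resolution_support (ipow (ideal_gen (set fs)) t) T \<and> finite T \<and>
    (\<forall>(i, j)\<in>T. i \<le> length fs \<and> j \<le> c * (int t + int i - 1)) \<and>
    (t \<ge> 1 \<and> (fs \<noteq> [] \<or> t = 1) \<longrightarrow> (length fs, c * (int t + int (length fs) - 1)) \<in> T)"
  using assms(1,2)
proof (induction fs arbitrary: t)
  case Nil
  show ?case
  proof (cases t)
    case 0
    then show ?thesis using resolution_support_UNIV by (intro exI[of _ "{}"]) auto
  next
    case (Suc t')
    have "resolution_support (ipow (ideal_gen {}) (Suc t')) ({(0, 0)} :: (nat \<times> int) set)"
      unfolding ipow_zero_ideal by (rule resolution_support_zero)
    then show ?thesis unfolding Suc using c
      by (intro exI[of _ "{(0, 0)}"]) (simp del: ipow.simps)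
  qed
next
  case (Cons f fs)
  define I where "I = ideal_gen (set (f # fs))"
  define Q where "Q = ideal_gen (set fs)"
  have f: "homogeneous f c" and fs: "regular_sequence fs" "\<forall>f\<in>set fs. homogeneous f c"
    using Cons.prems by auto
  have hQ: "homogeneous_ideal (ipow Q t)" for t
    unfolding Q_def using fs(2) by (intro homogeneous_ideal_ipow) auto
  have hI: "homogeneous_ideal (ipow I t)" for t
    unfolding I_def using Cons.prems(2) by (intro homogeneous_ideal_ipow) auto
  show ?case unfolding I_def[symmetric]
  proof (induction t)
    case 0
    then show ?case using resolution_support_UNIV by (intro exI[of _ "{}"]) auto
  next
    case (Suc t)
    obtain T where T: "resolution_support (ipow I t) T" "finite T"
      "\<And>i j. (i, j) \<in> T \<Longrightarrow> i \<le> Suc (length fs) \<and> j \<le> c * (int t + int i - 1)"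
      "t \<ge> 1 \<Longrightarrow> (Suc (length fs), c * (int t + int (length fs))) \<in> T"
    proof -
      obtain T where "resolution_support (ipow I t) T" "finite T"
        "\<forall>(i, j)\<in>T. i \<le> Suc (length fs) \<and> j \<le> c * (int t + int i - 1)"
        "t \<ge> 1 \<longrightarrow> (Suc (length fs), c * (int t + int (length fs))) \<in> T"
        using Suc by auto
      then show thesis by (intro that[of T]) auto
    qed
    obtain T' where T': "resolution_support (ipow Q (Suc t)) T'" "finite T'"
      "\<And>i j. (i, j) \<in> T' \<Longrightarrow> i \<le> length fs \<and> j \<le> c * (int t + int i)"
      "t = 0 \<Longrightarrow> (length fs, c * int (length fs)) \<in> T'"
    proof -
      obtain T where T: "resolution_support (ipow Q (Suc t)) T" "finite T"
        "\<forall>(i, j)\<in>T. i \<le> length fs \<and> j \<le> c * (int (Suc t) + int i - 1)"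
        "Suc t \<ge> 1 \<and> (fs \<noteq> [] \<or> Suc t = 1) \<longrightarrow>
          (length fs, c * (int (Suc t) + int (length fs) - 1)) \<in> T"
        using Cons.IH[OF fs, of "Suc t"] unfolding Q_def by (elim exE conjE)
      have "t = 0 \<Longrightarrow> (length fs, c * int (length fs)) \<in> T" using T(4) by simp
      then show thesis using T by (intro that[of T]) auto
    qed
    define U where "U = T' \<union> (\<lambda>(i, j). (Suc i, j + c)) ` T'"
    have "{a. f * a \<in> ipow Q (Suc t)} = ipow Q (Suc t)"
      using nonzerodivisor_mod_ipow[OF fs(1), of f "Suc t"] Cons.prems(1)
        ideal.subspace_scale[OF is_ideal_ipow]
      by (auto simp: nonzerodivisor_mod_def Q_def simp del: ipow.simps)
    then have "resolution_support (add_principal (ipow Q (Suc t)) f) U"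
      unfolding U_def using mapping_cone_resolution[OF hQ f, of "Suc t" T' T'] T'(1) by simp
    then have U: "resolution_support (add_principal (ipow I (Suc t)) f) U"
      using add_principal_ipow[of f fs t] by (simp add: I_def Q_def del: ipow.simps)
    have "{a. f * a \<in> ipow I (Suc t)} = ipow I t"
      using ipow_colon[OF Cons.prems(1)] by (auto simp: I_def simp del: ipow.simps)
    then have res: "resolution_support (ipow I (Suc t)) ((\<lambda>(i, j). (i, j + c)) ` T \<union> U)"
      using horseshoe_resolution[OF hI f, of "Suc t" T U] T(1) U by simp
    have bound: "i \<le> Suc (length fs) \<and> j \<le> c * (int t + int i)"
      if ij: "(i, j) \<in> (\<lambda>(i, j). (i, j + c)) ` T \<union> U" for i j
    proof -
      consider j' where "(i, j') \<in> T" "j = j' + c" | "(i, j) \<in> T'"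
        | i' j' where "(i', j') \<in> T'" "i = Suc i'" "j = j' + c"
        using ij by (auto simp: U_def)
      then show ?thesis
      proof cases
        case 1
        then show ?thesis using T(3)[OF 1(1)] by (simp add: algebra_simps)
      next
        case 2
        then show ?thesis using T'(3)[OF 2] by simp
      next
        case 3
        then show ?thesis using T'(3)[OF 3(1)] by (simp add: algebra_simps)
      qed
    qed
    have top: "(Suc (length fs), c * (int t + int (Suc (length fs)))) \<in> (\<lambda>(i, j). (i, j + c)) ` T \<union> U"
    proof (cases "t = 0")
      case True
      then have "(length fs, c * int (length fs)) \<in> T'" using T'(4) by simp
      then have "(Suc (length fs), c * int (length fs) + c) \<in> U" unfolding U_def by force
      then show ?thesis using True by (simp add: algebra_simps)
    next
      case False
      then have "(Suc (length fs), c * (int t + int (length fs))) \<in> T" using T(4) by simp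
      then have "(Suc (length fs), c * (int t + int (length fs)) + c) \<in> (\<lambda>(i, j). (i, j + c)) ` T"
        by force
      then show ?thesis by (simp add: algebra_simps)
    qed
    define V where "V = (\<lambda>(i, j). (i, j + c)) ` T \<union> U"
    have "finite V" using T(2) T'(2) by (simp add: V_def U_def)
    moreover have "\<forall>(i, j)\<in>V. i \<le> length (f # fs) \<and> j \<le> c * (int (Suc t) + int i - 1)"
      using bound unfolding V_def[symmetric] by auto
    moreover have "(length (f # fs), c * (int (Suc t) + int (length (f # fs)) - 1)) \<in> V"
      using top unfolding V_def[symmetric] by (simp add: algebra_simps)
    ultimately show ?case using res unfolding V_def[symmetric] by blast
  qed
qed

text \<open>
  As \<open>c \<ge> 1\<close>, the bound \<open>c (s + i - 1) - i\<close> on \<open>j - i\<close> is largest for \<open>i = r\<close>, where it is attained.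
\<close>

theorem reg_quotient_power_regular_sequence:
  fixes fs :: "('v, 'k::field) mpoly list"
  assumes reg: "regular_sequence fs" and hom: "\<forall>f\<in>set fs. homogeneous f c" and c: "c \<ge> 1"
    and s: "s \<ge> 1" and fs: "fs \<noteq> [] \<or> s = 1"
  shows "reg_quotient (ideal_power (ideal_gen (set fs)) s) =
    c * (int s + int (length fs) - 1) - int (length fs)"
proof -
  define I where "I = ipow (ideal_gen (set fs)) s"
  define r where "r = length fs"
  have "homogeneous_ideal I" unfolding I_def using hom by (intro homogeneous_ideal_ipow) auto
  obtain T where T: "resolution_support I T" "finite T"
    and bound: "\<And>i j. (i, j) \<in> T \<Longrightarrow> i \<le> r \<and> j \<le> c * (int s + int i - 1)"
    and top: "(r, c * (int s + int r - 1)) \<in> T"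
    using resolution_support_ipow[OF reg hom, of s] c s fs unfolding I_def r_def by auto
  define m where "m = c * (int s + int r - 1)"
  have "tor_nonzero I r m"
  proof (rule tor_nonzero_isolated[OF T(1)])
    show "(r, m) \<in> T" using top by (simp add: m_def)
    show "(Suc r, m) \<notin> T" using bound[of "Suc r" m] by auto
    fix i' assume "r = Suc i'"
    then have "m = c * (int s + int i' - 1) + c" by (simp add: m_def algebra_simps)
    then show "(i', m) \<notin> T" using bound[of i' m] c by auto
  qed
  have sub: "{j - int i | i j. tor_nonzero I i j} \<subseteq> (\<lambda>(i, j). j - int i) ` T"
    using tor_nonzero_imp_support[OF \<open>homogeneous_ideal I\<close> T(1)] by force
  have le: "x \<le> m - int r" if x: "x \<in> {j - int i | i j. tor_nonzero I i j}" for x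
  proof -
    obtain i j where ij: "x = j - int i" "(i, j) \<in> T"
      using subsetD[OF sub x] by auto
    \<comment> \<open>The bound increases by \<open>c - 1\<close> when \<open>i\<close> increases by one.\<close>
    have "0 \<le> (c - 1) * (int r - int i)" using bound[OF ij(2)] c by simp
    then have "c * (int s + int i - 1) - int i \<le> m - int r" by (simp add: m_def algebra_simps)
    then show ?thesis using bound[OF ij(2)] ij(1) by linarith
  qed
  have "Max {j - int i | i j. tor_nonzero I i j} = m - int r"
    using finite_subset[OF sub] T(2) \<open>tor_nonzero I r m\<close> le by (intro Max_eqI) auto
  then show ?thesis
    using ideal_power_eq_ipow[OF is_ideal_ideal_gen, of "set fs" s]
    by (simp add: reg_quotient_def I_def m_def r_def)
qed

section \<open>Coprime leading monomials\<close>

text \<open>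
  A monomial order is encoded by an injective key into a wellorder, so that it is total and
  well-founded by its type.
\<close>

locale monomial_order =
  fixes \<rho> :: "('v \<Rightarrow>\<^sub>0 nat) \<Rightarrow> 'o::wellorder"
  assumes inj: "\<rho> a = \<rho> b \<Longrightarrow> a = b"
    and add_strict: "\<rho> a < \<rho> b \<Longrightarrow> \<rho> (a + c) < \<rho> (b + c)"
begin

definition leading :: "('v, 'k::field) mpoly \<Rightarrow> ('v \<Rightarrow>\<^sub>0 nat) \<Rightarrow> bool" where
  "leading p m \<longleftrightarrow> Poly_Mapping.lookup p m \<noteq> 0 \<and>
    (\<forall>m'. Poly_Mapping.lookup p m' \<noteq> 0 \<longrightarrow> \<rho> m' \<le> \<rho> m)"

lemma leading_exists:
  assumes "p \<noteq> 0"
  shows "\<exists>m. leading p m"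
proof -
  define K where "K = Poly_Mapping.keys p"
  have K: "finite K" "K \<noteq> {}" using assms by (auto simp: K_def)
  then have "Max (\<rho> ` K) \<in> \<rho> ` K" by simp
  then obtain m where m: "m \<in> K" "\<rho> m = Max (\<rho> ` K)" by auto
  then have "\<rho> m' \<le> \<rho> m" if "m' \<in> K" for m' using K that by simp
  then show ?thesis using m by (auto simp: leading_def K_def in_keys_iff)
qed

lemma leading_unique: "leading p a \<Longrightarrow> leading p b \<Longrightarrow> a = b"
  by (meson antisym inj leading_def)

lemma add_le: "\<rho> a \<le> \<rho> b \<Longrightarrow> \<rho> (a + c) \<le> \<rho> (b + c)"
  using add_strict inj by (metis le_less)

text \<open>
  The product of the leading terms cannot cancel, because every other product of terms has a
  smaller key.
\<close>

lemma leading_mult: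
  assumes p: "leading p a" and q: "leading q b"
  shows "leading (p * q) (a + b)"
    and "Poly_Mapping.lookup (p * q) (a + b) = Poly_Mapping.lookup p a * Poly_Mapping.lookup q b"
proof -
  have le: "\<rho> (x + y) \<le> \<rho> (a + b) \<and> (x + y = a + b \<longrightarrow> x = a \<and> y = b)"
    if "Poly_Mapping.lookup p x \<noteq> 0" "Poly_Mapping.lookup q y \<noteq> 0" for x y
  proof -
    have x: "\<rho> x \<le> \<rho> a" and y: "\<rho> y \<le> \<rho> b" using that p q by (auto simp: leading_def)
    have 1: "\<rho> (x + y) \<le> \<rho> (a + y)" using add_le[OF x] .
    have 2: "\<rho> (a + y) \<le> \<rho> (a + b)" using add_le[OF y, of a] by (simp add: add.commute)
    have "x = a \<and> y = b" if eq: "x + y = a + b"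
    proof -
      have "\<rho> (x + y) = \<rho> (a + y)" using 1 2 eq by simp
      then have "x = a" using inj by force
      then show ?thesis using eq by simp
    qed
    then show ?thesis using 1 2 by auto
  qed
  have "Poly_Mapping.lookup (p * q) (a + b) =
      (\<Sum>x. Poly_Mapping.lookup p x * (\<Sum>y. Poly_Mapping.lookup q y when a + b = x + y))"
    by (rule lookup_mult)
  also have "\<dots> = (\<Sum>x. Poly_Mapping.lookup p a * Poly_Mapping.lookup q b when x = a)"
  proof (rule Sum_any.cong)
    fix x
    show "Poly_Mapping.lookup p x * (\<Sum>y. Poly_Mapping.lookup q y when a + b = x + y) =
        (Poly_Mapping.lookup p a * Poly_Mapping.lookup q b when x = a)"
    proof (cases "x = a")
      case True
      then show ?thesis by simp
    next
      case False
      have "(Poly_Mapping.lookup q y when a + b = x + y) = 0" if "Poly_Mapping.lookup p x \<noteq> 0" for y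
        using le[OF that, of y] False by (cases "Poly_Mapping.lookup q y = 0") (auto simp: when_def)
      then show ?thesis using False by (cases "Poly_Mapping.lookup p x = 0") auto
    qed
  qed
  finally show coeff: "Poly_Mapping.lookup (p * q) (a + b) =
      Poly_Mapping.lookup p a * Poly_Mapping.lookup q b" by simp
  have "\<rho> m' \<le> \<rho> (a + b)" if "Poly_Mapping.lookup (p * q) m' \<noteq> 0" for m'
  proof -
    from that have "m' \<in> Poly_Mapping.keys (p * q)" by (simp add: in_keys_iff)
    then obtain x y where "m' = x + y" "x \<in> Poly_Mapping.keys p" "y \<in> Poly_Mapping.keys q"
      using keys_mult by fastforce
    then show ?thesis using le by (simp add: in_keys_iff)
  qed
  then show "leading (p * q) (a + b)" using p q coeff by (simp add: leading_def)
qed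

lemma leading_add:
  assumes "leading p a" and "leading q b" and "\<rho> a < \<rho> b"
  shows "leading (p + q) b"
proof -
  have "Poly_Mapping.lookup p b = 0" using assms by (auto simp: leading_def not_less[symmetric])
  moreover have "\<rho> m \<le> \<rho> b" if "Poly_Mapping.lookup p m \<noteq> 0 \<or> Poly_Mapping.lookup q m \<noteq> 0" for m
    using that assms by (auto simp: leading_def intro: order_trans less_imp_le)
  moreover have "Poly_Mapping.lookup p m \<noteq> 0 \<or> Poly_Mapping.lookup q m \<noteq> 0"
    if "Poly_Mapping.lookup (p + q) m \<noteq> 0" for m
    using that by (auto simp: lookup_add)
  ultimately show ?thesis using assms(2) unfolding leading_def by (metis add_0 lookup_add)
qed

lemma leading_single: "c \<noteq> 0 \<Longrightarrow> leading (Poly_Mapping.single x c) x"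
  by (auto simp: leading_def lookup_single when_def)

definition mon_dvd :: "('v \<Rightarrow>\<^sub>0 nat) \<Rightarrow> ('v \<Rightarrow>\<^sub>0 nat) \<Rightarrow> bool" where
  "mon_dvd m x \<longleftrightarrow> (\<forall>v. Poly_Mapping.lookup m v \<le> Poly_Mapping.lookup x v)"

lemma mon_dvd_coprime:
  assumes "Poly_Mapping.keys m \<inter> Poly_Mapping.keys m' = {}" and "mon_dvd m (x + m')"
  shows "mon_dvd m x"
  unfolding mon_dvd_def
proof
  fix v
  have "Poly_Mapping.lookup m v = 0 \<or> Poly_Mapping.lookup m' v = 0"
    using assms(1) by (auto simp: in_keys_iff)
  then show "Poly_Mapping.lookup m v \<le> Poly_Mapping.lookup x v"
    using assms(2)[unfolded mon_dvd_def, rule_format, of v] by (auto simp: lookup_add)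
qed

text \<open>
  One step of the division algorithm.
\<close>

lemma leading_reduce:
  assumes a: "leading a x" and f: "leading f m" and "mon_dvd m x"
  shows "\<exists>k. a - k * f = 0 \<or> (\<exists>x'. leading (a - k * f) x' \<and> \<rho> x' < \<rho> x)"
proof -
  have x: "x = (x - m) + m"
    using assms(3) by (intro poly_mapping_eqI) (simp add: mon_dvd_def lookup_add lookup_minus)
  define k where "k = Poly_Mapping.single (x - m) (Poly_Mapping.lookup a x / Poly_Mapping.lookup f m)"
  have la: "Poly_Mapping.lookup a x \<noteq> 0" and lf: "Poly_Mapping.lookup f m \<noteq> 0"
    using a f by (auto simp: leading_def)
  have kf: "leading (k * f) x"
    using leading_mult(1)[OF leading_single f, of _ "x - m"] la lf x[symmetric] unfolding k_def by simp
  have "Poly_Mapping.lookup (k * f) x = Poly_Mapping.lookup a x"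
    using leading_mult(2)[OF leading_single f, of "Poly_Mapping.lookup a x / Poly_Mapping.lookup f m" "x - m"]
      la lf x[symmetric] unfolding k_def by simp
  then have zero: "Poly_Mapping.lookup (a - k * f) x = 0" by (simp add: lookup_minus)
  show ?thesis
  proof (cases "a - k * f = 0")
    case False
    then obtain x' where x': "leading (a - k * f) x'" using leading_exists by blast
    then have "Poly_Mapping.lookup a x' \<noteq> 0 \<or> Poly_Mapping.lookup (k * f) x' \<noteq> 0"
      by (auto simp: leading_def lookup_minus)
    then have "\<rho> x' \<le> \<rho> x" using a kf by (auto simp: leading_def)
    moreover have "x' \<noteq> x" using x' zero by (auto simp: leading_def)
    ultimately show ?thesis using x' inj by (metis le_less)
  qed blast
qed

text \<open>
  The second claim, that the given monomials generate the initial ideal, is what makes the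
  induction work. Let \<open>f\<close> have leading monomial \<open>m\<close>, coprime to the earlier ones. If \<open>f a \<in> I\<close>, then an earlier
  monomial divides \<open>m\<close> times the leading monomial of \<open>a\<close>, hence divides the latter, and a division
  step modulo \<open>I\<close> lowers it. So \<open>a \<in> I\<close> by induction. For an element \<open>q + k f\<close> of \<open>I + (f)\<close>,
  division lets one assume that no earlier monomial divides the leading monomial of \<open>k\<close>; then the leading
  terms of \<open>q\<close> and \<open>k f\<close> lie at different monomials and cannot cancel.
\<close>

theorem regular_sequence_coprime_leading:
  assumes "\<forall>(f, m)\<in>set ps. leading f m"
    and "sorted_wrt (\<lambda>(f, m) (f', m'). Poly_Mapping.keys m \<inter> Poly_Mapping.keys m' = {}) ps"
  shows "regular_sequence (map fst ps) \<and>
    (\<forall>p\<in>ideal_gen (fst ` set ps). \<forall>x. leading p x \<longrightarrow> (\<exists>m\<in>snd ` set ps. mon_dvd m x))"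
  using assms
proof (induction ps)
  case Nil
  then show ?case by (auto simp: ideal_gen_empty leading_def)
next
  case (Cons fm ps)
  obtain f m where fm: "fm = (f, m)" by (cases fm)
  define I where "I = ideal_gen (fst ` set ps)"
  have I0: "is_ideal I" by (simp add: I_def)
  have f: "leading f m" using Cons.prems fm by simp
  have IH: "regular_sequence (map fst ps)"
    and lead: "\<And>p x. p \<in> I \<Longrightarrow> leading p x \<Longrightarrow> \<exists>m\<in>snd ` set ps. mon_dvd m x"
    using Cons unfolding I_def by auto
  have coprime: "mon_dvd m' x" if "m' \<in> snd ` set ps" "mon_dvd m' (x + m)" for m' x
  proof -
    have "Poly_Mapping.keys m' \<inter> Poly_Mapping.keys m = {}"
      using that(1) Cons.prems(2) fm by fastforce
    then show ?thesis using mon_dvd_coprime that(2) by blast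
  qed
  have reduce: "\<exists>a'. a - a' \<in> I \<and> (a' = 0 \<or> (\<exists>x'. leading a' x' \<and> \<rho> x' < \<rho> x))"
    if a: "leading a x" and m': "m' \<in> snd ` set ps" and dvd: "mon_dvd m' x" for a x m'
  proof -
    obtain g where g: "(g, m') \<in> set ps" using m' by auto
    then have "leading g m'" using Cons.prems(1) by auto
    then obtain k where k: "a - k * g = 0 \<or> (\<exists>x'. leading (a - k * g) x' \<and> \<rho> x' < \<rho> x)"
      using leading_reduce[OF a _ dvd] by blast
    have "g \<in> I" unfolding I_def using g by (intro ideal_gen_base) force
    then have "k * g \<in> I" by (rule ideal.subspace_scale[OF I0])
    then show ?thesis using k by (intro exI[of _ "a - k * g"]) simp
  qed
  have nzd: "a \<in> I" if "f * a \<in> I" for a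
  proof -
    have "leading a x \<Longrightarrow> f * a \<in> I \<Longrightarrow> a \<in> I" for x a
    proof (induction "\<rho> x" arbitrary: x a rule: less_induct)
      case less
      have "leading (f * a) (x + m)"
        using leading_mult(1)[OF f less.prems(1)] by (simp add: add.commute)
      then obtain m' where m': "m' \<in> snd ` set ps" "mon_dvd m' x"
        using lead less.prems(2) coprime by blast
      obtain a' where a': "a - a' \<in> I" "a' = 0 \<or> (\<exists>x'. leading a' x' \<and> \<rho> x' < \<rho> x)"
        using reduce[OF less.prems(1) m'] by blast
      have "f * a' = f * a - f * (a - a')" by (simp add: algebra_simps)
      then have "f * a' \<in> I"
        using ideal.subspace_diff[OF I0 less.prems(2) ideal.subspace_scale[OF I0 a'(1)]] by simp
      then have "a' \<in> I" using a'(2) less.hyps ideal.subspace_0[OF I0] by blast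
      then show ?case using ideal.subspace_add[OF I0 a'(1)] by force
    qed
    then show ?thesis using leading_exists[of a] that ideal.subspace_0[OF I0] by (cases "a = 0") auto
  qed
  have "\<exists>m\<in>snd ` set (fm # ps). mon_dvd m z"
    if pz: "p \<in> ideal_gen (fst ` set (fm # ps))" "leading p z" for p z
  proof -
    have base: "\<exists>m\<in>snd ` set (fm # ps). mon_dvd m z" if "p \<in> I" using lead[OF that pz(2)] by auto
    have *: "leading k x \<Longrightarrow> p - k * f \<in> I \<Longrightarrow> \<exists>m\<in>snd ` set (fm # ps). mon_dvd m z" for k x
    proof (induction "\<rho> x" arbitrary: x k rule: less_induct)
      case less
      have kf: "leading (k * f) (x + m)" using leading_mult(1)[OF less.prems(1) f] .
      have dvd: "mon_dvd m (x + m)" by (simp add: mon_dvd_def lookup_add)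
      show ?case
      proof (cases "\<exists>m'\<in>snd ` set ps. mon_dvd m' x")
        case True
        then obtain k' where k': "k - k' \<in> I" "k' = 0 \<or> (\<exists>x'. leading k' x' \<and> \<rho> x' < \<rho> x)"
          using reduce[OF less.prems(1)] by blast
        have "p - k' * f = (p - k * f) + f * (k - k')" by (simp add: algebra_simps)
        then have "p - k' * f \<in> I"
          using ideal.subspace_add[OF I0 less.prems(2) ideal.subspace_scale[OF I0 k'(1)]] by metis
        then show ?thesis using k'(2) less.hyps base by auto
      next
        case False
        show ?thesis
        proof (cases "p - k * f = 0")
          case True
          then have "z = x + m" using kf pz(2) leading_unique by simp
          then show ?thesis using dvd fm by auto
        next
          case nz: False
          then obtain y where y: "leading (p - k * f) y" using leading_exists by blast
          obtain m' where m': "m' \<in> snd ` set ps" "mon_dvd m' y" using lead less.prems(2) y by blast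
          have "y \<noteq> x + m" using m' coprime False by blast
          then consider "\<rho> y < \<rho> (x + m)" | "\<rho> (x + m) < \<rho> y"
            using inj by (meson linorder_neqE)
          then show ?thesis
          proof cases
            case 1
            then have "z = x + m" using leading_add[OF y kf] pz(2) leading_unique by simp
            then show ?thesis using dvd fm by auto
          next
            case 2
            then have "z = y" using leading_add[OF kf y] pz(2) leading_unique by simp
            then show ?thesis using m' by auto
          qed
        qed
      qed
    qed
    obtain k where "p - k * f \<in> I" using pz(1) ideal_gen_insert[of p f] fm by (auto simp: I_def)
    then show ?thesis using * leading_exists[of k] base by (cases "k = 0") auto
  qed
  moreover have "nonzerodivisor_mod f I" using nzd by (simp add: nonzerodivisor_mod_def)
  ultimately show ?case using IH fm by (auto simp: I_def)
qed

end

text \<open>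
  Compare by weight first. Ties are broken by \<open>\<Prod> p(v)^(m v)\<close> for distinct primes \<open>p(v)\<close>, which is
  multiplicative in the monomial \<open>m\<close> and injective by unique factorization.
\<close>

lemma weighted_monomial_order_exists:
  fixes W :: "'v::finite \<Rightarrow> nat"
  shows "\<exists>\<rho> :: ('v \<Rightarrow>\<^sub>0 nat) \<Rightarrow> nat \<times> nat. monomial_order \<rho> \<and>
    (\<forall>m. fst (\<rho> m) = (\<Sum>v\<in>UNIV. W v * Poly_Mapping.lookup m v))"
proof -
  obtain g :: "nat \<Rightarrow> nat" where g: "inj g" "range g \<subseteq> {p. prime p}"
    using infinite_countable_subset[OF primes_infinite] by blast
  obtain h :: "'v \<Rightarrow> nat" where h: "inj h"
    using finite_imp_inj_to_nat_seg[of "UNIV :: 'v set"] by auto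
  define p where "p = g \<circ> h"
  have p: "inj p" "\<And>v. prime (p v)" using g h by (auto simp: p_def intro: inj_compose)
  define N where "N = (\<lambda>m. \<Prod>v\<in>UNIV. p v ^ Poly_Mapping.lookup m v)"
  define V where "V = (\<lambda>m. \<Sum>v\<in>UNIV. W v * Poly_Mapping.lookup m v)"
  define \<rho> where "\<rho> = (\<lambda>m. (V m, N m))"
  have N_add: "N (a + b) = N a * N b" for a b
    by (simp add: N_def lookup_add power_add prod.distrib)
  have V_add: "V (a + b) = V a + V b" for a b
    by (simp add: V_def lookup_add distrib_left sum.distrib)
  have N_pos: "N a > 0" for a
    unfolding N_def using p(2) by (intro prod_pos) (auto simp: prime_gt_0_nat)
  have mult: "multiplicity (p v) (N m) = Poly_Mapping.lookup m v" for m v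
  proof -
    have "N m = (\<Prod>q\<in>range p. q ^ Poly_Mapping.lookup m (inv_into UNIV p q))"
      unfolding N_def using p(1) by (simp add: prod.reindex)
    then show ?thesis
      using multiplicity_prod_prime_powers[of "range p" "p v"
          "\<lambda>q. Poly_Mapping.lookup m (inv_into UNIV p q)"] p
      by auto
  qed
  have "monomial_order \<rho>"
  proof
    fix a b assume "\<rho> a = \<rho> b"
    then have "Poly_Mapping.lookup a v = Poly_Mapping.lookup b v" for v
      using mult[of v a] mult[of v b] by (simp add: \<rho>_def)
    then show "a = b" by (rule poly_mapping_eqI)
  next
    fix a b c assume "\<rho> a < \<rho> b"
    then show "\<rho> (a + c) < \<rho> (b + c)"
      using N_pos[of c] by (auto simp: \<rho>_def V_add N_add)
  qed
  moreover have "fst (\<rho> m) = (\<Sum>v\<in>UNIV. W v * Poly_Mapping.lookup m v)" for m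
    by (simp add: \<rho>_def V_def)
  ultimately show ?thesis by blast
qed

section \<open>Weighted edge colourings\<close>

text \<open>
  The weight of the term of colour \<open>l\<close> in the quadric of the edge \<open>e\<close> is \<open>\<Sum>x\<in>e. w (x, l)\<close>, so the
  second condition selects the term of colour \<open>c e\<close>, and the first one makes these terms
  pairwise coprime. Positive matching decompositions in the sense of Conca and Welker give such colourings,
  with one matching per colour and vertex weights on rapidly decreasing scales.
\<close>

definition positive_colouring ::
  "'n set set \<Rightarrow> ('n set \<Rightarrow> 'd) \<Rightarrow> ('n \<times> 'd \<Rightarrow> nat) \<Rightarrow> bool" where
  "positive_colouring F c w \<longleftrightarrow>
    (\<forall>e\<in>F. \<forall>e'\<in>F. e \<noteq> e' \<and> c e = c e' \<longrightarrow> e \<inter> e' = {}) \<and>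
    (\<forall>e\<in>F. \<forall>l. l \<noteq> c e \<longrightarrow> (\<Sum>x\<in>e. w (x, l)) < (\<Sum>x\<in>e. w (x, c e)))"

definition connected_on :: "'n set \<Rightarrow> 'n set set \<Rightarrow> bool" where
  "connected_on X F \<longleftrightarrow> (\<forall>u\<in>X. \<forall>v\<in>X. (u, v) \<in> {(a, b). {a, b} \<in> F}\<^sup>*)"

text \<open>
  Some colour \<open>k\<close> is free at \<open>p\<close>. The weights of \<open>q\<close> do not occur in the
  conditions on the old edges, so \<open>(q, k)\<close> may get a weight \<open>B\<close> that exceeds all weights at \<open>p\<close>.
\<close>

lemma positive_colouring_add_leaf:
  fixes F :: "'n::finite set set" and c :: "'n set \<Rightarrow> 'd::finite"
  assumes pc: "positive_colouring F c w" and q: "\<And>e. e \<in> F \<Longrightarrow> q \<notin> e" and pq: "p \<noteq> q"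
    and deg: "card {e \<in> F. p \<in> e} < CARD('d)"
  shows "\<exists>(c' :: 'n set \<Rightarrow> 'd) w'. positive_colouring (insert {p, q} F) c' w'"
proof -
  have "card (c ` {e \<in> F. p \<in> e}) < CARD('d)"
    using card_image_le[of "{e \<in> F. p \<in> e}" c] deg by simp
  then obtain k where k: "k \<notin> c ` {e \<in> F. p \<in> e}"
    by (metis UNIV_eq_I less_irrefl)
  define c' where "c' = c({p, q} := k)"
  define B where "B = (\<Sum>l\<in>UNIV. w (p, l)) + 1"
  define w' where "w' = (\<lambda>(x, l). if x = q then (if l = k then B else 0) else w (x, l))"
  have B: "w (p, l) < B" for l
    unfolding B_def using member_le_sum[of l UNIV "\<lambda>l. w (p, l)"] by simp
  have new: "{p, q} \<notin> F" using q by auto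
  have c'F: "c' e = c e" if "e \<in> F" for e using that new by (auto simp: c'_def)
  have c'pq: "c' {p, q} = k" by (simp add: c'_def)
  have w'F: "(\<Sum>x\<in>e. w' (x, l)) = (\<Sum>x\<in>e. w (x, l))" if "e \<in> F" for e l
    using q[OF that] by (intro sum.cong) (auto simp: w'_def)
  have disj: "e \<inter> {p, q} = {}" if "e \<in> F" "c e = k" for e
    using that k q by auto
  have sum_pq: "(\<Sum>x\<in>{p, q}. w' (x, l)) = w (p, l) + (if l = k then B else 0)" for l
    using pq by (simp add: w'_def)
  have "positive_colouring (insert {p, q} F) c' w'"
    unfolding positive_colouring_def
  proof (intro conjI ballI allI impI)
    fix e e' assume "e \<in> insert {p, q} F" "e' \<in> insert {p, q} F" "e \<noteq> e' \<and> c' e = c' e'"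
    then consider "e \<in> F" "e' \<in> F" "c e = c e'" "e \<noteq> e'" | "e = {p, q}" "e' \<in> F" "c e' = k"
      | "e \<in> F" "e' = {p, q}" "c e = k"
      using c'F c'pq by force
    then show "e \<inter> e' = {}"
      using pc disj by cases (auto simp: positive_colouring_def)
  next
    fix e l assume e: "e \<in> insert {p, q} F" and l: "l \<noteq> c' e"
    show "(\<Sum>x\<in>e. w' (x, l)) < (\<Sum>x\<in>e. w' (x, c' e))"
    proof (cases "e = {p, q}")
      case True
      then have "c' e = k" by (simp add: c'_def)
      then show ?thesis using l B[of l] unfolding True sum_pq by simp
    next
      case False
      then have "e \<in> F" using e by simp
      then show ?thesis using pc l c'F w'F by (simp add: positive_colouring_def)
    qed
  qed
  then show ?thesis by blast
qed

text \<open>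
  As long as some vertex is missing, connectedness gives an edge of \<open>E\<close> that leaves \<open>X\<close>. This
  edge is still uncoloured, so fewer than \<open>d\<close> edges at its end in \<open>X\<close> are coloured and its other end
  can be added as a leaf. The difference between the numbers of edges and of vertices stays the same.
\<close>

lemma positive_colouring_extends_to_spanning:
  fixes E F0 :: "'n::finite set set" and c0 :: "'n set \<Rightarrow> 'd::finite"
  assumes E: "simple_graph E" "connected_graph E" "max_degree E \<le> CARD('d)"
    and F0: "F0 \<subseteq> E" "\<Union>F0 \<subseteq> X" "X \<noteq> {}" "connected_on X F0"
    and pc: "positive_colouring F0 c0 w0"
  shows "\<exists>F (c :: 'n set \<Rightarrow> 'd) w. F0 \<subseteq> F \<and> F \<subseteq> E \<and> positive_colouring F c w \<and>
    connected_on UNIV F \<and> card F + card X = CARD('n) + card F0"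
  using F0 pc
proof (induction "card (- X)" arbitrary: X F0 c0 w0 rule: less_induct)
  case less
  show ?case
  proof (cases "X = UNIV")
    case True
    then show ?thesis using less.prems by (intro exI[of _ F0] exI[of _ c0] exI[of _ w0]) auto
  next
    case False
    obtain u v where u: "u \<in> X" and v: "v \<notin> X" using False less.prems(3) by auto
    have "(u, v) \<in> {(a, b). {a, b} \<in> E}\<^sup>*" using E(2) by (simp add: connected_graph_def)
    then have "\<exists>p q. p \<in> X \<and> q \<notin> X \<and> {p, q} \<in> E"
      using u v
    proof (induction rule: rtrancl_induct)
      case (step y z)
      then show ?case by (cases "y \<in> X") auto
    qed auto
    then obtain p q where pq: "p \<in> X" "q \<notin> X" "{p, q} \<in> E" by blast
    have qF: "q \<notin> e" if "e \<in> F0" for e using that less.prems(2) pq(2) by auto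
    have "{p, q} \<notin> F0" using qF by auto
    have "vertex_degree E p \<le> max_degree E" unfolding max_degree_def by (rule Max_ge) auto
    moreover have "card {e \<in> F0. p \<in> e} < vertex_degree E p"
      unfolding vertex_degree_def
      using less.prems(1) pq \<open>{p, q} \<notin> F0\<close> by (intro psubset_card_mono) auto
    ultimately have deg: "card {e \<in> F0. p \<in> e} < CARD('d)" using E(3) by simp
    obtain c1 :: "'n set \<Rightarrow> 'd" and w1 where pc1: "positive_colouring (insert {p, q} F0) c1 w1"
      using positive_colouring_add_leaf[OF less.prems(5) qF _ deg] pq by blast
    have conn: "connected_on (insert q X) (insert {p, q} F0)"
    proof -
      let ?R = "{(a, b). {a, b} \<in> F0}" and ?R' = "{(a, b). {a, b} \<in> insert {p, q} F0}"
      have sub: "?R\<^sup>* \<subseteq> ?R'\<^sup>*" by (rule rtrancl_mono) auto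
      have X: "(a, b) \<in> ?R'\<^sup>*" if "a \<in> X" "b \<in> X" for a b
        using less.prems(4) that sub unfolding connected_on_def by blast
      have pq': "(p, q) \<in> ?R'" "(q, p) \<in> ?R'" by (auto simp: insert_commute)
      have "(q, b) \<in> ?R'\<^sup>*" "(b, q) \<in> ?R'\<^sup>*" if "b \<in> X" for b
        using X[OF pq(1) that] X[OF that pq(1)] pq'
        by (auto intro: converse_rtrancl_into_rtrancl rtrancl_into_rtrancl)
      then show ?thesis unfolding connected_on_def using X by auto
    qed
    have "card (- insert q X) < card (- X)" using pq(2) by (intro psubset_card_mono) auto
    moreover have "insert {p, q} F0 \<subseteq> E" using less.prems(1) pq by simp
    moreover have "\<Union>(insert {p, q} F0) \<subseteq> insert q X" using less.prems(2) pq by auto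
    ultimately obtain F and c :: "'n set \<Rightarrow> 'd" and w where F: "insert {p, q} F0 \<subseteq> F" "F \<subseteq> E" "positive_colouring F c w"
      "connected_on UNIV F" "card F + card (insert q X) = CARD('n) + card (insert {p, q} F0)"
      using less.hyps[OF _ _ _ _ conn pc1] by blast
    have "card F + card X = CARD('n) + card F0"
      using F(5) pq(2) \<open>{p, q} \<notin> F0\<close> by simp
    then show ?thesis using F by blast
  qed
qed

lemma simple_path_exists:
  assumes "(a, b) \<in> {(a, b). {a, b} \<in> F}\<^sup>*"
  shows "\<exists>vs. distinct vs \<and> vs \<noteq> [] \<and> hd vs = a \<and> last vs = b \<and>
    (\<forall>i. Suc i < length vs \<longrightarrow> {vs ! i, vs ! Suc i} \<in> F)"
  using assms
proof (induction rule: rtrancl_induct)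
  case base
  show ?case by (intro exI[of _ "[a]"]) auto
next
  case (step y z)
  then obtain vs where vs: "distinct vs" "vs \<noteq> []" "hd vs = a" "last vs = y"
    "\<And>i. Suc i < length vs \<Longrightarrow> {vs ! i, vs ! Suc i} \<in> F" by blast
  show ?case
  proof (cases "z \<in> set vs")
    case True
    then obtain k where k: "k < length vs" "vs ! k = z" by (auto simp: in_set_conv_nth)
    have "last (take (Suc k) vs) = z" using k by (simp add: take_Suc_conv_app_nth)
    moreover have "hd (take (Suc k) vs) = a" using vs by (simp add: hd_take)
    ultimately show ?thesis
      using vs k by (intro exI[of _ "take (Suc k) vs"]) auto
  next
    case False
    have "{(vs @ [z]) ! i, (vs @ [z]) ! Suc i} \<in> F" if "Suc i < length (vs @ [z])" for i
    proof (cases "Suc i < length vs")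
      case True
      then show ?thesis using vs(5)[OF True] by (simp add: nth_append)
    next
      case F: False
      then have "i = length vs - 1" using that by simp
      then have "vs ! i = y" using vs by (simp add: last_conv_nth)
      moreover have "Suc i = length vs" using F that by simp
      ultimately show ?thesis using step(2) by (simp add: nth_append)
    qed
    then show ?thesis using vs False by (intro exI[of _ "vs @ [z]"]) auto
  qed
qed

text \<open>
  A path in \<open>F\<close> between the ends of the extra edge has at least three vertices, and the extra edge
  closes it.
\<close>

lemma cycle_through_extra_edge:
  assumes E: "simple_graph E" and F: "F \<subseteq> E" "connected_on UNIV F" and e: "e \<in> E" "e \<notin> F"
  shows "\<exists>C. cycle_in E C \<and> e \<in> C"
proof -
  have "card e = 2" using E e by (simp add: simple_graph_def)
  then obtain a b where ab: "e = {a, b}" "a \<noteq> b" by (auto simp: card_2_iff)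
  have "(a, b) \<in> {(a, b). {a, b} \<in> F}\<^sup>*" using F(2) by (simp add: connected_on_def)
  from simple_path_exists[OF this] obtain vs where vs: "distinct vs" "vs \<noteq> []" "hd vs = a" "last vs = b"
    "\<forall>i. Suc i < length vs \<longrightarrow> {vs ! i, vs ! Suc i} \<in> F"
    by (elim exE conjE)
  define n where "n = length vs"
  have ends: "vs ! 0 = a" "vs ! (n - 1) = b"
    using vs by (auto simp: hd_conv_nth last_conv_nth n_def)
  have "n \<noteq> 0" using vs by (simp add: n_def)
  moreover have "n \<noteq> 1" using ends ab by auto
  moreover have "n \<noteq> 2" using vs(5)[rule_format, of 0] ends ab e by (auto simp: n_def)
  ultimately have n: "n \<ge> 3" by simp
  define C where "C = {{vs ! i, vs ! (Suc i mod n)} | i. i < n}"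
  have "{vs ! i, vs ! (Suc i mod n)} \<in> insert e F" if "i < n" for i
  proof (cases "Suc i < n")
    case True
    then show ?thesis using vs(5) by (simp add: n_def)
  next
    case False
    then have "i = n - 1" "Suc i = n" using that by auto
    then show ?thesis using ends ab by auto
  qed
  then have "C \<subseteq> E" using F(1) e(1) by (auto simp: C_def)
  then have "cycle_in E C" unfolding cycle_in_def C_def n_def
    using vs(1) n by (auto simp: n_def)
  moreover have "{vs ! (n - 1), vs ! (Suc (n - 1) mod n)} = e" using ends ab n by auto
  then have "e \<in> C" unfolding C_def using n by (auto intro!: exI[of _ "n - 1"])
  ultimately show ?thesis by blast
qed

text \<open>
  The closing edge gets a colour \<open>\<gamma>\<close> of its own, the edges of the remaining path alternate between
  \<open>\<alpha>\<close> and \<open>\<beta>\<close>. In colour \<open>\<gamma>\<close> the two ends of the path are heavy and the inner vertices are weightless: the sum in colour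
  \<open>\<gamma>\<close> is \<open>6n\<close> on the closing edge and at most \<open>3n\<close> on the path, while the basic weight \<open>2n\<close> in the
  other colours puts their sums between \<open>4n\<close> and \<open>5n\<close>. Along the path the colouring is the one that arises by adding leaves: the \<open>i\<close>-th
  vertex has an extra weight \<open>i\<close> in the colour of the edge by which it was added, which breaks the tie
  between the colours other than \<open>\<gamma>\<close>.
\<close>

lemma positive_colouring_cycle:
  fixes vs :: "'n::finite list"
  assumes dist: "distinct vs" and len: "length vs \<ge> 3" and d: "CARD('d::finite) \<ge> 3"
  defines "C \<equiv> {{vs ! i, vs ! (Suc i mod length vs)} | i. i < length vs}"
  shows "\<exists>(c :: 'n set \<Rightarrow> 'd) w. positive_colouring C c w" and "card C = length vs"
    and "connected_on (set vs) C" and "\<Union>C \<subseteq> set vs"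
proof -
  define n where "n = length vs"
  define nxt where "nxt = (\<lambda>i. Suc i mod n)"
  define edge where "edge = (\<lambda>i. {vs ! i, vs ! nxt i})"
  have n: "n \<ge> 3" using len by (simp add: n_def)
  have C: "C = edge ` {..<n}" by (auto simp: C_def edge_def nxt_def n_def)
  have nxt: "nxt i = (if Suc i < n then Suc i else 0)" if "i < n" for i
    using that by (auto simp: nxt_def not_less_eq less_Suc_eq)
  have nxt_lt: "nxt i < n" if "i < n" for i using nxt[OF that] n by auto
  have vs_eq: "vs ! i = vs ! j \<longleftrightarrow> i = j" if "i < n" "j < n" for i j
    using nth_eq_iff_index_eq[OF dist] that by (simp add: n_def)
  have edge_inj: "inj_on edge {..<n}"
  proof (rule inj_onI)
    fix i j assume i: "i \<in> {..<n}" and j: "j \<in> {..<n}" and eq: "edge i = edge j"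
    then have "i = j \<or> (i = nxt j \<and> nxt i = j)"
      unfolding edge_def doubleton_eq_iff using vs_eq nxt_lt by auto
    then show "i = j" using nxt[of i] nxt[of j] i j n by (auto split: if_splits)
  qed
  show "card C = length vs" unfolding C using card_image[OF edge_inj] by (simp add: n_def)
  show "\<Union>C \<subseteq> set vs" unfolding C edge_def using nxt_lt by (auto simp: n_def)
  show "connected_on (set vs) C"
  proof -
    let ?R = "{(a, b). {a, b} \<in> C}"
    have R0: "(vs ! 0, vs ! i) \<in> ?R\<^sup>* \<and> (vs ! i, vs ! 0) \<in> ?R\<^sup>*" if "i < n" for i
      using that
    proof (induction i)
      case (Suc i)
      then have "edge i \<in> C" unfolding C by auto
      then have "{vs ! i, vs ! Suc i} \<in> C" using nxt[of i] Suc by (simp add: edge_def)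
      then have "(vs ! i, vs ! Suc i) \<in> ?R" "(vs ! Suc i, vs ! i) \<in> ?R"
        by (auto simp: insert_commute)
      then show ?case
        using Suc by (auto intro: converse_rtrancl_into_rtrancl rtrancl_into_rtrancl)
    qed simp
    show ?thesis
      unfolding connected_on_def
    proof (intro ballI)
      fix u v assume "u \<in> set vs" "v \<in> set vs"
      then obtain i j where "i < n" "u = vs ! i" "j < n" "v = vs ! j"
        by (auto simp: in_set_conv_nth n_def)
      then show "(u, v) \<in> ?R\<^sup>*"
        using R0[of i] R0[of j] rtrancl_trans[of u "vs ! 0" ?R v] by blast
    qed
  qed
  obtain S :: "'d set" where "card S = 3" using obtain_subset_with_card_n[OF d] by blast
  then obtain \<alpha> \<beta> \<gamma> :: 'd where abc: "\<alpha> \<noteq> \<beta>" "\<alpha> \<noteq> \<gamma>" "\<beta> \<noteq> \<gamma>" by (auto simp: card_3_iff)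
  define ell where "ell = (\<lambda>i::nat. if even i then \<alpha> else \<beta>)"
  have ell: "ell i \<noteq> \<gamma>" "ell (Suc i) \<noteq> ell i" for i using abc by (auto simp: ell_def)
  define col where "col = (\<lambda>i. if i = n - 1 then \<gamma> else ell i)"
  define om where "om = (\<lambda>i m. if m = \<gamma> then (if i = 0 \<or> i = n - 1 then 3 * n else 0)
    else 2 * n + (if i \<ge> 1 \<and> m = ell (i - 1) then i else 0))"
  define c where "c = (\<lambda>e. col (the_inv_into {..<n} edge e))"
  define w where "w = (\<lambda>(x, m). om (the_inv_into {..<n} (\<lambda>i. vs ! i) x) m)"
  have c: "c (edge i) = col i" if "i < n" for i
    using that the_inv_into_f_f[OF edge_inj] by (simp add: c_def)
  have "inj_on (\<lambda>i. vs ! i) {..<n}" using vs_eq by (auto intro!: inj_onI)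
  then have w: "w (vs ! i, m) = om i m" if "i < n" for i m
    using that the_inv_into_f_f[of "\<lambda>i. vs ! i" "{..<n}" i] by (simp add: w_def)
  have sum: "(\<Sum>x\<in>edge i. w (x, m)) = om i m + om (nxt i) m" if i: "i < n" for i m
  proof -
    have "vs ! i \<noteq> vs ! nxt i" using vs_eq[OF i nxt_lt[OF i]] nxt[OF i] n i by (auto split: if_splits)
    then show ?thesis using w i nxt_lt[OF i] by (simp add: edge_def)
  qed
  have "positive_colouring C c w"
    unfolding positive_colouring_def
  proof (intro conjI ballI allI impI)
    fix e e' assume "e \<in> C" "e' \<in> C" and ne: "e \<noteq> e' \<and> c e = c e'"
    then obtain i j where ij: "e = edge i" "e' = edge j" "i < n" "j < n" unfolding C by auto
    have "i \<noteq> j" "col i = col j" using ne c ij by auto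
    then have lt: "i < n - 1" "j < n - 1" and "ell i = ell j"
      using ij ell by (auto simp: col_def split: if_splits)
    then have "even i = even j" using abc by (auto simp: ell_def split: if_splits)
    then have "i \<noteq> Suc j" "j \<noteq> Suc i" by auto
    then show "e \<inter> e' = {}"
      using ij lt \<open>i \<noteq> j\<close> nxt[of i] nxt[of j] vs_eq by (auto simp: edge_def)
  next
    fix e l assume "e \<in> C" and l: "l \<noteq> c e"
    then obtain i where i: "e = edge i" "i < n" unfolding C by auto
    have "om i l + om (nxt i) l < om i (col i) + om (nxt i) (col i)"
    proof (cases "i = n - 1")
      case True
      then have "nxt i = 0" "l \<noteq> \<gamma>" "col i = \<gamma>" using nxt[of i] i l c n by (auto simp: col_def)
      then show ?thesis using True n by (auto simp: om_def)
    next
      case False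
      then have nx: "nxt i = Suc i" and col: "col i = ell i" and lt: "i < n - 1" and le: "l \<noteq> ell i"
        using nxt[of i] i l c by (auto simp: col_def)
      have "om (Suc i) (ell i) = 2 * n + Suc i" "om i (ell i) \<ge> 2 * n"
        using ell by (auto simp: om_def)
      moreover have "om i l + om (Suc i) l < 4 * n + Suc i"
        using le lt n by (auto simp: om_def)
      ultimately show ?thesis unfolding nx col by linarith
    qed
    then show "(\<Sum>x\<in>e. w (x, l)) < (\<Sum>x\<in>e. w (x, c e))"
      unfolding i(1) sum[OF i(2)] c[OF i(2)] .
  qed
  then show "\<exists>(c :: 'n set \<Rightarrow> 'd) w. positive_colouring C c w" by blast
qed

text \<open>
  Grow from one vertex; an edge that is left over would close a cycle.
\<close>

lemma tree_positive_colouring: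
  fixes E :: "'n::finite set set"
  assumes E: "simple_graph E" "max_degree E \<le> CARD('d::finite)" and t: "tree E"
  shows "\<exists>(c :: 'n set \<Rightarrow> 'd) w. positive_colouring E c w" and "card E + 1 = CARD('n)"
proof -
  have conn: "connected_graph E" using t by (simp add: tree_def)
  have "positive_colouring {} (\<lambda>_. undefined :: 'd) (\<lambda>_. 0)"
    by (simp add: positive_colouring_def)
  from positive_colouring_extends_to_spanning[OF E(1) conn E(2), of "{}" "{undefined}", OF _ _ _ _ this]
  obtain F and c :: "'n set \<Rightarrow> 'd" and w where F: "F \<subseteq> E" "positive_colouring F c w"
    "connected_on UNIV F" "card F + 1 = CARD('n)"
    by (auto simp: connected_on_def)
  have "F = E"
    using cycle_through_extra_edge[OF E(1) F(1,3)] t F(1) by (auto simp: tree_def)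
  then show "\<exists>(c :: 'n set \<Rightarrow> 'd) w. positive_colouring E c w" "card E + 1 = CARD('n)"
    using F by auto
qed

text \<open>
  Grow from the cycle; an edge that is left over would close a second cycle.
\<close>

lemma unicyclic_positive_colouring:
  fixes E :: "'n::finite set set"
  assumes E: "simple_graph E" "max_degree E \<le> CARD('d::finite)" and d: "CARD('d) \<ge> 3"
    and conn: "connected_graph E" and u: "unicyclic E"
  shows "\<exists>(c :: 'n set \<Rightarrow> 'd) w. positive_colouring E c w" and "card E = CARD('n)"
proof -
  obtain C where C: "cycle_in E C" "\<And>C'. cycle_in E C' \<Longrightarrow> C' = C" using u by (auto simp: unicyclic_def)
  then obtain vs where vs: "distinct vs" "length vs \<ge> 3" "C \<subseteq> E"
    and C_def: "C = {{vs ! i, vs ! (Suc i mod length vs)} | i. i < length vs}"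
    unfolding cycle_in_def by blast
  note cyc = positive_colouring_cycle[OF vs(1,2) d, folded C_def]
  obtain c0 :: "'n set \<Rightarrow> 'd" and w0 where pc0: "positive_colouring C c0 w0" using cyc(1) by blast
  have "set vs \<noteq> {}" using vs(2) by auto
  from positive_colouring_extends_to_spanning[OF E(1) conn E(2) vs(3) cyc(4) this cyc(3) pc0]
  obtain F and c :: "'n set \<Rightarrow> 'd" and w where F: "C \<subseteq> F" "F \<subseteq> E" "positive_colouring F c w"
    "connected_on UNIV F" "card F + card (set vs) = CARD('n) + card C"
    by blast
  have "card F = CARD('n)" using F(5) cyc(2) distinct_card[OF vs(1)] by simp
  moreover have "F = E"
    using cycle_through_extra_edge[OF E(1) F(2,4)] C(2) F(1,2) by blast
  ultimately show "\<exists>(c :: 'n set \<Rightarrow> 'd) w. positive_colouring E c w" "card E = CARD('n)"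
    using F by auto
qed

section \<open>LSS-ideals\<close>

text \<open>
  In the order that refines the weights, the leading monomial of \<open>f_e\<close> is its term of colour \<open>c e\<close>. It
  involves only variables in \<open>e \<times> {c e}\<close>, and these sets are disjoint for different edges.
\<close>

lemma LSS_ideal_regular_sequence:
  fixes E :: "'n::finite set set" and c :: "'n set \<Rightarrow> 'd::finite"
  assumes E: "simple_graph E" and pc: "positive_colouring E c w"
  shows "\<exists>fs :: ('n \<times> 'd, 'k::field) mpoly list. regular_sequence fs \<and>
    ideal_gen (set fs) = LSS_ideal E \<and> length fs = card E \<and> (\<forall>f\<in>set fs. homogeneous f 2)"
proof -
  obtain \<rho> :: "('n \<times> 'd \<Rightarrow>\<^sub>0 nat) \<Rightarrow> nat \<times> nat" where "monomial_order \<rho>"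
    and \<rho>: "\<And>m. fst (\<rho> m) = (\<Sum>v\<in>UNIV. w v * Poly_Mapping.lookup m v)"
    using weighted_monomial_order_exists[of w] by blast
  interpret monomial_order \<rho> by fact
  define mon :: "'n \<Rightarrow> 'n \<Rightarrow> 'd \<Rightarrow> ('n \<times> 'd \<Rightarrow>\<^sub>0 nat)"
    where "mon = (\<lambda>i j l. Poly_Mapping.single (i, l) 1 + Poly_Mapping.single (j, l) 1)"
  define f :: "'n \<Rightarrow> 'n \<Rightarrow> ('n \<times> 'd, 'k) mpoly"
    where "f = (\<lambda>i j. \<Sum>l\<in>UNIV. var (i, l) * var (j, l))"
  have f_sym: "f i j = f j i" for i j by (simp add: f_def mult.commute)
  have f_mon: "f i j = (\<Sum>l\<in>UNIV. Poly_Mapping.single (mon i j l) 1)" for i j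
    by (simp add: f_def mon_def var_def mult_single)
  have weight: "fst (\<rho> (mon i j l)) = w (i, l) + w (j, l)" for i j l
  proof -
    have "w v * Poly_Mapping.lookup (Poly_Mapping.single u 1) v = (if v = u then w v else 0)" for u v
      by (simp add: lookup_single when_def)
    then have "(\<Sum>v\<in>UNIV. w v * Poly_Mapping.lookup (Poly_Mapping.single u 1) v) = w u" for u
      by simp
    then show ?thesis
      unfolding \<rho> mon_def by (simp only: lookup_add distrib_left sum.distrib)
  qed
  have "\<exists>i j. e = {i, j} \<and> i \<noteq> j" if "e \<in> E" for e
    using E that by (auto simp: simple_graph_def card_2_iff)
  then obtain a b where ab: "\<And>e. e \<in> E \<Longrightarrow> e = {a e, b e} \<and> a e \<noteq> b e" by metis
  define F where "F = (\<lambda>e. f (a e) (b e))"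
  define M where "M = (\<lambda>e. mon (a e) (b e) (c e))"
  have lead: "leading (F e) (M e)" if e: "e \<in> E" for e
  proof -
    let ?m = "mon (a e) (b e)"
    have less: "\<rho> (?m l) < \<rho> (?m (c e))" if "l \<noteq> c e" for l
    proof -
      have "(\<Sum>x\<in>{a e, b e}. w (x, m)) = w (a e, m) + w (b e, m)" for m
        using ab[OF e, THEN conjunct2] by simp
      then have sum: "(\<Sum>x\<in>e. w (x, m)) = w (a e, m) + w (b e, m)" for m
        unfolding ab[OF e, THEN conjunct1, symmetric] .
      have "(\<Sum>x\<in>e. w (x, l)) < (\<Sum>x\<in>e. w (x, c e))"
        using pc e that unfolding positive_colouring_def by blast
      then have "fst (\<rho> (?m l)) < fst (\<rho> (?m (c e)))" unfolding sum weight .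
      then show ?thesis by (simp add: less_prod_def)
    qed
    have lookup: "Poly_Mapping.lookup (F e) m = (\<Sum>l\<in>UNIV. 1 when ?m l = m)" for m
      unfolding F_def f_mon by (simp add: lookup_sum lookup_single)
    have "(1 when ?m l = ?m (c e)) = (if l = c e then 1 else 0 :: 'k)" for l
      using less[of l] by (cases "l = c e") (auto simp: when_def)
    then have "Poly_Mapping.lookup (F e) (M e) = 1" unfolding lookup M_def by simp
    moreover have "\<rho> m \<le> \<rho> (M e)" if nz: "Poly_Mapping.lookup (F e) m \<noteq> 0" for m
    proof -
      obtain l where "(1 when ?m l = m) \<noteq> (0 :: 'k)"
        using nz unfolding lookup by (rule sum.not_neutral_contains_not_neutral)
      then have "?m l = m" by (simp add: when_def split: if_splits)
      then show ?thesis using less[of l] by (cases "l = c e") (auto simp: M_def)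
    qed
    ultimately show ?thesis by (simp add: leading_def)
  qed
  have keys_M: "Poly_Mapping.keys (M e) \<subseteq> e \<times> {c e}" if "e \<in> E" for e
  proof -
    have "Poly_Mapping.keys (M e) \<subseteq> {(a e, c e), (b e, c e)}"
      unfolding M_def mon_def using Poly_Mapping.keys_add by fastforce
    then show ?thesis using ab[OF that] by blast
  qed
  have disj: "Poly_Mapping.keys (M e) \<inter> Poly_Mapping.keys (M e') = {}"
    if "e \<in> E" "e' \<in> E" "e \<noteq> e'" for e e'
  proof (cases "c e = c e'")
    case True
    then have "e \<inter> e' = {}" using pc that by (simp add: positive_colouring_def)
    then show ?thesis using keys_M[OF that(1)] keys_M[OF that(2)] by blast
  next
    case False
    then show ?thesis using keys_M[OF that(1)] keys_M[OF that(2)] by blast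
  qed
  obtain es where es: "set es = E" "distinct es" using finite_distinct_list[of E] by auto
  define ps where "ps = map (\<lambda>e. (F e, M e)) es"
  have "\<forall>(g, m)\<in>set ps. leading g m" using lead es by (auto simp: ps_def)
  moreover have "sorted_wrt (\<lambda>e e'. Poly_Mapping.keys (M e) \<inter> Poly_Mapping.keys (M e') = {}) es"
    unfolding sorted_wrt_iff_nth_less
  proof (intro allI impI)
    fix i j assume ij: "i < j" "j < length es"
    then have "es ! i \<in> E" "es ! j \<in> E" using es(1) nth_mem[of _ es] by auto
    moreover have "es ! i \<noteq> es ! j" using ij nth_eq_iff_index_eq[OF es(2)] by simp
    ultimately show "Poly_Mapping.keys (M (es ! i)) \<inter> Poly_Mapping.keys (M (es ! j)) = {}"
      by (rule disj)
  qed
  then have "sorted_wrt (\<lambda>(g, m) (g', m'). Poly_Mapping.keys m \<inter> Poly_Mapping.keys m' = {}) ps"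
    by (simp add: ps_def sorted_wrt_map)
  ultimately have "regular_sequence (map fst ps)" using regular_sequence_coprime_leading by blast
  then have reg: "regular_sequence (map F es)" by (simp add: ps_def comp_def)
  have "{f i j | i j. {i, j} \<in> E} = F ` E"
  proof (intro equalityI subsetI)
    fix p assume "p \<in> {f i j | i j. {i, j} \<in> E}"
    then obtain i j where ij: "p = f i j" "{i, j} \<in> E" by auto
    then have "{i, j} = {a {i, j}, b {i, j}}" using ab by blast
    then have "f i j = F {i, j}" unfolding F_def doubleton_eq_iff using f_sym by metis
    then show "p \<in> F ` E" using ij by blast
  next
    fix p assume "p \<in> F ` E"
    then obtain e where e: "e \<in> E" "p = f (a e) (b e)" by (auto simp: F_def)
    then have "{a e, b e} \<in> E" using ab[OF e(1)] by simp
    then show "p \<in> {f i j | i j. {i, j} \<in> E}" using e(2) by blast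
  qed
  then have gen: "ideal_gen (set (map F es)) = LSS_ideal E"
    unfolding LSS_ideal_def using es(1) by (simp add: f_def)
  have "homogeneous (var v * var v' :: ('n \<times> 'd, 'k) mpoly) 2" for v v' :: "'n \<times> 'd"
  proof -
    have "homogeneous (var v :: ('n \<times> 'd, 'k) mpoly) 1" for v :: "'n \<times> 'd"
      by (simp add: homogeneous_def var_def)
    from homogeneous_mult[OF this this] show ?thesis by simp
  qed
  then have "homogeneous (f i j) 2" for i j unfolding f_def by (rule homogeneous_sum)
  then have "\<forall>g\<in>set (map F es). homogeneous g 2" by (auto simp: F_def)
  moreover have "length (map F es) = card E" using es distinct_card by fastforce
  ultimately show ?thesis using reg gen by blast
qed

lemma reg_quotient_LSS_power:
  fixes E :: "'n::finite set set" and c :: "'n set \<Rightarrow> 'd::finite"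
  assumes E: "simple_graph E" and pc: "positive_colouring E c w"
    and s: "s \<ge> 1" and "E \<noteq> {} \<or> s = 1"
  shows "reg_quotient (ideal_power (LSS_ideal E :: ('n \<times> 'd, 'k::field) mpoly set) s) =
    2 * int s + int (card E) - 2"
proof -
  obtain fs :: "('n \<times> 'd, 'k) mpoly list" where fs: "regular_sequence fs"
    "ideal_gen (set fs) = LSS_ideal E" "length fs = card E" "\<forall>f\<in>set fs. homogeneous f 2"
    using LSS_ideal_regular_sequence[OF E pc] by blast
  have "fs \<noteq> [] \<or> s = 1" using assms(4) fs(3) by auto
  then show ?thesis
    using reg_quotient_power_regular_sequence[OF fs(1,4) _ s] fs(2,3) by (simp add: algebra_simps)
qed

theorem proposition4p1:
  fixes E :: "'n::finite set set"
  assumes "simple_graph E"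
    and "CARD('d) \<ge> 3"
    and "max_degree E \<le> CARD('d)"
  shows
    "(tree E \<longrightarrow>
       (\<forall>s\<ge>1. CARD('n) \<ge> 2 \<or> s = 1 \<longrightarrow>
          reg_quotient (ideal_power (LSS_ideal E :: ('n \<times> 'd::finite, 'k::field) mpoly set) s) =
            2 * int s + int CARD('n) - 3)) \<and>
     (connected_graph E \<and> unicyclic E \<longrightarrow>
       (\<forall>s\<ge>1.
          reg_quotient (ideal_power (LSS_ideal E :: ('n \<times> 'd, 'k) mpoly set) s) =
            2 * int s + int CARD('n) - 2))"
proof (intro conjI impI allI)
  fix s :: nat assume "tree E" and s: "1 \<le> s" "2 \<le> CARD('n) \<or> s = 1"
  note t = tree_positive_colouring[OF assms(1,3) \<open>tree E\<close>]
  obtain c :: "'n set \<Rightarrow> 'd" and w where pc: "positive_colouring E c w" using t(1) by blast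
  have "E \<noteq> {} \<or> s = 1" using t(2) s(2) by auto
  from reg_quotient_LSS_power[OF assms(1) pc s(1) this]
  show "reg_quotient (ideal_power (LSS_ideal E :: ('n \<times> 'd, 'k) mpoly set) s) =
      2 * int s + int CARD('n) - 3"
    unfolding t(2)[symmetric] by simp
next
  fix s :: nat assume "connected_graph E \<and> unicyclic E" and s: "1 \<le> s"
  then have u: "connected_graph E" "unicyclic E" by auto
  note t = unicyclic_positive_colouring[OF assms(1,3,2) u]
  obtain c :: "'n set \<Rightarrow> 'd" and w where pc: "positive_colouring E c w" using t(1) by blast
  have "E \<noteq> {} \<or> s = 1" using t(2) by (metis card.empty zero_less_card_finite less_irrefl)
  from reg_quotient_LSS_power[OF assms(1) pc s this]
  show "reg_quotient (ideal_power (LSS_ideal E :: ('n \<times> 'd, 'k) mpoly set) s) =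
      2 * int s + int CARD('n) - 2"
    using t(2) by simp
qed

end
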